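(* Let $\mathbb{F}$ be a field with $\mathrm{char}(\mathbb{F})\neq 2,3$. Every ideal of $\hat{\mathcal{H}}$ is invariant under $\mathrm{Aut}(\hat{\mathcal{H}})$. In particular, every quotient of $\hat{\mathcal{H}}$ by a proper ideal, and so also every quotient of the Highwater algebra $\mathcal{H}$ by a proper ideal, is symmetric.
   Context: Notation: $\mathbb{N}=\{1,2,3,\dots\}$, $3\mathbb{N}=\{3,6,9,\dots\}$; for $r\in\mathbb{Z}$, $\bar r=r+3\mathbb{Z}\in\mathbb{Z}_3$. The algebra $\hat{\mathcal{H}}$ is the commutative $\mathbb{F}$-algebra with basis $\{a_i:i\in\mathbb{Z}\}\cup\{s_j:j\in\mathbb{N}\}\cup\{p_{\bar r,k}:\bar r\in\{\bar1,\bar2\},\ k\in 3\mathbb{N}\}$, where $s_0=0$, $p_{\bar r,j}=0$ for all $\bar r$ whenever $j\notin 3\mathbb{N}$, $p_{\bar 0,j}=-p_{\bar1,j}-p_{\bar2,j}$, $z_{\bar r,j}=p_{\bar r+\bar1,j}-p_{\bar r-\bar1,j}$, and for $i,i'\in\mathbb{Z}$, $j,l\in\mathbb{N}$, $h,k\in3\mathbb{N}$, $\bar r,\bar t\in\mathbb{Z}_3$: (H1) $a_ia_{i'}=\tfrac12(a_i+a_{i'})+s_{|i-i'|}+z_{\bar\imath,|i-i'|}$; (H2) $a_is_j=-\tfrac34a_i+\tfrac38(a_{i-j}+a_{i+j})+\tfrac32 s_j-z_{\bar\imath,j}$; (H3) $a_ip_{\bar r,k}=\tfrac32p_{\bar r,k}-p_{-(\bar\imath+\bar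 r),k}$; (H4) $s_js_l=\tfrac34(s_j+s_l)-\tfrac38(s_{|j-l|}+s_{j+l})$; (H5) $s_jp_{\bar r,k}=\tfrac34(p_{\bar r,j}+p_{\bar r,k})-\tfrac38(p_{\bar r,|j-k|}+p_{\bar r,j+k})$; (H6) $p_{\bar r,h}p_{\bar t,k}=\tfrac14(z_{-(\bar r+\bar t),h}+z_{-(\bar r+\bar t),k})-\tfrac18(z_{-(\bar r+\bar t),|h-k|}+z_{-(\bar r+\bar t),h+k})$. The Highwater algebra $\mathcal{H}$ is the commutative algebra with basis $\{a_i:i\in\mathbb{Z}\}\cup\{s_j:j\in\mathbb{N}\}$, $s_0=0$, and products $a_ia_{i'}=\tfrac12(a_i+a_{i'})+s_{|i-i'|}$, $a_is_j=-\tfrac34a_i+\tfrac38(a_{i-j}+a_{i+j})+\tfrac32s_j$, $s_js_l=\tfrac34(s_j+s_l)-\tfrac38(s_{|j-l|}+s_{j+l})$; it is $\hat{\mathcal{H}}/J$ with $J=\langle p_{\bar1,j},p_{\bar2,j}:j\in3\mathbb{N}\rangle$. A quotient $A$ of $\hat{\mathcal{H}}$ or $\mathcal{H}$ is called symmetric if $A$ is generated as an algebra by the images $\bar a_0,\bar a_1$ of $a_0,a_1$ and there is an involutory automorphism of $A$ interchanging $\bar a_0$ and $\bar a_1$. *)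

theory Defs
  imports Complex_Main "HOL-Library.Function_Algebras"
begin

record ('v, 'a) alg =
  acar   :: "'v set"
  aadd   :: "'v \<Rightarrow> 'v \<Rightarrow> 'v"
  asmult :: "'a \<Rightarrow> 'v \<Rightarrow> 'v"
  amult  :: "'v \<Rightarrow> 'v \<Rightarrow> 'v"

definition alg_closed :: "('v, 'a) alg \<Rightarrow> 'v set \<Rightarrow> bool" where
  "alg_closed R B \<longleftrightarrow> B \<subseteq> acar R \<and>
     (\<forall>x\<in>B. \<forall>y\<in>B. aadd R x y \<in> B \<and> amult R x y \<in> B) \<and>
     (\<forall>c. \<forall>x\<in>B. asmult R c x \<in> B)"

definition alg_generated_by :: "('v, 'a) alg \<Rightarrow> 'v set \<Rightarrow> bool" where
  "alg_generated_by R X \<longleftrightarrow> X \<subseteq> acar R \<and>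
     (\<forall>B. alg_closed R B \<and> X \<subseteq> B \<longrightarrow> B = acar R)"

definition alg_ideal :: "('v, 'a) alg \<Rightarrow> 'v set \<Rightarrow> bool" where
  "alg_ideal R I \<longleftrightarrow> I \<subseteq> acar R \<and> I \<noteq> {} \<and>
     (\<forall>x\<in>I. \<forall>y\<in>I. aadd R x y \<in> I) \<and>
     (\<forall>c. \<forall>x\<in>I. asmult R c x \<in> I) \<and>
     (\<forall>x\<in>I. \<forall>y\<in>acar R. amult R y x \<in> I \<and> amult R x y \<in> I)"

definition alg_aut :: "('v, 'a) alg \<Rightarrow> ('v \<Rightarrow> 'v) \<Rightarrow> bool" where
  "alg_aut R \<phi> \<longleftrightarrow> bij_betw \<phi> (acar R) (acar R) \<and>
     (\<forall>x\<in>acar R. \<forall>y\<in>acar R. \<phi> (aadd R x y) = aadd R (\<phi> x) (\<phi> y)) \<and>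
     (\<forall>c. \<forall>x\<in>acar R. \<phi> (asmult R c x) = asmult R c (\<phi> x)) \<and>
     (\<forall>x\<in>acar R. \<forall>y\<in>acar R. \<phi> (amult R x y) = amult R (\<phi> x) (\<phi> y))"

definition coset :: "('v, 'a) alg \<Rightarrow> 'v set \<Rightarrow> 'v \<Rightarrow> 'v set" where
  "coset R I v = {aadd R v w | w. w \<in> I}"

definition quot_alg :: "('v, 'a) alg \<Rightarrow> 'v set \<Rightarrow> ('v set, 'a) alg" where
  "quot_alg R I =
     \<lparr> acar = coset R I ` acar R,
       aadd = (\<lambda>X Y. {aadd R x y | x y. x \<in> X \<and> y \<in> Y}),
       asmult = (\<lambda>c X. {aadd R (asmult R c x) w | x w. x \<in> X \<and> w \<in> I}),
       amult = (\<lambda>X Y. {aadd R (amult R x y) w | x y w. x \<in> X \<and> y \<in> Y \<and> w \<in> I}) \<rparr>"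

definition alg_symmetric :: "('v, 'a) alg \<Rightarrow> 'v \<Rightarrow> 'v \<Rightarrow> bool" where
  "alg_symmetric R b0 b1 \<longleftrightarrow> alg_generated_by R {b0, b1} \<and>
     (\<exists>\<phi>. alg_aut R \<phi> \<and> (\<forall>x\<in>acar R. \<phi> (\<phi> x) = x) \<and> \<phi> b0 = b1 \<and> \<phi> b1 = b0)"

text \<open>Basis indices: A i = a_i, S j = s_j (j \<ge> 1), P r k = p_{r,k} (r \<in> {1,2}, k \<in> 3\<nat>).\<close>
datatype hidx = A int | S nat | P int nat

fun valid_hat :: "hidx \<Rightarrow> bool" where
  "valid_hat (A i) = True"
| "valid_hat (S j) = (1 \<le> j)"
| "valid_hat (P r k) = (r \<in> {1, 2} \<and> 0 < k \<and> 3 dvd k)"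

fun valid_hw :: "hidx \<Rightarrow> bool" where
  "valid_hw (A i) = True"
| "valid_hw (S j) = (1 \<le> j)"
| "valid_hw (P r k) = False"

definition sm :: "'a::field \<Rightarrow> (hidx \<Rightarrow> 'a) \<Rightarrow> (hidx \<Rightarrow> 'a)" where
  "sm c v = (\<lambda>x. c * v x)"

definition uvec :: "hidx \<Rightarrow> hidx \<Rightarrow> 'a::field" where
  "uvec i = (\<lambda>x. if x = i then 1 else 0)"

definition aV :: "int \<Rightarrow> hidx \<Rightarrow> 'a::field" where
  "aV i = uvec (A i)"

definition sV :: "nat \<Rightarrow> hidx \<Rightarrow> 'a::field" where
  "sV j = (if j = 0 then 0 else uvec (S j))"

definition pV :: "int \<Rightarrow> nat \<Rightarrow> hidx \<Rightarrow> 'a::field" where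
  "pV r j = (if j = 0 \<or> \<not> 3 dvd j then 0
             else if r mod 3 = 1 then uvec (P 1 j)
             else if r mod 3 = 2 then uvec (P 2 j)
             else - uvec (P 1 j) - uvec (P 2 j))"

definition zV :: "int \<Rightarrow> nat \<Rightarrow> hidx \<Rightarrow> 'a::field" where
  "zV r j = pV (r + 1) j - pV (r - 1) j"

definition prodAA :: "int \<Rightarrow> int \<Rightarrow> hidx \<Rightarrow> 'a::field" where
  "prodAA i i' = sm (1/2) (aV i + aV i') + sV (nat \<bar>i - i'\<bar>) + zV i (nat \<bar>i - i'\<bar>)"

definition prodAS :: "int \<Rightarrow> nat \<Rightarrow> hidx \<Rightarrow> 'a::field" where
  "prodAS i j = sm (- 3/4) (aV i) + sm (3/8) (aV (i - int j) + aV (i + int j))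
                + sm (3/2) (sV j) - zV i j"

definition prodAP :: "int \<Rightarrow> int \<Rightarrow> nat \<Rightarrow> hidx \<Rightarrow> 'a::field" where
  "prodAP i r k = sm (3/2) (pV r k) - pV (- (i + r)) k"

definition prodSS :: "nat \<Rightarrow> nat \<Rightarrow> hidx \<Rightarrow> 'a::field" where
  "prodSS j l = sm (3/4) (sV j + sV l) - sm (3/8) (sV (nat \<bar>int j - int l\<bar>) + sV (j + l))"

definition prodSP :: "nat \<Rightarrow> int \<Rightarrow> nat \<Rightarrow> hidx \<Rightarrow> 'a::field" where
  "prodSP j r k = sm (3/4) (pV r j + pV r k)
                  - sm (3/8) (pV r (nat \<bar>int j - int k\<bar>) + pV r (j + k))"

definition prodPP :: "int \<Rightarrow> nat \<Rightarrow> int \<Rightarrow> nat \<Rightarrow> hidx \<Rightarrow> 'a::field" where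
  "prodPP r h t k = sm (1/4) (zV (- (r + t)) h + zV (- (r + t)) k)
                    - sm (1/8) (zV (- (r + t)) (nat \<bar>int h - int k\<bar>) + zV (- (r + t)) (h + k))"

fun bprod_hat :: "hidx \<Rightarrow> hidx \<Rightarrow> hidx \<Rightarrow> 'a::field" where
  "bprod_hat (A i) (A i') = prodAA i i'"
| "bprod_hat (A i) (S j) = prodAS i j"
| "bprod_hat (S j) (A i) = prodAS i j"
| "bprod_hat (A i) (P r k) = prodAP i r k"
| "bprod_hat (P r k) (A i) = prodAP i r k"
| "bprod_hat (S j) (S l) = prodSS j l"
| "bprod_hat (S j) (P r k) = prodSP j r k"
| "bprod_hat (P r k) (S j) = prodSP j r k"
| "bprod_hat (P r h) (P t k) = prodPP r h t k"

text \<open>Products of basis elements of the Highwater algebra \<open>\<H>\<close> (p-indices do not occur).\<close>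
fun bprod_hw :: "hidx \<Rightarrow> hidx \<Rightarrow> hidx \<Rightarrow> 'a::field" where
  "bprod_hw (A i) (A i') = sm (1/2) (aV i + aV i') + sV (nat \<bar>i - i'\<bar>)"
| "bprod_hw (A i) (S j) = sm (- 3/4) (aV i) + sm (3/8) (aV (i - int j) + aV (i + int j)) + sm (3/2) (sV j)"
| "bprod_hw (S j) (A i) = sm (- 3/4) (aV i) + sm (3/8) (aV (i - int j) + aV (i + int j)) + sm (3/2) (sV j)"
| "bprod_hw (S j) (S l) = prodSS j l"
| "bprod_hw _ _ = 0"

definition supp :: "(hidx \<Rightarrow> 'a::zero) \<Rightarrow> hidx set" where
  "supp v = {x. v x \<noteq> 0}"

definition bilin_mult :: "(hidx \<Rightarrow> hidx \<Rightarrow> hidx \<Rightarrow> 'a::field) \<Rightarrow> (hidx \<Rightarrow> 'a) \<Rightarrow> (hidx \<Rightarrow> 'a) \<Rightarrow> hidx \<Rightarrow> 'a" where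
  "bilin_mult B v w = (\<lambda>x. \<Sum>i\<in>supp v. \<Sum>j\<in>supp w. v i * w j * B i j x)"

definition Hhat :: "(hidx \<Rightarrow> 'a::field, 'a) alg" where
  "Hhat = \<lparr> acar = {v. finite (supp v) \<and> (\<forall>x\<in>supp v. valid_hat x)},
            aadd = (+), asmult = sm, amult = bilin_mult bprod_hat \<rparr>"

definition Highwater :: "(hidx \<Rightarrow> 'a::field, 'a) alg" where
  "Highwater = \<lparr> acar = {v. finite (supp v) \<and> (\<forall>x\<in>supp v. valid_hw x)},
            aadd = (+), asmult = sm, amult = bilin_mult bprod_hw \<rparr>"

end

theory Submission
  imports Defs
begin

text \<open>Let \<open>\<tau>\<close> be the reflection of the index set \<open>\<int>\<close> in \<open>0\<close> and \<open>T\<close> the translation by \<open>1\<close>.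
  Multiplication by \<open>a\<^sub>0\<close> has the eigenvalues \<open>1, 0, 2, 1/2, 5/2\<close>, among which at most \<open>0\<close> and \<open>5/2\<close>
  coincide (in characteristic 5), and \<open>\<tau>\<close> is \<open>-1\<close> on the \<open>1/2\<close>-eigenspace and \<open>1\<close> on the others. Hence an ideal
  contains the components of its elements in these eigenspaces (with \<open>0\<close> and \<open>5/2\<close> taken together)
  and is \<open>\<tau>\<close>-invariant. On each component \<open>T\<close> can be expressed by products with \<open>a\<^sub>0, a\<^sub>1, a\<^sub>2, s\<^sub>1\<close>,
  up to elements of the span of the \<open>p\<^sub>r\<^sub>,\<^sub>k\<close>, on which the \<open>a\<^sub>i\<close> act through reflections that generate \<open>T\<close>.
  So every ideal is invariant under the infinite dihedral group generated by \<open>\<tau>\<close> and \<open>T\<close>.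

  Comparing leading terms, the only nonzero idempotents are the \<open>a\<^sub>i\<close>, so an automorphism permutes them.
  Since the image of \<open>s\<^sub>1\<close> determines the distance of the images of \<open>a\<^sub>i\<close> and \<open>a\<^sub>i\<^sub>+\<^sub>1\<close>, this
  distance is constant, and it is \<open>1\<close> by surjectivity. As \<open>a\<^sub>0\<close> and \<open>a\<^sub>1\<close> generate the algebra, every
  automorphism is dihedral. The flip \<open>i \<mapsto> 1 - i\<close> descends to all quotients; the Highwater algebra is
  treated by pulling its ideals back along the projection that kills the \<open>p\<^sub>r\<^sub>,\<^sub>k\<close>.\<close>

section \<open>Finitely supported vectors and bilinear products\<close>

definition vecs :: "(hidx \<Rightarrow> bool) \<Rightarrow> (hidx \<Rightarrow> 'a::field) set" where
  "vecs ok = {v. finite (supp v) \<and> (\<forall>x\<in>supp v. ok x)}"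

definition ext :: "(hidx \<Rightarrow> hidx \<Rightarrow> 'a::field) \<Rightarrow> (hidx \<Rightarrow> 'a) \<Rightarrow> hidx \<Rightarrow> 'a" where
  "ext f v = (\<lambda>x. \<Sum>b\<in>supp v. v b * f b x)"

lemma sm_apply [simp]: "sm c v x = c * v x"
  by (simp add: sm_def)

lemma sm_simps [simp]:
  "sm 0 v = 0" "sm c 0 = 0" "sm 1 v = v" "sm c (sm d v) = sm (c * d) v"
  by (auto simp: fun_eq_iff)

lemma sm_distribs:
  "sm c (v + w) = sm c v + sm c w" "sm c (v - w) = sm c v - sm c w" "sm c (- v) = - sm c v"
  "sm (c + d) v = sm c v + sm d v"
  by (auto simp: fun_eq_iff algebra_simps)

lemma sm_minus_one: "sm (- 1) v = - v"
  by (auto simp: fun_eq_iff)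

lemma supp_add: "supp (v + w :: hidx \<Rightarrow> 'a::field) \<subseteq> supp v \<union> supp w"
  by (auto simp: supp_def)

lemma supp_sm: "supp (sm c v) \<subseteq> supp v"
  by (auto simp: supp_def)

lemma supp_uvec: "supp (uvec b :: hidx \<Rightarrow> 'a::field) = {b}"
  by (auto simp: supp_def uvec_def)

lemma vecs_add [simp]: "v \<in> vecs ok \<Longrightarrow> w \<in> vecs ok \<Longrightarrow> v + w \<in> vecs ok"
  using supp_add[of v w] by (auto simp: vecs_def intro: finite_subset)

lemma vecs_sm [simp]: "v \<in> vecs ok \<Longrightarrow> sm c v \<in> vecs ok"
  using supp_sm[of c v] by (auto simp: vecs_def intro: finite_subset)

lemma vecs_zero [simp]: "0 \<in> vecs ok"
  by (simp add: vecs_def supp_def)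

lemma vecs_uminus [simp]: "v \<in> vecs ok \<Longrightarrow> - v \<in> vecs ok"
  using vecs_sm[of v ok "- 1"] by (simp add: sm_minus_one)

lemma vecs_diff [simp]: "v \<in> vecs ok \<Longrightarrow> w \<in> vecs ok \<Longrightarrow> v - w \<in> vecs ok"
  using vecs_add[of v ok "- w"] by simp

lemma vecs_uvec [simp]: "uvec b \<in> vecs ok \<longleftrightarrow> ok b"
  by (simp add: vecs_def supp_uvec)

lemma vecs_sum: "(\<And>i. i \<in> X \<Longrightarrow> f i \<in> vecs ok) \<Longrightarrow> sum f X \<in> vecs ok"
  by (induction X rule: infinite_finite_induct) auto

lemma sum_fun_apply: "(\<Sum>i\<in>X. f i) x = (\<Sum>i\<in>X. f i x)" for f :: "'b \<Rightarrow> hidx \<Rightarrow> 'a::field"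
  by (induction X rule: infinite_finite_induct) auto

lemma ext_conv_sum: "ext f v = (\<Sum>b\<in>supp v. sm (v b) (f b))"
  by (rule ext) (simp add: ext_def sum_fun_apply)

lemma ext_superset:
  assumes "finite X" "supp v \<subseteq> X"
  shows "ext f v x = (\<Sum>b\<in>X. v b * f b x)"
  unfolding ext_def by (rule sum.mono_neutral_left) (use assms in \<open>auto simp: supp_def\<close>)

lemma ext_add_arg:
  assumes "finite (supp v)" "finite (supp w)"
  shows "ext f (v + w) = ext f v + ext f w"
proof
  fix x
  let ?X = "supp v \<union> supp w"
  have "finite ?X" using assms by simp
  moreover have "supp (v + w) \<subseteq> ?X" by (rule supp_add)
  ultimately show "ext f (v + w) x = (ext f v + ext f w) x"
    by (simp add: ext_superset[of ?X] sum.distrib algebra_simps)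
qed

lemma ext_sm_arg:
  assumes "finite (supp v)"
  shows "ext f (sm c v) = sm c (ext f v)"
proof
  fix x
  show "ext f (sm c v) x = sm c (ext f v) x"
    using assms by (simp add: ext_superset[of "supp v"] supp_sm sum_distrib_left algebra_simps)
qed

lemma ext_uvec [simp]: "ext f (uvec b) = f b"
  by (rule ext) (simp add: ext_def supp_uvec, simp add: uvec_def)

lemma ext_zero [simp]: "ext f 0 = 0"
  by (rule ext) (simp add: ext_def supp_def)

lemma ext_add_fun: "ext (\<lambda>b. f b + g b) v = ext f v + ext g v"
  by (rule ext) (simp add: ext_def sum.distrib algebra_simps)

lemma ext_sm_fun: "ext (\<lambda>b. sm c (f b)) v = sm c (ext f v)"
  by (rule ext) (simp add: ext_def sum_distrib_left algebra_simps)

lemma ext_in_vecs: "v \<in> vecs ok \<Longrightarrow> (\<And>b. ok b \<Longrightarrow> f b \<in> vecs ok') \<Longrightarrow> ext f v \<in> vecs ok'"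
  unfolding ext_conv_sum by (rule vecs_sum) (auto simp: vecs_def[of ok])

lemma bilin_mult_conv_ext: "bilin_mult B v w = ext (\<lambda>i. ext (B i) w) v"
  by (rule ext) (simp add: bilin_mult_def ext_def sum_distrib_left algebra_simps)

section \<open>Linear maps on finitely supported vectors\<close>

definition lin_on :: "(hidx \<Rightarrow> bool) \<Rightarrow> ((hidx \<Rightarrow> 'a::field) \<Rightarrow> hidx \<Rightarrow> 'a) \<Rightarrow> bool" where
  "lin_on ok F \<longleftrightarrow> (\<forall>x\<in>vecs ok. \<forall>y\<in>vecs ok. F (x + y) = F x + F y) \<and>
     (\<forall>c. \<forall>x\<in>vecs ok. F (sm c x) = sm c (F x))"

lemma lin_onI:
  assumes "\<And>x y. x \<in> vecs ok \<Longrightarrow> y \<in> vecs ok \<Longrightarrow> F (x + y) = F x + F y"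
    and "\<And>c x. x \<in> vecs ok \<Longrightarrow> F (sm c x) = sm c (F x)"
  shows "lin_on ok F"
  using assms by (auto simp: lin_on_def)

lemma lin_onD:
  assumes "lin_on ok F" "x \<in> vecs ok"
  shows "y \<in> vecs ok \<Longrightarrow> F (x + y) = F x + F y" "F (sm c x) = sm c (F x)"
  using assms by (auto simp: lin_on_def)

lemma lin_on_more:
  assumes "lin_on ok F" "x \<in> vecs ok"
  shows "F (- x) = - F x" "y \<in> vecs ok \<Longrightarrow> F (x - y) = F x - F y" "F 0 = 0"
proof -
  have neg: "F (- x) = - F x" if "x \<in> vecs ok" for x
    using lin_onD(2)[OF assms(1) that, of "- 1"] by (simp add: sm_minus_one)
  then show "F (- x) = - F x" using assms(2) .
  show "F (x - y) = F x - F y" if "y \<in> vecs ok"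
    using lin_onD(1)[OF assms vecs_uminus[OF that]] that by (simp add: neg)
  show "F 0 = 0"
    using lin_onD(2)[OF assms, of 0] by simp
qed

lemma lin_on_ext [simp]: "lin_on ok (ext f)"
  by (rule lin_onI) (auto simp: vecs_def ext_add_arg ext_sm_arg)

lemma vecs_induct [consumes 1, case_names zero step]:
  assumes "v \<in> vecs ok" "Q 0"
    and "\<And>c b v. ok b \<Longrightarrow> v \<in> vecs ok \<Longrightarrow> Q v \<Longrightarrow> Q (sm c (uvec b) + v)"
  shows "Q v"
proof -
  have "\<forall>v. supp v \<subseteq> X \<and> v \<in> vecs ok \<longrightarrow> Q v" if "finite X" for X
    using that
  proof (induction X rule: finite_induct)
    case empty
    have "v = 0" if "supp v = {}" for v :: "hidx \<Rightarrow> 'a"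
      using that by (auto simp: supp_def fun_eq_iff)
    then show ?case using assms(2) by auto
  next
    case (insert b X)
    show ?case
    proof (intro allI impI)
      fix v :: "hidx \<Rightarrow> 'a" assume v: "supp v \<subseteq> insert b X \<and> v \<in> vecs ok"
      show "Q v"
      proof (cases "b \<in> supp v")
        case False
        then show ?thesis using v insert.IH by blast
      next
        case True
        then have ok: "ok b" using v by (auto simp: vecs_def)
        define w where "w = v - sm (v b) (uvec b)"
        have w: "w \<in> vecs ok" using v ok by (simp add: w_def)
        have "supp w \<subseteq> X" using v by (auto simp: w_def supp_def uvec_def split: if_splits)
        then have "Q (sm (v b) (uvec b) + w)"
          using assms(3)[OF ok w] w insert.IH by blast
        then show ?thesis by (simp add: w_def)
      qed
    qed
  qed
  from this[of "supp v"] assms(1) show ?thesis by (auto simp: vecs_def)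
qed

lemma lin_on_eqI:
  assumes "lin_on ok F" "lin_on ok G" "\<And>b. ok b \<Longrightarrow> F (uvec b) = G (uvec b)" "v \<in> vecs ok"
  shows "F v = G v"
proof (rule vecs_induct[OF assms(4), of "\<lambda>v. F v = G v"], goal_cases)
  case 1
  show ?case
    using lin_on_more(3)[OF assms(1) vecs_zero] lin_on_more(3)[OF assms(2) vecs_zero] by (simp only:)
next
  case (2 c b v)
  have b: "uvec b \<in> vecs ok" using 2 by simp
  have "H (sm c (uvec b) + v) = sm c (H (uvec b)) + H v" if "lin_on ok H" for H
    using lin_onD(1)[OF that vecs_sm[OF b] 2(2)] lin_onD(2)[OF that b] by simp
  from this[OF assms(1)] this[OF assms(2)] show ?case
    using assms(3)[OF 2(1)] 2(3) by simp
qed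

lemma lin_on_intros:
  "lin_on ok (\<lambda>x. x)"
  "lin_on ok F \<Longrightarrow> lin_on ok (\<lambda>x. sm c (F x))"
  "lin_on ok F \<Longrightarrow> lin_on ok G \<Longrightarrow> lin_on ok (\<lambda>x. F x + G x)"
  "lin_on ok F \<Longrightarrow> lin_on ok G \<Longrightarrow> lin_on ok (\<lambda>x. F x - G x)"
  "lin_on ok F \<Longrightarrow> lin_on ok (\<lambda>x. - F x)"
  by (auto simp: lin_on_def sm_distribs algebra_simps)

lemma lin_on_comp:
  assumes "lin_on ok' F" "lin_on ok G" "\<And>x. x \<in> vecs ok \<Longrightarrow> G x \<in> vecs ok'"
  shows "lin_on ok (\<lambda>x. F (G x))"
  using assms by (auto simp: lin_on_def)

section \<open>Bilinear products\<close>

lemma lin_on_mult_left: "y \<in> vecs ok' \<Longrightarrow> lin_on ok (\<lambda>x. bilin_mult B x y)"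
  unfolding bilin_mult_conv_ext by simp

lemma bilin_mult_simps:
  assumes "x \<in> vecs ok" "y \<in> vecs ok" "z \<in> vecs ok"
  shows "bilin_mult B (x + y) z = bilin_mult B x z + bilin_mult B y z"
    "bilin_mult B (sm c x) z = sm c (bilin_mult B x z)"
    "bilin_mult B z (x + y) = bilin_mult B z x + bilin_mult B z y"
    "bilin_mult B z (sm c x) = sm c (bilin_mult B z x)"
proof -
  show "bilin_mult B (x + y) z = bilin_mult B x z + bilin_mult B y z"
    "bilin_mult B (sm c x) z = sm c (bilin_mult B x z)"
    unfolding bilin_mult_conv_ext using assms by (auto simp: lin_onD[OF lin_on_ext])
  have fin: "finite (supp x)" "finite (supp y)" using assms by (auto simp: vecs_def)
  show "bilin_mult B z (x + y) = bilin_mult B z x + bilin_mult B z y"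
    unfolding bilin_mult_conv_ext ext_add_arg[OF fin] by (simp add: ext_add_fun)
  show "bilin_mult B z (sm c x) = sm c (bilin_mult B z x)"
    unfolding bilin_mult_conv_ext ext_sm_arg[OF fin(1)] by (simp add: ext_sm_fun)
qed

lemma lin_on_mult_right: "y \<in> vecs ok \<Longrightarrow> lin_on ok (\<lambda>x. bilin_mult B y x)"
  by (rule lin_onI) (auto simp: bilin_mult_simps)

lemma bilin_mult_uvec [simp]: "bilin_mult B (uvec i) (uvec j) = B i j"
  by (simp add: bilin_mult_conv_ext)

lemma bilin_mult_in_vecs:
  assumes "\<And>i j. ok i \<Longrightarrow> ok j \<Longrightarrow> B i j \<in> vecs ok" "v \<in> vecs ok" "w \<in> vecs ok"
  shows "bilin_mult B v w \<in> vecs ok"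
  unfolding bilin_mult_conv_ext using assms by (intro ext_in_vecs[where ok = ok]) auto

lemma bilin_mult_commute:
  assumes "\<And>i j. B i j = B j i"
  shows "bilin_mult B v w = bilin_mult B w v"
proof
  fix x
  show "bilin_mult B v w x = bilin_mult B w v x"
    unfolding bilin_mult_def by (subst sum.swap) (simp add: assms[of _ "_ :: hidx"] mult.commute assms)
qed

text \<open>Both sides are linear in each factor, so the identity passes from pairs of basis vectors
  to pairs \<open>uvec i\<close>, \<open>w\<close>, and from there to all pairs.\<close>

lemma bilin_mult_hom:
  assumes v: "v \<in> vecs ok" and w: "w \<in> vecs ok"
    and cl: "\<And>i j. ok i \<Longrightarrow> ok j \<Longrightarrow> B i j \<in> vecs ok"
    and f: "\<And>b. ok b \<Longrightarrow> f b \<in> vecs ok'"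
    and hom: "\<And>i j. ok i \<Longrightarrow> ok j \<Longrightarrow> ext f (B i j) = bilin_mult B' (f i) (f j)"
  shows "ext f (bilin_mult B v w) = bilin_mult B' (ext f v) (ext f w)"
proof -
  have *: "ext f (bilin_mult B (uvec i) w) = bilin_mult B' (f i) (ext f w)" if i: "ok i" for i
  proof (rule lin_on_eqI[OF _ _ _ w])
    show "lin_on ok (\<lambda>w. ext f (bilin_mult B (uvec i) w))"
      by (rule lin_on_comp[where ok' = ok]) (auto intro!: lin_on_mult_right bilin_mult_in_vecs cl i)
    show "lin_on ok (\<lambda>w. bilin_mult B' (f i) (ext f w))"
      by (rule lin_on_comp[where ok' = ok']) (auto intro!: lin_on_mult_right f i ext_in_vecs)
  qed (use hom i in simp)
  show ?thesis
  proof (rule lin_on_eqI[OF _ _ _ v])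
    show "lin_on ok (\<lambda>v. ext f (bilin_mult B v w))"
      by (rule lin_on_comp[where ok' = ok]) (auto intro!: lin_on_mult_left[OF w] bilin_mult_in_vecs cl w)
    show "lin_on ok (\<lambda>v. bilin_mult B' (ext f v) (ext f w))"
      by (rule lin_on_comp[where ok' = ok'])
        (auto intro!: lin_on_mult_left[of _ ok'] ext_in_vecs[OF w] f ext_in_vecs)
  qed (use * in simp)
qed
text \<open>Vectors are functions. Without these deletions the simplifier rewrites below \<open>\<eta>\<close>-expanded
  vectors and destroys the vector operations.\<close>

declare sm_apply [simp del] plus_fun_apply [simp del] zero_fun_apply [simp del]
  minus_apply [simp del] uminus_apply [simp del]

lemmas vec_eq = fun_eq_iff sm_apply plus_fun_apply minus_apply uminus_apply zero_fun_apply

section \<open>The product in terms of integer indices\<close>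

abbreviation hatC :: "(hidx \<Rightarrow> 'a::field) set" where
  "hatC \<equiv> vecs valid_hat"

abbreviation hmul :: "(hidx \<Rightarrow> 'a::field) \<Rightarrow> (hidx \<Rightarrow> 'a) \<Rightarrow> hidx \<Rightarrow> 'a" (infixl "\<odot>" 70) where
  "x \<odot> y \<equiv> bilin_mult bprod_hat x y"

lemma acar_Hhat [simp]: "acar Hhat = hatC"
  and aadd_Hhat [simp]: "aadd Hhat = (+)"
  and asmult_Hhat [simp]: "asmult Hhat = sm"
  and amult_Hhat [simp]: "amult Hhat = bilin_mult bprod_hat"
  by (simp_all add: Hhat_def vecs_def)

lemma pV_mod: "pV (r mod 3) k = pV r k"
  by (simp add: pV_def)

lemma pV_cong: "r mod 3 = t mod 3 \<Longrightarrow> pV r k = pV t k"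
  by (metis pV_mod)

lemma pV_not_dvd: "\<not> 3 dvd k \<Longrightarrow> pV r k = 0"
  by (simp add: pV_def)

lemma pV_0 [simp]: "pV r 0 = 0"
  by (simp add: pV_def)

lemma mod3_cases:
  fixes r :: int
  obtains "r mod 3 = 0" | "r mod 3 = 1" | "r mod 3 = 2"
proof -
  have "r mod 3 = 0 \<or> r mod 3 = 1 \<or> r mod 3 = 2" by presburger
  then show ?thesis by (elim disjE) (fact that)+
qed

lemma mod3I: "a - b = 3 * c \<Longrightarrow> a mod 3 = b mod (3::int)"
  by (simp add: mod_eq_dvd_iff)

lemma pV_sum: "pV r k + pV (r + 1) k + pV (r + 2) k = 0"
proof -
  have "r mod 3 = 0 \<Longrightarrow> (r + 1) mod 3 = 1 \<and> (r + 2) mod 3 = 2"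
    "r mod 3 = 1 \<Longrightarrow> (r + 1) mod 3 = 2 \<and> (r + 2) mod 3 = 0"
    "r mod 3 = 2 \<Longrightarrow> (r + 1) mod 3 = 0 \<and> (r + 2) mod 3 = 1" by presburger+
  then show ?thesis
    by (cases r rule: mod3_cases) (auto simp: pV_def)
qed

lemma pV_third: "pV (r + 2) k = - pV r k - pV (r + 1) k"
  using pV_sum[of r k] by (simp add: algebra_simps eq_neg_iff_add_eq_0)

text \<open>With integer indices the product formulas hold for all signs, so differences of
  indices need no case distinction.\<close>

definition sI :: "int \<Rightarrow> hidx \<Rightarrow> 'a::field" where
  "sI j = sV (nat \<bar>j\<bar>)"

definition pI :: "int \<Rightarrow> int \<Rightarrow> hidx \<Rightarrow> 'a::field" where
  "pI r j = pV r (nat \<bar>j\<bar>)"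

definition zI :: "int \<Rightarrow> int \<Rightarrow> hidx \<Rightarrow> 'a::field" where
  "zI r j = pI (r + 1) j - pI (r - 1) j"

lemma sV_conv: "sV j = sI (int j)" by (simp add: sI_def)
lemma pV_conv: "pV r j = pI r (int j)" by (simp add: pI_def)
lemma zV_conv: "zV r j = zI r (int j)" by (simp add: zV_def zI_def pI_def)

lemma zI_conv: "zI r j = zV r (nat \<bar>j\<bar>)" by (simp add: zV_def zI_def pI_def)

lemma sI_0 [simp]: "sI 0 = 0" by (simp add: sI_def sV_def)
lemma pI_0 [simp]: "pI r 0 = 0" by (simp add: pI_def)

lemma sI_minus: "sI (- j) = sI j" by (simp add: sI_def)
lemma pI_minus: "pI r (- j) = pI r j" by (simp add: pI_def)
lemma zI_minus: "zI r (- j) = zI r j" by (simp add: zI_def pI_minus)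
lemma sI_abs: "sI \<bar>j\<bar> = sI j" by (simp add: sI_def)
lemma pI_abs: "pI r \<bar>j\<bar> = pI r j" by (simp add: pI_def)
lemma zI_abs: "zI r \<bar>j\<bar> = zI r j" by (simp add: zI_def pI_abs)

lemma pI_cong: "r mod 3 = t mod 3 \<Longrightarrow> pI r k = pI t k"
  unfolding pI_def by (rule pV_cong)

lemma zI_cong: "r mod 3 = t mod 3 \<Longrightarrow> zI r k = zI t k"
  unfolding zI_def by (metis pI_cong mod_add_left_eq mod_diff_left_eq)

lemma pI_not_dvd: "\<not> 3 dvd k \<Longrightarrow> pI r k = 0"
  by (simp add: pI_def pV_not_dvd)

lemma pI_third: "pI (r + 2) k = - pI r k - pI (r + 1) k"
  by (simp add: pI_def pV_third)

lemma aV_in [simp]: "aV i \<in> hatC" by (simp add: aV_def)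
lemma sV_in [simp]: "sV j \<in> hatC" by (simp add: sV_def)
lemma pV_in [simp]: "pV r j \<in> hatC"
  by (auto simp: pV_def intro!: vecs_diff vecs_uminus)
lemma zV_in [simp]: "zV r j \<in> hatC" by (simp add: zV_def)
lemma sI_in [simp]: "sI j \<in> hatC" by (simp add: sI_def)
lemma pI_in [simp]: "pI r j \<in> hatC" by (simp add: pI_def)
lemma zI_in [simp]: "zI r j \<in> hatC" by (simp add: zI_def)

lemma bprod_hat_in: "bprod_hat i j \<in> hatC"
  by (cases "(i, j)" rule: bprod_hat.cases)
    (auto simp: prodAA_def prodAS_def prodAP_def prodSS_def prodSP_def prodPP_def)

lemma hmul_in [simp]: "x \<in> hatC \<Longrightarrow> y \<in> hatC \<Longrightarrow> x \<odot> y \<in> hatC"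
  by (rule bilin_mult_in_vecs) (rule bprod_hat_in)

lemma bprod_hat_commute: "bprod_hat i j = bprod_hat j i"
proof (cases "(i, j)" rule: bprod_hat.cases)
  case (1 i i')
  \<comment> \<open>(H1) names only the first index in its \<open>z\<close>-term. That term vanishes
    unless 3 divides \<open>i - i'\<close>, and then the residues of both indices agree.\<close>
  have "zV i (nat \<bar>i - i'\<bar>) = zV i' (nat \<bar>i - i'\<bar>)"
  proof (cases "3 dvd nat \<bar>i - i'\<bar>")
    case True
    then have "3 dvd i - i'" by (simp add: dvd_nat_abs_iff)
    then have "(i + 1) mod 3 = (i' + 1) mod 3" "(i - 1) mod 3 = (i' - 1) mod 3"
      by presburger+
    then show ?thesis unfolding zV_def by (metis pV_cong)
  qed (simp add: zV_def pV_not_dvd)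
  then show ?thesis using 1 by (simp add: prodAA_def add.commute abs_minus_commute)
next
  case (6 j l)
  then show ?thesis by (simp add: prodSS_def add.commute abs_minus_commute)
next
  case (9 r h t k)
  then show ?thesis by (simp add: prodPP_def add.commute abs_minus_commute)
qed simp_all

lemma hmul_commute: "x \<odot> y = y \<odot> x"
  by (rule bilin_mult_commute) (rule bprod_hat_commute)

lemma hmul_lin_left: "y \<in> hatC \<Longrightarrow> lin_on valid_hat (\<lambda>x. x \<odot> y)"
  by (rule lin_on_mult_left)

lemma hmul_lin_right: "y \<in> hatC \<Longrightarrow> lin_on valid_hat (\<lambda>x. y \<odot> x)"
  by (rule lin_on_mult_right)

lemmas hmul_simps =
  lin_onD[OF hmul_lin_left] lin_on_more(1,2)[OF hmul_lin_left]
  lin_onD[OF hmul_lin_right] lin_on_more(1,2)[OF hmul_lin_right]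

lemma hmul_0 [simp]: "0 \<odot> x = 0" "x \<odot> 0 = 0"
proof -
  show "0 \<odot> x = 0" for x :: "hidx \<Rightarrow> 'a" by (simp add: bilin_mult_conv_ext)
  then show "x \<odot> 0 = 0" by (metis hmul_commute)
qed

text \<open>The parameter \<open>hf\<close> is \<open>1/2\<close>. Keeping it abstract leaves only polynomial coefficients, which the simplifier
  can normalise without knowing which numerals vanish in the field.\<close>

locale char_not_2_3 =
  fixes hf :: "'a::field"
  assumes hf: "2 * hf = 1" and three_nonzero: "(3::'a) \<noteq> 0"
begin

lemma nonzero [simp]: "(2::'a) \<noteq> 0" "(3::'a) \<noteq> 0" "(4::'a) \<noteq> 0" "(8::'a) \<noteq> 0"
proof -
  show 2: "(2::'a) \<noteq> 0" "(3::'a) \<noteq> 0" using hf three_nonzero by auto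
  have "(2::'a) ^ 2 \<noteq> 0" "(2::'a) ^ 3 \<noteq> 0" using 2(1) power_not_zero by blast+
  then show "(4::'a) \<noteq> 0" "(8::'a) \<noteq> 0" by simp_all
qed

lemma fractions:
  "1 / 2 = hf" "3 / 2 = 3 * hf" "- 3 / 4 = - 3 * hf\<^sup>2" "3 / 4 = 3 * hf\<^sup>2" "3 / 8 = 3 * hf ^ 3"
  "1 / 4 = hf\<^sup>2" "1 / 8 = hf ^ 3"
proof -
  have *: "hf = 1 / 2" using hf by (simp add: field_simps)
  show "1 / 2 = hf" "3 / 2 = 3 * hf" "- 3 / 4 = - 3 * hf\<^sup>2" "3 / 4 = 3 * hf\<^sup>2" "3 / 8 = 3 * hf ^ 3"
    "1 / 4 = hf\<^sup>2" "1 / 8 = hf ^ 3"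
    unfolding * by (simp_all add: power2_eq_square power3_eq_cube)
qed

lemma aV_mult_aV: "aV i \<odot> aV j = sm hf (aV i + aV j) + sI (i - j) + zI i (i - j)"
  unfolding aV_def by (simp add: prodAA_def aV_def sV_conv zV_conv sI_abs zI_abs fractions)

lemma aV_mult_sI:
  "aV i \<odot> sI j = sm (- 3 * hf\<^sup>2) (aV i) + sm (3 * hf ^ 3) (aV (i - j) + aV (i + j)) + sm (3 * hf) (sI j) - zI i j"
proof (cases "j = 0")
  case True
  \<comment> \<open>For \<open>j = 0\<close> the coefficients -3/4 and 3/8 + 3/8 of
    \<open>aV i\<close> cancel, so the formula agrees with \<open>sI 0 = 0\<close>.\<close>
  show ?thesis unfolding True zI_def sI_0 pI_0 hmul_0 diff_0_right add_0_right vec_eq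
    using hf by (intro allI) algebra
next
  case False
  have "aV i \<odot> sI j = prodAS i (nat \<bar>j\<bar>)"
    using False by (simp add: sI_def sV_def aV_def)
  also have "aV (i - \<bar>j\<bar>) + aV (i + \<bar>j\<bar>) = (aV (i - j) + aV (i + j) :: hidx \<Rightarrow> 'a)"
    by (cases "j \<ge> 0") (auto simp: add.commute)
  then have "prodAS i (nat \<bar>j\<bar>) = sm (- 3 * hf\<^sup>2) (aV i) + sm (3 * hf ^ 3) (aV (i - j) + aV (i + j)) + sm (3 * hf) (sI j) - (zI i j :: hidx \<Rightarrow> 'a)"
    by (simp add: prodAS_def sV_conv zV_conv sI_abs zI_abs fractions)
  finally show ?thesis .
qed

text \<open>Only residues 1 and 2 give basis vectors. A formula that depends on the residue alone
  and respects the defining relation for residue 0 therefore extends from these two to every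
  \<open>r\<close>.\<close>

lemma pV_bilin:
  fixes f :: "int \<Rightarrow> hidx \<Rightarrow> 'a"
  assumes lin: "lin_on valid_hat F" and k: "3 dvd k" "k > 0"
    and f: "F (uvec (P 1 k)) = f 1" "F (uvec (P 2 k)) = f 2"
    and cong: "\<And>r t. r mod 3 = t mod 3 \<Longrightarrow> f r = f t"
    and sum: "f 0 = - f 1 - f 2"
  shows "F (pV r k) = f r"
proof (cases r rule: mod3_cases)
  case 1
  have "F (- uvec (P 1 k) - uvec (P 2 k)) = - F (uvec (P 1 k)) - F (uvec (P 2 k))"
    using k by (simp add: lin_on_more[OF lin])
  then have "F (pV r k) = f 0"
    using k 1 by (simp add: pV_def f sum)
  then show ?thesis using cong[of r 0] 1 by simp
next
  case 2
  then show ?thesis using k cong[of r 1] f by (simp add: pV_def)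
next
  case 3
  then show ?thesis using k cong[of r 2] f by (simp add: pV_def)
qed

lemma mod3_uminus_cong: "r mod 3 = u mod (3::int) \<Longrightarrow> (- (i + r)) mod 3 = (- (i + u)) mod 3"
  by presburger

lemma aV_mult_pV: "aV i \<odot> pV r k = (prodAP i r k :: hidx \<Rightarrow> 'a)"
proof (cases "3 dvd k \<and> k > 0")
  case True
  show ?thesis
  proof (rule pV_bilin[where F = "\<lambda>x. aV i \<odot> x" and f = "\<lambda>r. prodAP i r k"])
    show "prodAP i r k = prodAP i t k" if "r mod 3 = t mod 3" for r t
      by (simp only: prodAP_def pV_cong[OF that] pV_cong[OF mod3_uminus_cong[OF that]])
    show "prodAP i 0 k = - prodAP i 1 k - (prodAP i 2 k :: hidx \<Rightarrow> 'a)"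
    proof -
      have "- (i + 0) = - (i + 2) + 2" "- (i + 1) = - (i + 2) + 1" by simp_all
      then show ?thesis
        unfolding prodAP_def by (simp only: pV_third pV_third[of 0, simplified]) (simp add: sm_distribs)
    qed
  qed (use True in \<open>auto simp: aV_def lin_on_mult_right\<close>)
qed (auto simp: prodAP_def pV_not_dvd)

lemma aV_mult_pI: "aV i \<odot> pI r k = sm (3 * hf) (pI r k) - pI (- (i + r)) k"
  by (simp add: pI_def aV_mult_pV prodAP_def fractions)

lemma sV_mult_sV: "sV j \<odot> sV l = (prodSS j l :: hidx \<Rightarrow> 'a)"
proof (cases "j = 0 \<or> l = 0")
  case True
  have "prodSS 0 i = (0 :: hidx \<Rightarrow> 'a)" "prodSS i 0 = (0 :: hidx \<Rightarrow> 'a)" for i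
    unfolding prodSS_def fractions by (simp_all add: sV_def vec_eq) (use hf in algebra)+
  with True show ?thesis by (auto simp: sV_def)
next
  case False
  then show ?thesis by (simp add: sV_def)
qed

lemma sI_mult_sI: "sI j \<odot> sI l = sm (3 * hf\<^sup>2) (sI j + sI l) - sm (3 * hf ^ 3) (sI (j - l) + sI (j + l))"
proof -
  \<comment> \<open>Up to sign and order, difference and sum of the absolute values are
    \<open>j - l\<close> and \<open>j + l\<close>, and \<open>sI\<close> ignores signs.\<close>
  have "sI (\<bar>j\<bar> - \<bar>l\<bar>) + sI (\<bar>j\<bar> + \<bar>l\<bar>) = (sI (j - l) + sI (j + l) :: hidx \<Rightarrow> 'a)"
    using sI_minus[of "j - l", where 'a = 'a] sI_minus[of "j + l", where 'a = 'a]
    by (auto simp: abs_if algebra_simps)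
  then show ?thesis
    unfolding sI_def[of j] sI_def[of l] sV_mult_sV
    by (simp add: prodSS_def sV_conv sI_abs fractions)
qed

text \<open>For \<open>k\<close> not divisible by 3 the factor \<open>pV r k\<close> is zero,
  whereas \<open>prodSP j r k\<close> may retain the term with \<open>pV r j\<close>; hence the
  hypothesis.\<close>

lemma sV_mult_pV: "3 dvd k \<Longrightarrow> sV j \<odot> pV r k = (prodSP j r k :: hidx \<Rightarrow> 'a)"
proof (cases "k = 0 \<or> j = 0")
  case True
  have "prodSP 0 r i = (0 :: hidx \<Rightarrow> 'a)" "prodSP i r 0 = (0 :: hidx \<Rightarrow> 'a)" for i
    unfolding prodSP_def fractions by (simp_all add: vec_eq) (use hf in algebra)+
  with True show ?thesis by (auto simp: sV_def)
next
  case False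
  assume k: "3 dvd k"
  show ?thesis
  proof (rule pV_bilin[where F = "\<lambda>x. sV j \<odot> x" and f = "\<lambda>r. prodSP j r k"])
    show "prodSP j r k = prodSP j t k" if "r mod 3 = t mod 3" for r t
      by (simp only: prodSP_def pV_cong[OF that])
    show "prodSP j 0 k = - prodSP j 1 k - (prodSP j 2 k :: hidx \<Rightarrow> 'a)"
      unfolding prodSP_def pV_third[of 0, simplified] vec_eq by (intro allI) algebra
  qed (use k False in \<open>auto simp: sV_def lin_on_mult_right\<close>)
qed

lemma zV_cong: "r mod 3 = t mod 3 \<Longrightarrow> zV r k = zV t k"
  unfolding zV_conv by (rule zI_cong)

lemma zV_sum: "zV (- r) k = - zV (- (1 + r)) k - zV (- (2 + r)) k"
proof -
  have mod: "(1 - r) mod 3 = (- 2 - r) mod 3" "(- r) mod 3 = (- 3 - r) mod 3" by presburger+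
  have "- r + 1 = 1 - r" "- r - 1 = - 1 - r" "- (1 + r) + 1 = - r" "- (1 + r) - 1 = - 2 - r"
    "- (2 + r) + 1 = - 1 - r" "- (2 + r) - 1 = - 3 - r" by simp_all
  then show ?thesis
    unfolding zV_def by (simp only: pV_cong[OF mod(1)] pV_cong[OF mod(2)]) simp
qed

lemma prodPP_cong:
  assumes "r mod 3 = u mod 3"
  shows "prodPP r m s k = prodPP u m s k"
proof -
  have "(- (r + s)) mod 3 = (- (u + s)) mod 3"
    using mod3_uminus_cong[OF assms, of s] by (simp only: add.commute)
  note * = zV_cong[OF this]
  show ?thesis by (simp only: prodPP_def *)
qed

lemma prodPP_sum: "prodPP 0 m s k = - prodPP 1 m s k - (prodPP 2 m s k :: hidx \<Rightarrow> 'a)"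
  unfolding prodPP_def zV_sum[of s] add_0_left vec_eq by (intro allI) algebra

lemma prodPP_commute: "prodPP r m u k = prodPP u k r m"
  by (simp add: prodPP_def add.commute abs_minus_commute)

lemma pV_mult_pV:
  assumes "3 dvd m" "3 dvd k"
  shows "pV r m \<odot> pV u k = (prodPP r m u k :: hidx \<Rightarrow> 'a)"
proof (cases "m = 0 \<or> k = 0")
  case True
  have "prodPP r 0 u i = (0 :: hidx \<Rightarrow> 'a)" "prodPP r i u 0 = (0 :: hidx \<Rightarrow> 'a)" for i
    unfolding prodPP_def fractions by (simp_all add: zV_def vec_eq) (use hf in algebra)+
  with True show ?thesis by auto
next
  case False
  have *: "uvec (P v m) \<odot> pV u k = (prodPP v m u k :: hidx \<Rightarrow> 'a)" if "v \<in> {1, 2}" for u v :: int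
  proof (rule pV_bilin[where F = "\<lambda>x. uvec (P v m) \<odot> x" and f = "\<lambda>u. prodPP v m u k"])
    show "prodPP v m r k = prodPP v m s k" if "r mod 3 = s mod 3" for r s
      using prodPP_cong[OF that] by (metis prodPP_commute)
    show "prodPP v m 0 k = - prodPP v m 1 k - (prodPP v m 2 k :: hidx \<Rightarrow> 'a)"
      using prodPP_sum by (metis prodPP_commute)
  qed (use assms False that in \<open>auto intro!: lin_on_mult_right\<close>)
  show ?thesis
  proof (rule pV_bilin[where F = "\<lambda>x. x \<odot> pV u k" and f = "\<lambda>r. prodPP r m u k"])
    show "prodPP r m u k = prodPP s m u k" if "r mod 3 = s mod 3" for r s
      using prodPP_cong[OF that] .
    show "prodPP 0 m u k = - prodPP 1 m u k - (prodPP 2 m u k :: hidx \<Rightarrow> 'a)"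
      by (rule prodPP_sum)
    show "lin_on valid_hat (\<lambda>x. x \<odot> pV u k)"
      by (rule lin_on_mult_left[of _ valid_hat]) simp
  qed (use assms False * in auto)
qed

end

section \<open>The dihedral group of automorphisms\<close>

text \<open>The sign on the \<open>P\<close>-vectors is forced by (H1): a reflection exchanges the
  two summands of \<open>zV r k\<close>, and with the factor \<open>e\<close> the image of
  \<open>zV r k\<close> is \<open>zV (e * r + c) k\<close> for both values of
  \<open>e\<close>.\<close>

definition dih_basis :: "int \<Rightarrow> int \<Rightarrow> hidx \<Rightarrow> hidx \<Rightarrow> 'a::field" where
  "dih_basis e c b = (case b of A i \<Rightarrow> aV (e * i + c) | S j \<Rightarrow> sV j | P r k \<Rightarrow> sm (of_int e) (pV (e * r + c) k))"

text \<open>For \<open>e = \<plusminus>1\<close> these are the elements of the infinite dihedral group acting on \<open>\<int>\<close>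
  by \<open>i \<mapsto> e i + c\<close>.\<close>
definition dih :: "int \<Rightarrow> int \<Rightarrow> (hidx \<Rightarrow> 'a::field) \<Rightarrow> hidx \<Rightarrow> 'a" where
  "dih e c = ext (dih_basis e c)"

context char_not_2_3
begin

lemma dih_basis_in: "dih_basis e c b \<in> hatC"
  by (simp add: dih_basis_def split: hidx.split)

lemma dih_in [simp]: "x \<in> hatC \<Longrightarrow> dih e c x \<in> hatC"
  unfolding dih_def by (rule ext_in_vecs) (auto simp: dih_basis_in)

lemma lin_on_dih [simp]: "lin_on valid_hat (dih e c)"
  by (simp add: dih_def)

lemmas dih_lin = lin_onD[OF lin_on_dih] lin_on_more[OF lin_on_dih]

lemma dih_aV [simp]: "dih e c (aV i) = aV (e * i + c)"
  by (simp add: dih_def aV_def dih_basis_def)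

lemma dih_sV [simp]: "dih e c (sV j) = sV j"
  by (simp add: dih_def sV_def dih_basis_def)

lemma dih_pV [simp]: "dih e c (pV r k :: hidx \<Rightarrow> 'a) = sm (of_int e) (pV (e * r + c) k)"
  if e: "e = 1 \<or> e = -1"
proof (cases "3 dvd k \<and> k > 0")
  case True
  show ?thesis
  proof (rule pV_bilin[where f = "\<lambda>r. sm (of_int e) (pV (e * r + c) k)"])
    show "sm (of_int e) (pV (e * r + c) k) = (sm (of_int e) (pV (e * t + c) k) :: hidx \<Rightarrow> 'a)"
      if "r mod 3 = t mod 3" for r t
      by (rule arg_cong[where f = "sm _"], rule pV_cong) (use that in \<open>intro mod_add_cong mod_mult_cong refl\<close>)
    show "sm (of_int e) (pV (e * 0 + c) k) =
        - sm (of_int e) (pV (e * 1 + c) k) - (sm (of_int e) (pV (e * 2 + c) k) :: hidx \<Rightarrow> 'a)"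
    proof -
      have mod: "(c - 1) mod 3 = (c + 2) mod 3" "(c - 2) mod 3 = (c + 1) mod 3" by presburger+
      show ?thesis
        using pV_third[of c k, where 'a = 'a] pV_cong[OF mod(1), of k, where 'a = 'a]
          pV_cong[OF mod(2), of k, where 'a = 'a] e
        by (auto simp: sm_distribs sm_minus_one add.commute)
    qed
    show "dih e c (uvec (P 1 k)) = (sm (of_int e) (pV (e * 1 + c) k) :: hidx \<Rightarrow> 'a)"
      "dih e c (uvec (P 2 k)) = (sm (of_int e) (pV (e * 2 + c) k) :: hidx \<Rightarrow> 'a)"
      by (simp_all add: dih_def dih_basis_def)
  qed (use True in auto)
next
  case False
  then have "pV r k = (0 :: hidx \<Rightarrow> 'a)" for r by (auto simp: pV_not_dvd)
  then show ?thesis using lin_on_more(3)[OF lin_on_dih vecs_zero, of e c] by simp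
qed

lemma dih_sI [simp]: "dih e c (sI j) = sI j"
  by (simp add: sI_def)

lemma dih_pI [simp]: "e = 1 \<or> e = -1 \<Longrightarrow> dih e c (pI r k :: hidx \<Rightarrow> 'a) = sm (of_int e) (pI (e * r + c) k)"
  by (simp add: pI_def)

lemma dih_zV: "e = 1 \<or> e = -1 \<Longrightarrow> dih e c (zV r k :: hidx \<Rightarrow> 'a) = zV (e * r + c) k"
  by (auto simp: zV_def dih_lin sm_minus_one algebra_simps)

lemma dih_zI: "e = 1 \<or> e = -1 \<Longrightarrow> dih e c (zI r k :: hidx \<Rightarrow> 'a) = zI (e * r + c) k"
  by (simp add: zI_conv dih_zV)

lemma dih_hmul_basis:
  assumes e: "e = 1 \<or> e = -1" and "valid_hat i" "valid_hat j"
  shows "dih e c (bprod_hat i j :: hidx \<Rightarrow> 'a) = dih_basis e c i \<odot> dih_basis e c j"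
proof -
  note lin = dih_lin dih_zV[OF e] dih_zI[OF e] dih_pV[OF e] hmul_simps
  have AA: "dih e c (prodAA i j) = (aV (e * i + c) \<odot> aV (e * j + c) :: hidx \<Rightarrow> 'a)" for i j
  proof -
    have "\<bar>(e * i + c) - (e * j + c)\<bar> = \<bar>i - j\<bar>"
      using e by auto
    then show ?thesis
      unfolding aV_mult_aV sI_def zI_conv by (simp add: prodAA_def lin fractions)
  qed
  have AS: "dih e c (prodAS i k) = (aV (e * i + c) \<odot> sV k :: hidx \<Rightarrow> 'a)" for i k
  proof -
    have "aV (e * (i - int k) + c) + aV (e * (i + int k) + c)
        = (aV (e * i + c - int k) + aV (e * i + c + int k) :: hidx \<Rightarrow> 'a)"
      using e by (auto simp: algebra_simps)
    then show ?thesis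
      unfolding sV_conv aV_mult_sI by (simp add: prodAS_def lin fractions sV_conv zV_conv)
  qed
  have AP: "dih e c (prodAP i r k) = (aV (e * i + c) \<odot> sm (of_int e) (pV (e * r + c) k) :: hidx \<Rightarrow> 'a)" for i r k
  proof -
    \<comment> \<open>The two residues differ by \<open>3 * c\<close>, so the index rule of (H3) is
      compatible with translations.\<close>
    have "(e * (- (i + r)) + c) mod 3 = (- (e * i + c + (e * r + c))) mod 3"
      using e by (intro mod3I[of _ _ c]) (auto simp: algebra_simps)
    from pV_cong[OF this, of k, where 'a = 'a] show ?thesis
      by (simp add: prodAP_def lin aV_mult_pV fractions sm_distribs mult.commute)
  qed
  have SP: "dih e c (prodSP m r k) = (sV m \<odot> sm (of_int e) (pV (e * r + c) k) :: hidx \<Rightarrow> 'a)"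
    if "3 dvd k" for m r k
    using that by (simp add: prodSP_def lin sV_mult_pV fractions sm_distribs mult.commute)
  have PP: "dih e c (prodPP r m u k)
      = (sm (of_int e) (pV (e * r + c) m) \<odot> sm (of_int e) (pV (e * u + c) k) :: hidx \<Rightarrow> 'a)"
    if "3 dvd m" "3 dvd k" for r m u k
  proof -
    have "(e * (- (r + u)) + c) mod 3 = (- (e * r + c + (e * u + c))) mod 3"
      using e by (intro mod3I[of _ _ c]) (auto simp: algebra_simps)
    note * = zV_cong[OF this]
    have z: "dih e c (zV (- (r + u)) n) = (zV (- (e * r + c + (e * u + c))) n :: hidx \<Rightarrow> 'a)" for n
      by (simp only: dih_zV[OF e] *)
    \<comment> \<open>The signs of the two factors cancel, which fits the sign-free transformation
      of \<open>zV\<close>.\<close>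
    have "of_int e * of_int e = (1::'a)" using e by auto
    then show ?thesis
      using that unfolding prodPP_def by (simp add: prodPP_def dih_lin z hmul_simps pV_mult_pV del: minus_add_distrib)
  qed
  have SS: "dih e c (prodSS m k) = (sV m \<odot> sV k :: hidx \<Rightarrow> 'a)" for m k
    by (simp add: sV_mult_sV prodSS_def lin)
  show ?thesis
    using assms(2,3)
    by (cases "(i, j)" rule: bprod_hat.cases)
      (simp_all only: prod.inject dih_basis_def bprod_hat.simps hidx.case valid_hat.simps AA AS AP SP PP SS,
        (rule hmul_commute)+)
qed

lemma dih_hmul:
  assumes "e = 1 \<or> e = -1" "x \<in> hatC" "y \<in> hatC"
  shows "dih e c (x \<odot> y :: hidx \<Rightarrow> 'a) = dih e c x \<odot> dih e c y"
  unfolding dih_def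
  by (rule bilin_mult_hom[OF assms(2,3), where ok' = valid_hat])
    (auto simp: bprod_hat_in dih_basis_in dih_hmul_basis[OF assms(1), unfolded dih_def])

lemma hat_eqI:
  fixes x :: "hidx \<Rightarrow> 'a"
  assumes "lin_on valid_hat F" "lin_on valid_hat G" "x \<in> hatC"
    and "\<And>i. F (aV i) = G (aV i)" "\<And>j. F (sI j) = G (sI j)"
    and "\<And>r k. r \<in> {1, 2} \<Longrightarrow> F (pI r k) = G (pI r k)"
  shows "F x = G x"
proof (rule lin_on_eqI[OF assms(1,2) _ assms(3)])
  fix b assume b: "valid_hat b"
  show "F (uvec b) = G (uvec b)"
  proof (cases b)
    case (A i)
    then show ?thesis using assms(4)[of i] by (simp add: aV_def)
  next
    case (S j)
    then show ?thesis using assms(5)[of "int j"] b by (simp add: sI_def sV_def)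
  next
    case (P r k)
    then show ?thesis using assms(6)[of r "int k"] b by (auto simp: pI_def pV_def)
  qed
qed

end

section \<open>Linear operators\<close>

definition shadow_basis :: "hidx \<Rightarrow> hidx \<Rightarrow> 'a::field" where
  "shadow_basis b = (case b of A i \<Rightarrow> pI 0 i | S j \<Rightarrow> 0 | P r k \<Rightarrow> 0)"

text \<open>Products of \<open>\<Sum> w\<^sub>i a\<^sub>i\<close> with \<open>a\<^sub>k\<close> produce the \<open>p\<close>-terms \<open>\<Sum> w\<^sub>i z\<^sub>k\<^sub>,\<^sub>|\<^sub>i\<^sub>-\<^sub>k\<^sub>|\<close>;
  these are differences of rotated shadows of the translate of \<open>w\<close> by \<open>-k\<close>.\<close>

definition shadow :: "(hidx \<Rightarrow> 'a::field) \<Rightarrow> hidx \<Rightarrow> 'a" where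
  "shadow = ext shadow_basis"

definition ppart_basis :: "hidx \<Rightarrow> hidx \<Rightarrow> 'a::field" where
  "ppart_basis b = (case b of A i \<Rightarrow> 0 | S j \<Rightarrow> 0 | P r k \<Rightarrow> pV r k)"

definition ppart :: "(hidx \<Rightarrow> 'a::field) \<Rightarrow> hidx \<Rightarrow> 'a" where
  "ppart = ext ppart_basis"

definition lin_op :: "((hidx \<Rightarrow> 'a::field) \<Rightarrow> hidx \<Rightarrow> 'a) \<Rightarrow> bool" where
  "lin_op F \<longleftrightarrow> lin_on valid_hat F \<and> (\<forall>x\<in>hatC. F x \<in> hatC)"

lemma shadow_in [simp]: "x \<in> hatC \<Longrightarrow> shadow x \<in> hatC"
  unfolding shadow_def by (rule ext_in_vecs[where ok = valid_hat]) (auto simp: shadow_basis_def split: hidx.split)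

lemma ppart_in [simp]: "x \<in> hatC \<Longrightarrow> ppart x \<in> hatC"
  unfolding ppart_def by (rule ext_in_vecs[where ok = valid_hat]) (auto simp: ppart_basis_def split: hidx.split)

lemma lin_on_shadow: "lin_on valid_hat shadow"
  by (simp add: shadow_def)

lemma lin_on_ppart: "lin_on valid_hat ppart"
  by (simp add: ppart_def)

lemmas shadow_lin = lin_onD[OF lin_on_shadow] lin_on_more[OF lin_on_shadow]
lemmas ppart_lin = lin_onD[OF lin_on_ppart] lin_on_more[OF lin_on_ppart]

lemma lin_op_zero [simp]: "dih e c 0 = 0" "shadow 0 = 0" "ppart 0 = 0"
  by (simp_all add: dih_def shadow_def ppart_def)

lemma shadow_aV: "shadow (aV i) = pI 0 i"
  by (simp add: shadow_def aV_def shadow_basis_def)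

lemma shadow_sI: "shadow (sI j) = 0"
  by (simp add: shadow_def sI_def sV_def shadow_basis_def)

lemma ppart_aV: "ppart (aV i) = 0"
  by (simp add: ppart_def aV_def ppart_basis_def)

lemma ppart_sI: "ppart (sI j) = 0"
  by (simp add: ppart_def sI_def sV_def ppart_basis_def)

lemma lin_op_intros:
  "lin_op (\<lambda>x. x)"
  "lin_op F \<Longrightarrow> lin_op (\<lambda>x. sm c (F x))"
  "lin_op F \<Longrightarrow> lin_op G \<Longrightarrow> lin_op (\<lambda>x. F x + G x)"
  "lin_op F \<Longrightarrow> lin_op G \<Longrightarrow> lin_op (\<lambda>x. F x - G x)"
  "lin_op F \<Longrightarrow> lin_op (\<lambda>x. - F x)"
  "lin_op F \<Longrightarrow> lin_op (\<lambda>x. shadow (F x))"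
  "lin_op F \<Longrightarrow> lin_op (\<lambda>x. ppart (F x))"
  "y \<in> hatC \<Longrightarrow> lin_op F \<Longrightarrow> lin_op (\<lambda>x. y \<odot> F x)"
  unfolding lin_op_def
  by (auto intro!: lin_on_intros intro: lin_on_comp[OF lin_on_shadow] lin_on_comp[OF lin_on_ppart]
      lin_on_comp[OF hmul_lin_right])

context char_not_2_3
begin

abbreviation HC :: "(hidx \<Rightarrow> 'a) set" where
  "HC \<equiv> hatC"

lemma lin_op_dih: "lin_op F \<Longrightarrow> lin_op (\<lambda>x. dih e c (F x) :: hidx \<Rightarrow> 'a)"
  unfolding lin_op_def by (auto intro: lin_on_comp[OF lin_on_dih])

lemma pI_lin_zero:
  assumes "lin_on valid_hat F" "F (uvec (P 1 k)) = 0" "F (uvec (P 2 k)) = 0" "3 dvd k" "k > 0"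
  shows "F (pV r k :: hidx \<Rightarrow> 'a) = (0 :: hidx \<Rightarrow> 'a)"
  by (rule pV_bilin[where f = "\<lambda>_. 0", OF assms(1,4,5)]) (use assms in auto)

lemma shadow_pI: "shadow (pI r k :: hidx \<Rightarrow> 'a) = 0"
proof (cases "3 dvd nat \<bar>k\<bar> \<and> nat \<bar>k\<bar> > 0")
  case True
  then show ?thesis
    unfolding pI_def
    by (intro pI_lin_zero[where F = shadow, OF lin_on_shadow]) (auto simp: shadow_def shadow_basis_def)
next
  case False
  then have "pI r k = (0 :: hidx \<Rightarrow> 'a)" by (auto simp: pI_def pV_not_dvd)
  then show ?thesis using shadow_lin(5)[of 0] by simp
qed

lemma ppart_pI: "ppart (pI r k :: hidx \<Rightarrow> 'a) = pI r k"
proof (cases "3 dvd nat \<bar>k\<bar> \<and> nat \<bar>k\<bar> > 0")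
  case True
  have "ppart (pV r (nat \<bar>k\<bar>)) = (pV r (nat \<bar>k\<bar>) :: hidx \<Rightarrow> 'a)"
  proof (rule pV_bilin[where F = ppart and f = "\<lambda>r. pV r (nat \<bar>k\<bar>)"])
    show "pV 0 (nat \<bar>k\<bar>) = - pV 1 (nat \<bar>k\<bar>) - (pV 2 (nat \<bar>k\<bar>) :: hidx \<Rightarrow> 'a)"
      unfolding pV_third[of 0, simplified] by simp
    show "pV r (nat \<bar>k\<bar>) = (pV u (nat \<bar>k\<bar>) :: hidx \<Rightarrow> 'a)" if "r mod 3 = u mod 3" for r u
      by (rule pV_cong[OF that])
  qed (use True in \<open>auto simp: lin_on_ppart\<close>, auto simp: ppart_def ppart_basis_def)
  then show ?thesis by (simp add: pI_def)
next
  case False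
  then have "pI r k = (0 :: hidx \<Rightarrow> 'a)" by (auto simp: pI_def pV_not_dvd)
  then show ?thesis using ppart_lin(5)[of 0] by simp
qed

text \<open>This reduces the operator identities below to one symbolic computation for each family
  of generators, uniform in the integer index.\<close>

lemma lin_op_eqI:
  fixes F G :: "(hidx \<Rightarrow> 'a) \<Rightarrow> hidx \<Rightarrow> 'a"
  assumes "lin_op F" "lin_op G"
    and "\<And>i. F (aV i) = G (aV i)" "\<And>j. F (sI j) = G (sI j)"
    and "\<And>r k. r \<in> {1, 2} \<Longrightarrow> F (pI r k) = G (pI r k)"
  shows "\<forall>x\<in>hatC. F x = G x"
proof
  fix x :: "hidx \<Rightarrow> 'a" assume x: "x \<in> hatC"
  show "F x = G x"
    by (rule hat_eqI[OF _ _ x assms(3-5)]) (use assms(1,2) in \<open>simp_all add: lin_op_def\<close>)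
qed

text \<open>With residues normalised to 0 and 1, two independent vectors remain for each admissible
  \<open>k\<close>, so equal combinations acquire the same normal form.\<close>

lemma pI_reduce:
  "pI 2 k = - pI 0 k - (pI 1 k :: hidx \<Rightarrow> 'a)"
  "pI 3 k = (pI 0 k :: hidx \<Rightarrow> 'a)"
  "pI 4 k = (pI 1 k :: hidx \<Rightarrow> 'a)"
  "pI (- 1) k = - pI 0 k - (pI 1 k :: hidx \<Rightarrow> 'a)"
  "pI (- 2) k = (pI 1 k :: hidx \<Rightarrow> 'a)"
  "pI (- 3) k = (pI 0 k :: hidx \<Rightarrow> 'a)"
  "pI (- 4) k = - pI 0 k - (pI 1 k :: hidx \<Rightarrow> 'a)"
  using pI_third[of 0 k]
  by (simp_all add: pI_cong[of 3 0] pI_cong[of 4 1] pI_cong[of "- 1" 2] pI_cong[of "- 2" 1]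
      pI_cong[of "- 3" 0] pI_cong[of "- 4" 2])

lemma pI_small: "pI r 1 = (0 :: hidx \<Rightarrow> 'a)" "pI r 2 = (0 :: hidx \<Rightarrow> 'a)"
  by (simp_all add: pI_not_dvd)

lemma sI_flip:
  "sI (- i) = sI i"
  "sI (1 - i) = sI (i - 1)"
  "sI (2 - i) = sI (i - 2)"
  "sI (- i - 1) = sI (i + 1)"
  "sI (- 1 - i) = sI (i + 1)"
  "sI (- i - 2) = sI (i + 2)"
  "sI (- 2 - i) = sI (i + 2)"
  "sI (- i + 1) = sI (i - 1)"
  "sI (- i + 2) = sI (i - 2)"
  unfolding sI_def by (rule arg_cong[where f = "\<lambda>n. sV (nat n)"], arith)+

lemma pI_flip:
  "pI r (- i) = pI r i"
  "pI r (1 - i) = pI r (i - 1)"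
  "pI r (2 - i) = pI r (i - 2)"
  "pI r (- i - 1) = pI r (i + 1)"
  "pI r (- 1 - i) = pI r (i + 1)"
  "pI r (- i - 2) = pI r (i + 2)"
  "pI r (- 2 - i) = pI r (i + 2)"
  "pI r (- i + 1) = pI r (i - 1)"
  "pI r (- i + 2) = pI r (i - 2)"
  unfolding pI_def by (rule arg_cong[where f = "\<lambda>n. pV r (nat n)"], arith)+

lemma aV_mult_aV': "aV j \<odot> aV i = sm hf (aV j + aV i) + sI (i - j) + (zI j (i - j) :: hidx \<Rightarrow> 'a)"
  by (simp only: aV_mult_aV sI_minus[of "j - i", simplified] zI_minus[of _ "j - i", simplified])

text \<open>\<open>P\<close>-vectors with second index 1 vanish, and so do those with index
  \<open>k - 1\<close> or \<open>k + 1\<close> when 3 divides \<open>k\<close>. Hence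
  \<open>sI 1\<close> is the scalar 3/4 on the \<open>P\<close>-span and produces no
  \<open>P\<close>-terms on \<open>aV i\<close>.\<close>

lemma s1_mult:
  "sI 1 \<odot> aV i = sm (- 3 * hf\<^sup>2) (aV i) + sm (3 * hf ^ 3) (aV (i - 1) + aV (i + 1)) + sm (3 * hf) (sI 1)"
  "sI 1 \<odot> sI j = sm (3 * hf\<^sup>2) (sI 1 + sI j) - sm (3 * hf ^ 3) (sI (j - 1) + sI (j + 1))"
  "sI 1 \<odot> pI r k = sm (3 * hf\<^sup>2) (pI r k)"
proof -
  show "sI 1 \<odot> aV i = sm (- 3 * hf\<^sup>2) (aV i) + sm (3 * hf ^ 3) (aV (i - 1) + aV (i + 1)) + sm (3 * hf) (sI 1)"
    unfolding hmul_commute[of "sI 1" "aV i"] by (simp add: aV_mult_sI zI_def pI_small)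
  show "sI 1 \<odot> sI j = sm (3 * hf\<^sup>2) (sI 1 + sI j) - sm (3 * hf ^ 3) (sI (j - 1) + sI (j + 1))"
    by (simp add: sI_mult_sI sI_flip add.commute)
  show "sI 1 \<odot> pI r k = sm (3 * hf\<^sup>2) (pI r k)"
  proof (cases "3 dvd k")
    case True
    define m where "m = \<bar>k\<bar>"
    have "3 dvd m" using True by (simp add: m_def)
    then have nd: "\<not> 3 dvd 1 - m" "\<not> 3 dvd 1 + m" by presburger+
    have "sV 1 \<odot> pV r (nat m) = (prodSP 1 r (nat m) :: hidx \<Rightarrow> 'a)"
      using \<open>3 dvd m\<close> by (intro sV_mult_pV) (simp add: m_def dvd_nat_abs_iff)
    moreover have "m \<ge> 0" by (simp add: m_def)
    ultimately have "sI 1 \<odot> pI r m = sm (3 * hf\<^sup>2) (pI r 1 + pI r m) - sm (3 * hf ^ 3) (pI r (1 - m) + pI r (1 + m))"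
      by (simp add: prodSP_def pV_conv sV_conv pI_abs fractions)
    then show ?thesis
      unfolding pI_not_dvd[OF nd(1)] pI_not_dvd[OF nd(2)] by (simp add: pI_small m_def pI_abs)
  qed (simp add: pI_not_dvd)
qed

lemma numeral_times_vec: "numeral n * v = sm (numeral n) (v :: hidx \<Rightarrow> 'a)"
  by (rule ext) (simp add: sm_apply)

lemma index_norm:
  "aV (1 + i) = aV (i + 1)"
  "aV (2 + i) = aV (i + 2)"
  "aV (3 + i) = aV (i + 3)"
  "aV (- 1 + i) = aV (i - 1)"
  "aV (- 2 + i) = aV (i - 2)"
  "aV (- 3 + i) = aV (i - 3)"
  "aV (- 1 - i) = aV (- i - 1)"
  "aV (- 2 - i) = aV (- i - 2)"
  "aV (- 3 - i) = aV (- i - 3)"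
  "aV (- i + 1) = aV (1 - i)"
  "aV (- i + 2) = aV (2 - i)"
  "aV (- i + 3) = aV (3 - i)"
  "sI (1 + i) = sI (i + 1)"
  "sI (2 + i) = sI (i + 2)"
  "sI (3 + i) = sI (i + 3)"
  "sI (- 1 + i) = sI (i - 1)"
  "sI (- 2 + i) = sI (i - 2)"
  "sI (- 3 + i) = sI (i - 3)"
  "pI r (1 + i) = pI r (i + 1)"
  "pI r (2 + i) = pI r (i + 2)"
  "pI r (3 + i) = pI r (i + 3)"
  "pI r (- 1 + i) = pI r (i - 1)"
  "pI r (- 2 + i) = pI r (i - 2)"
  "pI r (- 3 + i) = pI r (i - 3)"
  by (simp_all add: add.commute, (rule arg_cong[where f = aV], simp)+)

lemmas lin_op_eval = index_norm numeral_times_vec dih_lin shadow_lin ppart_lin hmul_simps zI_def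
  shadow_aV shadow_sI shadow_pI ppart_aV ppart_sI ppart_pI
  aV_mult_aV' aV_mult_sI aV_mult_pI s1_mult
  pI_small sI_flip pI_flip pI_reduce sm_minus_one

text \<open>After scaling by \<open>2^10\<close> all powers of \<open>1/2\<close> in the identities below disappear by
  rewriting with \<open>half_numeral\<close>.\<close>

lemma vec_scale: "sm 1024 v = sm 1024 w \<Longrightarrow> v = (w :: hidx \<Rightarrow> 'a)"
proof -
  have "(2::'a) ^ 10 \<noteq> 0" by (intro power_not_zero) simp
  then have "(1024::'a) \<noteq> 0" by simp
  then show "sm 1024 v = sm 1024 w \<Longrightarrow> v = w" by (simp add: vec_eq)
qed

lemma half_numeral:
  "hf * numeral (Num.Bit0 n) = numeral n" "hf * (a * numeral (Num.Bit0 n)) = a * numeral n"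
proof -
  have *: "numeral (Num.Bit0 n) = 2 * (numeral n :: 'a)" by (simp only: mult_2 numeral.numeral_Bit0[of n])
  have h2: "hf * (2 * m) = m" for m
    using hf by (simp only: mult.assoc[symmetric] mult.commute[of hf 2] mult_1)
  show "hf * numeral (Num.Bit0 n) = numeral n"
    by (simp only: * h2)
  show "hf * (a * numeral (Num.Bit0 n)) = a * numeral n"
    by (simp only: * h2 mult.left_commute[of a 2])
qed

lemmas vec_norm = half_numeral algebra_simps power2_eq_square power3_eq_cube

section \<open>Operator identities on the eigenspaces\<close>

text \<open>An antisymmetric \<open>x\<close> is half of \<open>x - dih (- 1) 0 x\<close>. In such
  differences \<open>sI j\<close> contributes zero, and \<open>pI 1 k\<close> and
  \<open>pI 2 k\<close> both contribute \<open>- pI 0 k\<close>.\<close>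

lemma antisym_eqI:
  assumes "lin_op F" "lin_op G"
    and "\<And>i. F (aV i - aV (- i)) = G (aV i - aV (- i))" "\<And>k. F (pI 0 k) = G (pI 0 k)"
  shows "\<forall>x\<in>{x\<in>hatC. dih (- 1) 0 x = - x}. F x = (G x :: hidx \<Rightarrow> 'a)"
proof
  fix x :: "hidx \<Rightarrow> 'a" assume x: "x \<in> {x\<in>hatC. dih (- 1) 0 x = - x}"
  have lin: "lin_on valid_hat F" "lin_on valid_hat G" using assms by (auto simp: lin_op_def)
  have op: "lin_op (\<lambda>x. H (x - dih (- 1) 0 x))" if "lin_op H" for H :: "(hidx \<Rightarrow> 'a) \<Rightarrow> hidx \<Rightarrow> 'a"
    unfolding lin_op_def
  proof
    show "lin_on valid_hat (\<lambda>x. H (x - dih (- 1) 0 x))"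
      by (rule lin_on_comp[of valid_hat H]) (use that in \<open>auto simp: lin_op_def intro!: lin_on_intros\<close>)
  qed (use that in \<open>auto simp: lin_op_def\<close>)
  have p: "pI r k - dih (- 1) 0 (pI r k) = (- pI 0 k :: hidx \<Rightarrow> 'a)" if "r \<in> {1, 2}" for r k
    using that by (auto simp: lin_op_eval)
  have neg: "F (- pI 0 k) = G (- pI 0 k)" for k
    by (simp add: assms lin_on_more[OF lin(1)] lin_on_more[OF lin(2)])
  have zero: "F 0 = G 0"
    by (simp only: lin_on_more(3)[OF lin(1) vecs_zero] lin_on_more(3)[OF lin(2) vecs_zero])
  have "\<forall>x\<in>HC. F (x - dih (- 1) 0 x) = G (x - dih (- 1) 0 x)"
    by (rule lin_op_eqI[OF op[OF assms(1)] op[OF assms(2)]]) (simp_all add: assms zero p neg del: dih_pI)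
  moreover have "x - dih (- 1) 0 x = sm 2 x"
    using x by (simp add: vec_eq)
  ultimately have "sm 2 (F x) = sm 2 (G x)"
    using x lin_onD(2)[OF lin(1), of x 2] lin_onD(2)[OF lin(2), of x 2] by force
  then show "F x = G x" by (simp add: vec_eq)
qed

text \<open>The reflection fixes the part of \<open>D1 x\<close> outside the \<open>P\<close>-span,
  so the antisymmetrisation leaves only \<open>P\<close>-terms. In this way \<open>x\<close> yields
  an element of the \<open>P\<close>-span by operations that an ideal is closed under.\<close>

lemma half_D1:
  fixes y D1 q1 :: "(hidx \<Rightarrow> 'a) \<Rightarrow> hidx \<Rightarrow> 'a"
  defines "y \<equiv> \<lambda>x. aV 1 \<odot> x - sm hf x"
  defines "D1 \<equiv> \<lambda>x. aV 0 \<odot> y x - sm (3 * hf) (y x)"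
  defines "q1 \<equiv> \<lambda>x. shadow (dih 1 (- 1) x) - ppart x"
  shows "\<forall>x\<in>{x\<in>HC. dih (- 1) 0 x = - x}. D1 x - dih (- 1) 0 (D1 x) = sm 3 (q1 x)"
  unfolding y_def D1_def q1_def
  by (rule antisym_eqI; (intro lin_op_intros lin_op_dih; simp; fail)?; simp add: lin_op_eval; rule vec_scale; simp add: vec_eq vec_norm)

lemma half_antisym:
  fixes x1 :: "(hidx \<Rightarrow> 'a) \<Rightarrow> hidx \<Rightarrow> 'a"
  defines "x1 \<equiv> \<lambda>x. sm 8 (sI 1 \<odot> x) + sm 6 x"
  shows "\<forall>x\<in>{x\<in>HC. dih (- 1) 0 x = - x}. dih (- 1) 0 (x1 x) = - x1 x"
  unfolding x1_def
  by (rule antisym_eqI; (intro lin_op_intros lin_op_dih; simp; fail)?; simp add: lin_op_eval; rule vec_scale; simp add: vec_eq vec_norm)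

text \<open>A second element of the \<open>P\<close>-span, obtained with \<open>aV 2\<close> in
  place of \<open>aV 1\<close>; relative to \<open>q1\<close> the term \<open>ppart x\<close> has
  the opposite sign.\<close>

lemma half_D2:
  fixes y2 D2 q2 :: "(hidx \<Rightarrow> 'a) \<Rightarrow> hidx \<Rightarrow> 'a"
  defines "y2 \<equiv> \<lambda>x. aV 2 \<odot> x - sm hf x"
  defines "D2 \<equiv> \<lambda>x. aV 0 \<odot> y2 x - sm (3 * hf) (y2 x)"
  defines "q2 \<equiv> \<lambda>x. ppart x + shadow (dih 1 (- 2) x)"
  shows "\<forall>x\<in>{x\<in>HC. dih (- 1) 0 x = - x}. D2 x - dih (- 1) 0 (D2 x) = sm (- 3) (q2 x)"
  unfolding y2_def D2_def q2_def
  by (rule antisym_eqI; (intro lin_op_intros lin_op_dih; simp; fail)?; simp add: lin_op_eval; rule vec_scale; simp add: vec_eq vec_norm)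

text \<open>Up to \<open>P\<close>-terms \<open>x1 x\<close> is 3 times the sum of both unit
  translates of \<open>x\<close>, and the shadow of an antisymmetric \<open>x\<close> is zero. So
  the shadows cancel. As \<open>x1\<close> multiplies \<open>ppart x\<close> by 12, the coefficient
  -12 - 3 is left.\<close>

lemma half_five:
  fixes x1 q1 q2 :: "(hidx \<Rightarrow> 'a) \<Rightarrow> hidx \<Rightarrow> 'a"
  defines "x1 \<equiv> \<lambda>x. sm 8 (sI 1 \<odot> x) + sm 6 x"
  defines "q1 \<equiv> \<lambda>x. shadow (dih 1 (- 1) x) - ppart x"
  defines "q2 \<equiv> \<lambda>x. ppart x + shadow (dih 1 (- 2) x)"
  shows "\<forall>x\<in>{x\<in>HC. dih (- 1) 0 x = - x}. q1 (x1 x) - sm 3 (q2 x) = sm (- 15) (ppart x)"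
  unfolding x1_def q1_def q2_def
  by (rule antisym_eqI; (intro lin_op_intros lin_op_dih; simp; fail)?; simp add: lin_op_eval; rule vec_scale; simp add: vec_eq vec_norm)

text \<open>Write T for \<open>dih 1 1\<close>. Up to \<open>P\<close>-terms \<open>x1 x\<close> is
  3 times the sum of T x and its counterpart for the inverse of T, and \<open>sm 8 (D1 x)\<close> is
  3 times the latter minus T x. The difference is 6 T x. The \<open>P\<close>-terms that remain are
  multiples of \<open>5 ppart x\<close>, of its translate, and of the translate of
  \<open>q1 x\<close>.\<close>

lemma half_shift:
  fixes x1 y D1 q1 :: "(hidx \<Rightarrow> 'a) \<Rightarrow> hidx \<Rightarrow> 'a"
  defines "x1 \<equiv> \<lambda>x. sm 8 (sI 1 \<odot> x) + sm 6 x"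
  defines "y \<equiv> \<lambda>x. aV 1 \<odot> x - sm hf x"
  defines "D1 \<equiv> \<lambda>x. aV 0 \<odot> y x - sm (3 * hf) (y x)"
  defines "q1 \<equiv> \<lambda>x. shadow (dih 1 (- 1) x) - ppart x"
  shows "\<forall>x\<in>{x\<in>HC. dih (- 1) 0 x = - x}. x1 x - sm 8 (D1 x) - sm 6 (dih 1 1 x) - sm 20 (ppart x) - sm 10 (dih 1 1 (ppart x)) = sm 24 (dih 1 1 (q1 x))"
  unfolding x1_def y_def D1_def q1_def
  by (rule antisym_eqI; (intro lin_op_intros lin_op_dih; simp; fail)?; simp add: lin_op_eval; rule vec_scale; simp add: vec_eq vec_norm)

end

section \<open>Projections to the eigenspaces of \<open>aV 0\<close>\<close>

definition from_basis :: "(int \<Rightarrow> hidx \<Rightarrow> 'a::field) \<Rightarrow> (int \<Rightarrow> hidx \<Rightarrow> 'a) \<Rightarrow> (int \<Rightarrow> int \<Rightarrow> hidx \<Rightarrow> 'a)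
    \<Rightarrow> (hidx \<Rightarrow> 'a) \<Rightarrow> hidx \<Rightarrow> 'a" where
  "from_basis fa fs fp = ext (\<lambda>b. case b of A i \<Rightarrow> fa i | S j \<Rightarrow> fs (int j) | P r k \<Rightarrow> fp r (int k))"

lemma lin_op_from_basis:
  assumes "\<And>i. fa i \<in> hatC" "\<And>j. fs j \<in> hatC" "\<And>r k. fp r k \<in> hatC"
  shows "lin_op (from_basis fa fs fp)"
  unfolding lin_op_def from_basis_def
  by (auto intro!: ext_in_vecs[where ok = valid_hat] simp: assms split: hidx.split)

lemma from_basis_aV: "from_basis fa fs fp (aV i) = fa i"
  by (simp add: from_basis_def aV_def)

lemma from_basis_sI:
  assumes "fs 0 = 0" "\<And>j. fs (- j) = fs j"
  shows "from_basis fa fs fp (sI j) = fs j"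
proof (cases "j = 0")
  case False
  then have "from_basis fa fs fp (sI j) = fs \<bar>j\<bar>" by (simp add: from_basis_def sI_def sV_def)
  then show ?thesis using assms(2) by (simp add: abs_if)
qed (simp add: from_basis_def assms)

lemma from_basis_pI:
  assumes "r \<in> {1, 2}" "\<And>k. fp r (- k) = fp r k" "\<And>k. k = 0 \<or> \<not> 3 dvd k \<Longrightarrow> fp r k = 0"
  shows "from_basis fa fs fp (pI r k) = (fp r k :: hidx \<Rightarrow> 'a::field)"
proof (cases "k = 0 \<or> \<not> 3 dvd k")
  case False
  then have "pI r k = (uvec (P r (nat \<bar>k\<bar>)) :: hidx \<Rightarrow> 'a)" using assms(1)
    by (auto simp: pI_def pV_def dvd_nat_abs_iff)
  then have "from_basis fa fs fp (pI r k) = fp r \<bar>k\<bar>" by (simp add: from_basis_def)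
  then show ?thesis using assms(2) by (simp add: abs_if)
next
  case True
  then have "pI r k = (0 :: hidx \<Rightarrow> 'a)" by (auto simp: pI_not_dvd)
  then show ?thesis using assms(3)[OF True] by (simp add: from_basis_def)
qed

context char_not_2_3
begin

text \<open>\<open>gen2 i\<close> is a \<open>2\<close>-eigenvector and \<open>gen0 i + z\<^sub>0\<^sub>,\<^sub>i\<close> a \<open>0\<close>-eigenvector of \<open>a\<^sub>0\<close>; the \<open>5/2\<close>-eigenspace is
  spanned by the \<open>z\<^sub>0\<^sub>,\<^sub>k\<close>. As \<open>0 = 5/2\<close> in characteristic 5, \<open>proj0\<close> is the projection to the sum of
  the last two spaces, and \<open>projz\<close> the one to the \<open>5/2\<close>-part.\<close>

definition gen2 :: "int \<Rightarrow> hidx \<Rightarrow> 'a" where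
  "gen2 i = sm hf (aV i + aV (- i)) - aV 0 + sm 2 (sI i) + sm 2 (zI 0 i)"

definition gen0 :: "int \<Rightarrow> hidx \<Rightarrow> 'a" where
  "gen0 i = sm (- 3 * hf\<^sup>2) (aV i + aV (- i)) + sm (3 * hf) (aV 0) + sI i"

definition proj1 :: "(hidx \<Rightarrow> 'a) \<Rightarrow> hidx \<Rightarrow> 'a" where
  "proj1 = from_basis (\<lambda>_. aV 0) (\<lambda>_. 0) (\<lambda>_ _. 0)"

definition proj2 :: "(hidx \<Rightarrow> 'a) \<Rightarrow> hidx \<Rightarrow> 'a" where
  "proj2 = from_basis (\<lambda>i. sm (hf\<^sup>2) (gen2 i)) (\<lambda>j. sm (3 * hf ^ 3) (gen2 j)) (\<lambda>_ _. 0)"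

definition proj0 :: "(hidx \<Rightarrow> 'a) \<Rightarrow> hidx \<Rightarrow> 'a" where
  "proj0 = from_basis (\<lambda>i. sm (- hf) (gen0 i + zI 0 i)) (\<lambda>j. sm (hf\<^sup>2) (gen0 j) - sm (3 * hf\<^sup>2) (zI 0 j))
     (\<lambda>r k. if r = 1 then sm hf (zI 0 k) else sm (- hf) (zI 0 k))"

definition projz :: "(hidx \<Rightarrow> 'a) \<Rightarrow> hidx \<Rightarrow> 'a" where
  "projz = from_basis (\<lambda>_. 0) (\<lambda>j. - zI 0 j) (\<lambda>r k. if r = 1 then sm hf (zI 0 k) else sm (- hf) (zI 0 k))"

lemma gen_in [simp]: "gen2 i \<in> hatC" "gen0 i \<in> hatC"
  by (simp_all add: gen2_def gen0_def)

lemma lin_op_projs: "lin_op proj1" "lin_op proj2" "lin_op proj0" "lin_op projz"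
  unfolding proj1_def proj2_def proj0_def projz_def by (rule lin_op_from_basis; simp)+

lemma lin_op_proj:
  assumes "lin_op F"
  shows "lin_op (\<lambda>x. proj1 (F x))" "lin_op (\<lambda>x. proj2 (F x))" "lin_op (\<lambda>x. proj0 (F x))" "lin_op (\<lambda>x. projz (F x))"
  using assms lin_op_projs by (auto simp: lin_op_def intro: lin_on_comp)

lemma proj_in [simp]:
  "x \<in> hatC \<Longrightarrow> proj1 x \<in> hatC" "x \<in> hatC \<Longrightarrow> proj2 x \<in> hatC"
  "x \<in> hatC \<Longrightarrow> proj0 x \<in> hatC" "x \<in> hatC \<Longrightarrow> projz x \<in> hatC"
  using lin_op_projs by (auto simp: lin_op_def)

lemma proj_zero [simp]: "proj1 0 = 0" "proj2 0 = 0" "proj0 0 = 0" "projz 0 = 0"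
  by (simp_all add: proj1_def proj2_def proj0_def projz_def from_basis_def)

lemma lin_on_projs: "lin_on valid_hat proj1" "lin_on valid_hat proj2" "lin_on valid_hat proj0" "lin_on valid_hat projz"
  using lin_op_projs by (auto simp: lin_op_def)

lemmas proj_lin =
  lin_onD[OF lin_on_projs(1)] lin_on_more(1,2)[OF lin_on_projs(1)]
  lin_onD[OF lin_on_projs(2)] lin_on_more(1,2)[OF lin_on_projs(2)]
  lin_onD[OF lin_on_projs(3)] lin_on_more(1,2)[OF lin_on_projs(3)]
  lin_onD[OF lin_on_projs(4)] lin_on_more(1,2)[OF lin_on_projs(4)]

lemma proj_aV: "proj1 (aV i) = aV 0" "proj2 (aV i) = sm (hf\<^sup>2) (gen2 i)"
  "proj0 (aV i) = sm (- hf) (gen0 i + zI 0 i)" "projz (aV i) = 0"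
  by (simp_all add: proj1_def proj2_def proj0_def projz_def from_basis_aV)

lemma gen_zero: "gen2 0 = 0" "gen0 0 = 0"
proof -
  show "gen2 0 = 0"
    by (rule vec_scale) (simp add: gen2_def zI_def vec_eq vec_norm)
  show "gen0 0 = 0"
    by (rule vec_scale) (simp add: gen0_def zI_def vec_eq vec_norm)
qed

lemma gen_minus: "gen2 (- i) = gen2 i" "gen0 (- i) = gen0 i"
  by (simp_all add: gen2_def gen0_def sI_minus zI_minus add.commute)

lemma zI_not_dvd: "k = 0 \<or> \<not> 3 dvd k \<Longrightarrow> zI r k = 0"
  by (auto simp: zI_def pI_not_dvd)

lemma proj_sI: "proj1 (sI j) = 0" "proj2 (sI j) = sm (3 * hf ^ 3) (gen2 j)"
  "proj0 (sI j) = sm (hf\<^sup>2) (gen0 j) - sm (3 * hf\<^sup>2) (zI 0 j)" "projz (sI j) = - zI 0 j"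
  unfolding proj1_def proj2_def proj0_def projz_def
  by (rule from_basis_sI; simp add: gen_zero gen_minus zI_minus zI_not_dvd)+

lemma proj_pI1: "proj1 (pI 1 k) = 0" "proj2 (pI 1 k) = 0"
    "proj0 (pI 1 k) = sm hf (zI 0 k)" "projz (pI 1 k) = sm hf (zI 0 k)"
  unfolding proj1_def proj2_def proj0_def projz_def
  by (subst from_basis_pI; simp add: zI_minus zI_not_dvd)+

lemma proj_pI2: "proj1 (pI 2 k) = 0" "proj2 (pI 2 k) = 0"
    "proj0 (pI 2 k) = sm (- hf) (zI 0 k)" "projz (pI 2 k) = sm (- hf) (zI 0 k)"
  unfolding proj1_def proj2_def proj0_def projz_def
  by (subst from_basis_pI; simp add: zI_minus zI_not_dvd)+

lemma proj_pI0: "proj1 (pI 0 k) = 0" "proj2 (pI 0 k) = 0" "proj0 (pI 0 k) = 0" "projz (pI 0 k) = 0"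
proof -
  have p: "pI 0 k = - pI 1 k - (pI 2 k :: hidx \<Rightarrow> 'a)"
    using pI_third[of 0 k, where 'a = 'a] by simp
  show "proj1 (pI 0 k) = 0" "proj2 (pI 0 k) = 0" "proj0 (pI 0 k) = 0" "projz (pI 0 k) = 0"
    unfolding p by (simp_all add: proj_lin proj_pI1 proj_pI2, simp_all add: vec_eq)
qed

lemmas proj_eval = proj_lin proj_aV proj_sI proj_pI1 proj_pI0 gen2_def gen0_def

lemma decompose: "\<forall>x\<in>HC. x = proj1 x + proj2 x + sm hf (x - dih (- 1) 0 x) + proj0 x"
  by (rule lin_op_eqI; (intro lin_op_intros lin_op_dih lin_op_proj; simp; fail)?; (elim insertE emptyE)?; simp add: lin_op_eval proj_eval; rule vec_scale; simp add: vec_eq vec_norm)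

lemma eigen1: "\<forall>x\<in>HC. aV 0 \<odot> proj1 x = proj1 x"
  by (rule lin_op_eqI; (intro lin_op_intros lin_op_dih lin_op_proj; simp; fail)?; (elim insertE emptyE)?; simp add: lin_op_eval proj_eval; rule vec_scale; simp add: vec_eq vec_norm)

lemma eigen2: "\<forall>x\<in>HC. aV 0 \<odot> proj2 x = sm 2 (proj2 x)"
  by (rule lin_op_eqI; (intro lin_op_intros lin_op_dih lin_op_proj; simp; fail)?; (elim insertE emptyE)?; simp add: lin_op_eval proj_eval; rule vec_scale; simp add: vec_eq vec_norm)

lemma eigen_half: "\<forall>x\<in>HC. aV 0 \<odot> (x - dih (- 1) 0 x) = sm hf (x - dih (- 1) 0 x)"
  by (rule lin_op_eqI; (intro lin_op_intros lin_op_dih lin_op_proj; simp; fail)?; (elim insertE emptyE)?; simp add: lin_op_eval proj_eval; rule vec_scale; simp add: vec_eq vec_norm)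

text \<open>\<open>proj0 x\<close> is a 0-eigenvector plus \<open>projz x\<close>, and only the
  latter survives the multiplication.\<close>

lemma eigen0: "\<forall>x\<in>HC. aV 0 \<odot> proj0 x = sm (5 * hf) (projz x)"
  by (rule lin_op_eqI; (intro lin_op_intros lin_op_dih lin_op_proj; simp; fail)?; (elim insertE emptyE)?; simp add: lin_op_eval proj_eval; rule vec_scale; simp add: vec_eq vec_norm)

lemma eigenz: "\<forall>x\<in>HC. aV 0 \<odot> projz x = sm (5 * hf) (projz x)"
  by (rule lin_op_eqI; (intro lin_op_intros lin_op_dih lin_op_proj; simp; fail)?; (elim insertE emptyE)?; simp add: lin_op_eval proj_eval; rule vec_scale; simp add: vec_eq vec_norm)


section \<open>Operator identities on the images of \<open>proj2\<close> and
  \<open>proj0\<close>\<close>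

lemma proj2_eqI:
  assumes "lin_op F" "lin_op G" "\<And>i. F (gen2 i) = G (gen2 i)"
  shows "\<forall>x\<in>proj2 ` HC. F x = (G x :: hidx \<Rightarrow> 'a)"
proof -
  have lin: "lin_on valid_hat F" "lin_on valid_hat G" using assms by (auto simp: lin_op_def)
  note simps = lin_onD[OF lin(1)] lin_onD[OF lin(2)] lin_on_more(1,2)[OF lin(1)] lin_on_more(1,2)[OF lin(2)]
  have zero: "F 0 = G 0"
    by (simp only: lin_on_more(3)[OF lin(1) vecs_zero] lin_on_more(3)[OF lin(2) vecs_zero])
  have "lin_op (\<lambda>x. F (proj2 x))" "lin_op (\<lambda>x. G (proj2 x))"
    using assms(1,2) lin_op_projs by (auto simp: lin_op_def intro: lin_on_comp)
  then have "\<forall>x\<in>HC. F (proj2 x) = G (proj2 x)"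
    by (rule lin_op_eqI) (auto simp: proj_aV proj_sI proj_pI1 proj_pI2 simps assms(3) zero)
  then show ?thesis by blast
qed

lemma proj0_eqI:
  assumes "lin_op F" "lin_op G" "\<And>i. F (gen0 i) = G (gen0 i)" "\<And>i. F (zI 0 i) = G (zI 0 i)"
  shows "\<forall>x\<in>proj0 ` HC. F x = (G x :: hidx \<Rightarrow> 'a)"
proof -
  have lin: "lin_on valid_hat F" "lin_on valid_hat G" using assms by (auto simp: lin_op_def)
  note simps = lin_onD[OF lin(1)] lin_onD[OF lin(2)] lin_on_more(1,2)[OF lin(1)] lin_on_more(1,2)[OF lin(2)]
  have "lin_op (\<lambda>x. F (proj0 x))" "lin_op (\<lambda>x. G (proj0 x))"
    using assms(1,2) lin_op_projs by (auto simp: lin_op_def intro: lin_on_comp)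
  then have "\<forall>x\<in>HC. F (proj0 x) = G (proj0 x)"
    by (rule lin_op_eqI) (auto simp: proj_aV proj_sI proj_pI1 proj_pI2 simps assms(3,4))
  then show ?thesis by blast
qed

lemma two_antisym:
  fixes a e :: "(hidx \<Rightarrow> 'a) \<Rightarrow> hidx \<Rightarrow> 'a"
  defines "a \<equiv> \<lambda>x. aV 1 \<odot> x - sm (3 * hf) x"
  defines "e \<equiv> \<lambda>x. a x - dih (- 1) 0 (a x)"
  shows "\<forall>x\<in>proj2 ` HC. dih (- 1) 0 (e x) = - e x"
  unfolding a_def e_def
  by (rule proj2_eqI; (intro lin_op_intros lin_op_dih lin_op_proj; simp; fail)?; simp add: lin_op_eval gen2_def; rule vec_scale; simp add: vec_eq vec_norm)

lemma two_ppart_e: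
  fixes a e u u1 :: "(hidx \<Rightarrow> 'a) \<Rightarrow> hidx \<Rightarrow> 'a"
  defines "a \<equiv> \<lambda>x. aV 1 \<odot> x - sm (3 * hf) x"
  defines "e \<equiv> \<lambda>x. a x - dih (- 1) 0 (a x)"
  defines "u \<equiv> \<lambda>x. sm 2 (shadow x)"
  defines "u1 \<equiv> \<lambda>x. sm 2 (shadow (dih 1 1 x))"
  shows "\<forall>x\<in>proj2 ` HC. ppart (e x) = sm (- 3 * hf) (u1 x) + sm 6 (u x)"
  unfolding a_def e_def u_def u1_def
  by (rule proj2_eqI; (intro lin_op_intros lin_op_dih lin_op_proj; simp; fail)?; simp add: lin_op_eval gen2_def; rule vec_scale; simp add: vec_eq vec_norm)

text \<open>\<open>c x\<close> is fixed by the reflection, and modulo the \<open>P\<close>-span it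
  is a multiple of the second difference of the translates of \<open>x\<close>. So its
  \<open>A\<close>-coefficients sum to zero and it has no \<open>S\<close>-part. Only the
  eigenvalues 0, 2 and 5/2 occur, the last one with component \<open>ppart (c x)\<close>. The
  polynomial X^2 - 2X kills the first two and takes the value 5/4 at 5/2.\<close>

lemma two_eigen_c:
  fixes a c :: "(hidx \<Rightarrow> 'a) \<Rightarrow> hidx \<Rightarrow> 'a"
  defines "a \<equiv> \<lambda>x. aV 1 \<odot> x - sm (3 * hf) x"
  defines "c \<equiv> \<lambda>x. sm 6 (a x + dih (- 1) 0 (a x)) + (sm 8 (sI 1 \<odot> x) - sm 6 x)"
  shows "\<forall>x\<in>proj2 ` HC. aV 0 \<odot> (aV 0 \<odot> c x) - sm 2 (aV 0 \<odot> c x) = sm (5 * hf\<^sup>2) (ppart (c x))"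
  unfolding a_def c_def
  by (rule proj2_eqI; (intro lin_op_intros lin_op_dih lin_op_proj; simp; fail)?; simp add: lin_op_eval gen2_def; rule vec_scale; simp add: vec_eq vec_norm)

text \<open>\<open>ppart (c x)\<close> is a combination of vectors \<open>zI 0 k\<close>. The
  difference of its two translates turns each of them into \<open>zI 1 k - zI 2 k\<close>, which is
  \<open>- 3\<close> times \<open>pI 0 k\<close>.\<close>

lemma two_ppart_c:
  fixes a c u1 :: "(hidx \<Rightarrow> 'a) \<Rightarrow> hidx \<Rightarrow> 'a"
  defines "a \<equiv> \<lambda>x. aV 1 \<odot> x - sm (3 * hf) x"
  defines "c \<equiv> \<lambda>x. sm 6 (a x + dih (- 1) 0 (a x)) + (sm 8 (sI 1 \<odot> x) - sm 6 x)"
  defines "u1 \<equiv> \<lambda>x. sm 2 (shadow (dih 1 1 x))"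
  shows "\<forall>x\<in>proj2 ` HC. dih 1 1 (ppart (c x)) - dih 1 2 (ppart (c x)) = sm 9 (u1 x)"
  unfolding a_def c_def u1_def
  by (rule proj2_eqI; (intro lin_op_intros lin_op_dih lin_op_proj; simp; fail)?; simp add: lin_op_eval gen2_def; rule vec_scale; simp add: vec_eq vec_norm)

text \<open>As the \<open>A\<close>-coefficients of \<open>c x\<close> sum to zero,
  \<open>cc x\<close> has only \<open>S\<close>- and \<open>P\<close>-terms, and the reflection
  fixes the former. The result is an element of the \<open>P\<close>-span that carries no common
  factor 5.\<close>

lemma two_c:
  fixes a c cc u u1 u2 :: "(hidx \<Rightarrow> 'a) \<Rightarrow> hidx \<Rightarrow> 'a"
  defines "a \<equiv> \<lambda>x. aV 1 \<odot> x - sm (3 * hf) x"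
  defines "c \<equiv> \<lambda>x. sm 6 (a x + dih (- 1) 0 (a x)) + (sm 8 (sI 1 \<odot> x) - sm 6 x)"
  defines "cc \<equiv> \<lambda>x. aV 1 \<odot> c x - sm hf (c x)"
  defines "u \<equiv> \<lambda>x. sm 2 (shadow x)"
  defines "u1 \<equiv> \<lambda>x. sm 2 (shadow (dih 1 1 x))"
  defines "u2 \<equiv> \<lambda>x. sm 2 (shadow (dih 1 2 x))"
  shows "\<forall>x\<in>proj2 ` HC. cc x - dih (- 1) 0 (cc x) = sm (- 18) (u x) + sm (- 18) (u2 x) + sm 27 (u1 x)"
  unfolding a_def c_def cc_def u_def u1_def u2_def
  by (rule proj2_eqI; (intro lin_op_intros lin_op_dih lin_op_proj; simp; fail)?; simp add: lin_op_eval gen2_def; rule vec_scale; simp add: vec_eq vec_norm)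

lemma two_e:
  fixes a e u u1 u2 :: "(hidx \<Rightarrow> 'a) \<Rightarrow> hidx \<Rightarrow> 'a"
  defines "a \<equiv> \<lambda>x. aV 1 \<odot> x - sm (3 * hf) x"
  defines "e \<equiv> \<lambda>x. a x - dih (- 1) 0 (a x)"
  defines "u \<equiv> \<lambda>x. sm 2 (shadow x)"
  defines "u1 \<equiv> \<lambda>x. sm 2 (shadow (dih 1 1 x))"
  defines "u2 \<equiv> \<lambda>x. sm 2 (shadow (dih 1 2 x))"
  shows "\<forall>x\<in>proj2 ` HC. sm (- 4) (shadow (dih 1 (- 1) (e x)) - ppart (e x)) = sm 21 (u x) - sm 6 (u1 x) + sm 3 (u2 x)"
  unfolding a_def e_def u_def u1_def u2_def
  by (rule proj2_eqI; (intro lin_op_intros lin_op_dih lin_op_proj; simp; fail)?; simp add: lin_op_eval gen2_def; rule vec_scale; simp add: vec_eq vec_norm)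

text \<open>With T = \<open>dih 1 1\<close> and T' its inverse, modulo the \<open>P\<close>-span
  \<open>c x\<close> is 12 (T x + T' x - 2 x) and \<open>sm 8 (e x)\<close> is 12 (T x - T' x): the
  even and the odd part of 24 (T x - x). The right-hand side sorts the \<open>P\<close>-terms into
  translates of \<open>q\<close> and multiples of \<open>5 u\<close>.\<close>

lemma two_shift:
  fixes a e c u u1 q :: "(hidx \<Rightarrow> 'a) \<Rightarrow> hidx \<Rightarrow> 'a"
  defines "a \<equiv> \<lambda>x. aV 1 \<odot> x - sm (3 * hf) x"
  defines "e \<equiv> \<lambda>x. a x - dih (- 1) 0 (a x)"
  defines "c \<equiv> \<lambda>x. sm 6 (a x + dih (- 1) 0 (a x)) + (sm 8 (sI 1 \<odot> x) - sm 6 x)"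
  defines "u \<equiv> \<lambda>x. sm 2 (shadow x)"
  defines "u1 \<equiv> \<lambda>x. sm 2 (shadow (dih 1 1 x))"
  defines "q \<equiv> \<lambda>x. sm 12 (u x) - u1 x"
  shows "\<forall>x\<in>proj2 ` HC. sm 24 (dih 1 1 x - x) - c x - sm 8 (e x) = sm (- 3) (dih 1 1 (q x) - dih 1 2 (q x)) + sm 4 (dih 1 2 (q x) + dih 1 1 (q x) - sm 2 (q x)) - sm 20 (dih 1 2 (u x) + dih 1 1 (u x) - sm 2 (u x))"
  unfolding a_def e_def c_def u_def u1_def q_def
  by (rule proj2_eqI; (intro lin_op_intros lin_op_dih lin_op_proj; simp; fail)?; simp add: lin_op_eval gen2_def; rule vec_scale; simp add: vec_eq vec_norm)

lemma rest_antisym: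
  fixes a e :: "(hidx \<Rightarrow> 'a) \<Rightarrow> hidx \<Rightarrow> 'a"
  defines "a \<equiv> \<lambda>x. aV 1 \<odot> x - sm (3 * hf) x"
  defines "e \<equiv> \<lambda>x. a x - dih (- 1) 0 (a x)"
  shows "\<forall>x\<in>proj0 ` HC. dih (- 1) 0 (e x) = - e x"
  unfolding a_def e_def
  by (rule proj0_eqI; (intro lin_op_intros lin_op_dih lin_op_proj; simp; fail)?; simp add: lin_op_eval gen0_def; rule vec_scale; simp add: vec_eq vec_norm)

text \<open>The image of \<open>proj0\<close> contains the vectors \<open>zI 0 k\<close> themselves,
  so the \<open>P\<close>-part of \<open>x\<close> is not determined by its
  \<open>A\<close>-coefficients. The operator \<open>g\<close> records it in terms of
  \<open>pI 0 k\<close>, since it maps \<open>zI 0 k\<close> to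
  \<open>zI 2 k - zI 1 k\<close>.\<close>

lemma rest_ppart_e:
  fixes a e v v1 g :: "(hidx \<Rightarrow> 'a) \<Rightarrow> hidx \<Rightarrow> 'a"
  defines "a \<equiv> \<lambda>x. aV 1 \<odot> x - sm (3 * hf) x"
  defines "e \<equiv> \<lambda>x. a x - dih (- 1) 0 (a x)"
  defines "v \<equiv> \<lambda>x. sm (- 2) (shadow x)"
  defines "v1 \<equiv> \<lambda>x. sm (- 2) (shadow (dih 1 1 x))"
  defines "g \<equiv> \<lambda>x. dih 1 2 (ppart x) - dih 1 1 (ppart x)"
  shows "\<forall>x\<in>proj0 ` HC. ppart (e x) = sm (3 * hf) (v1 x) + v x + g x"
  unfolding a_def e_def v_def v1_def g_def
  by (rule proj0_eqI; (intro lin_op_intros lin_op_dih lin_op_proj; simp; fail)?; simp add: lin_op_eval gen0_def; rule vec_scale; simp add: vec_eq vec_norm)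

lemma rest_eigen_c:
  fixes a c :: "(hidx \<Rightarrow> 'a) \<Rightarrow> hidx \<Rightarrow> 'a"
  defines "a \<equiv> \<lambda>x. aV 1 \<odot> x - sm (3 * hf) x"
  defines "c \<equiv> \<lambda>x. sm 2 (a x + dih (- 1) 0 (a x)) - (sm 8 (sI 1 \<odot> x) - sm 6 x)"
  shows "\<forall>x\<in>proj0 ` HC. aV 0 \<odot> (aV 0 \<odot> c x) - sm 2 (aV 0 \<odot> c x) = sm (5 * hf\<^sup>2) (ppart (c x))"
  unfolding a_def c_def
  by (rule proj0_eqI; (intro lin_op_intros lin_op_dih lin_op_proj; simp; fail)?; simp add: lin_op_eval gen0_def; rule vec_scale; simp add: vec_eq vec_norm)

lemma rest_ppart_c:
  fixes a c v v1 g :: "(hidx \<Rightarrow> 'a) \<Rightarrow> hidx \<Rightarrow> 'a"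
  defines "a \<equiv> \<lambda>x. aV 1 \<odot> x - sm (3 * hf) x"
  defines "c \<equiv> \<lambda>x. sm 2 (a x + dih (- 1) 0 (a x)) - (sm 8 (sI 1 \<odot> x) - sm 6 x)"
  defines "v \<equiv> \<lambda>x. sm (- 2) (shadow x)"
  defines "v1 \<equiv> \<lambda>x. sm (- 2) (shadow (dih 1 1 x))"
  defines "g \<equiv> \<lambda>x. dih 1 2 (ppart x) - dih 1 1 (ppart x)"
  shows "\<forall>x\<in>proj0 ` HC. dih 1 1 (ppart (c x)) - dih 1 2 (ppart (c x)) = sm 2 (g x) - sm 3 (v1 x) - sm 2 (v x)"
  unfolding a_def c_def v_def v1_def g_def
  by (rule proj0_eqI; (intro lin_op_intros lin_op_dih lin_op_proj; simp; fail)?; simp add: lin_op_eval gen0_def; rule vec_scale; simp add: vec_eq vec_norm)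

lemma rest_c:
  fixes a c cc v v1 v2 g :: "(hidx \<Rightarrow> 'a) \<Rightarrow> hidx \<Rightarrow> 'a"
  defines "a \<equiv> \<lambda>x. aV 1 \<odot> x - sm (3 * hf) x"
  defines "c \<equiv> \<lambda>x. sm 2 (a x + dih (- 1) 0 (a x)) - (sm 8 (sI 1 \<odot> x) - sm 6 x)"
  defines "cc \<equiv> \<lambda>x. aV 1 \<odot> c x - sm hf (c x)"
  defines "v \<equiv> \<lambda>x. sm (- 2) (shadow x)"
  defines "v1 \<equiv> \<lambda>x. sm (- 2) (shadow (dih 1 1 x))"
  defines "v2 \<equiv> \<lambda>x. sm (- 2) (shadow (dih 1 2 x))"
  defines "g \<equiv> \<lambda>x. dih 1 2 (ppart x) - dih 1 1 (ppart x)"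
  shows "\<forall>x\<in>proj0 ` HC. cc x - dih (- 1) 0 (cc x) = sm 15 (v1 x) - sm 4 (v x) - sm 2 (g x) - sm 6 (v2 x)"
  unfolding a_def c_def cc_def v_def v1_def v2_def g_def
  by (rule proj0_eqI; (intro lin_op_intros lin_op_dih lin_op_proj; simp; fail)?; simp add: lin_op_eval gen0_def; rule vec_scale; simp add: vec_eq vec_norm)

lemma rest_e:
  fixes a e v v1 v2 g :: "(hidx \<Rightarrow> 'a) \<Rightarrow> hidx \<Rightarrow> 'a"
  defines "a \<equiv> \<lambda>x. aV 1 \<odot> x - sm (3 * hf) x"
  defines "e \<equiv> \<lambda>x. a x - dih (- 1) 0 (a x)"
  defines "v \<equiv> \<lambda>x. sm (- 2) (shadow x)"
  defines "v1 \<equiv> \<lambda>x. sm (- 2) (shadow (dih 1 1 x))"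
  defines "v2 \<equiv> \<lambda>x. sm (- 2) (shadow (dih 1 2 x))"
  defines "g \<equiv> \<lambda>x. dih 1 2 (ppart x) - dih 1 1 (ppart x)"
  shows "\<forall>x\<in>proj0 ` HC. sm (- 4) (shadow (dih 1 (- 1) (e x)) - ppart (e x)) = sm 3 (v x) + sm 4 (g x) + sm 6 (v1 x) + v2 x"
  unfolding a_def e_def v_def v1_def v2_def g_def
  by (rule proj0_eqI; (intro lin_op_intros lin_op_dih lin_op_proj; simp; fail)?; simp add: lin_op_eval gen0_def; rule vec_scale; simp add: vec_eq vec_norm)

text \<open>As on the image of \<open>proj2\<close>, \<open>c\<close> and \<open>e\<close> give the
  even and odd part of the translation defect: modulo the \<open>P\<close>-span \<open>c x\<close>
  is -4 times the second difference, and \<open>sm 2 (e x)\<close> is minus the difference of the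
  two unit translates.\<close>

lemma rest_shift:
  fixes a e c v v1 g w :: "(hidx \<Rightarrow> 'a) \<Rightarrow> hidx \<Rightarrow> 'a"
  defines "a \<equiv> \<lambda>x. aV 1 \<odot> x - sm (3 * hf) x"
  defines "e \<equiv> \<lambda>x. a x - dih (- 1) 0 (a x)"
  defines "c \<equiv> \<lambda>x. sm 2 (a x + dih (- 1) 0 (a x)) - (sm 8 (sI 1 \<odot> x) - sm 6 x)"
  defines "v \<equiv> \<lambda>x. sm (- 2) (shadow x)"
  defines "v1 \<equiv> \<lambda>x. sm (- 2) (shadow (dih 1 1 x))"
  defines "g \<equiv> \<lambda>x. dih 1 2 (ppart x) - dih 1 1 (ppart x)"
  defines "w \<equiv> \<lambda>x. sm 3 (v1 x) + sm 2 (v x)"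
  shows "\<forall>x\<in>proj0 ` HC. sm (- 24) (dih 1 1 x - x) - sm 3 (c x) - sm 24 (e x) = sm 4 (dih 1 2 (w x + sm 2 (g x)) + dih 1 1 (w x + sm 2 (g x)) - sm 2 (w x + sm 2 (g x))) - (dih 1 1 (w x - sm 2 (g x)) - dih 1 2 (w x - sm 2 (g x))) - sm 8 (sm 2 (dih 1 2 (g x)) - g x - dih 1 1 (g x))"
  unfolding a_def e_def c_def v_def v1_def g_def w_def
  by (rule proj0_eqI; (intro lin_op_intros lin_op_dih lin_op_proj; simp; fail)?; simp add: lin_op_eval gen0_def; rule vec_scale; simp add: vec_eq vec_norm)

lemma dih_id: "x \<in> HC \<Longrightarrow> dih 1 0 x = x"
proof -
  have "\<forall>x\<in>HC. dih 1 0 x = x"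
    by (rule lin_op_eqI; (intro lin_op_intros lin_op_dih; simp; fail)?; simp add: lin_op_eval)
  then show "x \<in> HC \<Longrightarrow> dih 1 0 x = x" by blast
qed

lemma dih_comp:
  assumes "e = 1 \<or> e = - 1" "e' = 1 \<or> e' = - 1" "x \<in> HC"
  shows "dih e c (dih e' c' x) = dih (e * e') (e * c' + c) x"
proof -
  have "\<forall>x\<in>HC. dih e c (dih e' c' x) = dih (e * e') (e * c' + c) x"
    using assms(1,2)
    by (intro lin_op_eqI lin_op_intros lin_op_dih; (elim disjE)?; simp add: dih_lin algebra_simps)
  then show ?thesis using assms by blast
qed

lemma ppart_ppart: "\<forall>x\<in>HC. ppart (ppart x) = ppart x"
  by (rule lin_op_eqI; (intro lin_op_intros lin_op_dih; simp; fail)?; simp add: lin_op_eval)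

lemma ppart_shadow: "\<forall>x\<in>HC. ppart (shadow x) = shadow x"
  by (rule lin_op_eqI; (intro lin_op_intros lin_op_dih; simp; fail)?; simp add: lin_op_eval)

lemma ppart_dih: "\<forall>x\<in>HC. ppart (dih 1 c (ppart x)) = dih 1 c (ppart x)"
  by (rule lin_op_eqI; (intro lin_op_intros lin_op_dih; simp; fail)?; simp add: lin_op_eval)

end

section \<open>Ideals are invariant under the dihedral group\<close>

locale hat_ideal = char_not_2_3 hf for hf :: "'a::field" +
  fixes I :: "(hidx \<Rightarrow> 'a) set"
  assumes ideal: "alg_ideal Hhat I"
begin

lemma I_subset [simp]: "x \<in> I \<Longrightarrow> x \<in> hatC"
  using ideal by (auto simp: alg_ideal_def)

lemma I_add: "x \<in> I \<Longrightarrow> y \<in> I \<Longrightarrow> x + y \<in> I"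
  using ideal by (simp add: alg_ideal_def)

lemma I_sm: "x \<in> I \<Longrightarrow> sm c x \<in> I"
  using ideal by (simp add: alg_ideal_def)

lemma I_mult: "x \<in> I \<Longrightarrow> y \<in> hatC \<Longrightarrow> y \<odot> x \<in> I"
  using ideal by (simp add: alg_ideal_def)

lemma I_uminus: "x \<in> I \<Longrightarrow> - x \<in> I"
  using I_sm[of x "- 1"] by (simp add: sm_minus_one)

lemma I_diff: "x \<in> I \<Longrightarrow> y \<in> I \<Longrightarrow> x - y \<in> I"
  using I_add[of x "- y"] I_uminus by simp

lemmas I_intros = I_add I_sm I_diff I_uminus I_mult

lemma I_cancel:
  assumes "sm c x \<in> I" "c \<noteq> 0"
  shows "x \<in> I"
  using I_sm[OF assms(1), of "inverse c"] assms(2) by simp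

text \<open>On the \<open>P\<close>-span \<open>sm (3 * hf) x - aV k \<odot> x\<close> is the
  reflection of residues at \<open>r \<mapsto> - (k + r)\<close>. The reflection for
  \<open>k = 1\<close> followed by that for \<open>k = 0\<close> is the translation by 1.\<close>

lemma ppart_shift:
  assumes "x \<in> I" "ppart x = x"
  shows "dih 1 1 x \<in> I" "ppart (dih 1 1 x) = dih 1 1 x"
proof -
  let ?\<rho> = "\<lambda>k x. sm (3 * hf) x - aV k \<odot> x"
  have "\<forall>x\<in>HC. dih 1 1 (ppart x) = ?\<rho> 0 (?\<rho> 1 (ppart x))"
    by (rule lin_op_eqI) (auto intro!: lin_op_intros lin_op_dih simp: lin_op_eval)
  from bspec[OF this I_subset[OF assms(1)]] have "dih 1 1 x = ?\<rho> 0 (?\<rho> 1 x)"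
    by (simp only: assms(2))
  then show "dih 1 1 x \<in> I" using assms by (auto intro!: I_intros)
  have "\<forall>x\<in>HC. ppart (dih 1 1 (ppart x)) = dih 1 1 (ppart x)"
    by (rule lin_op_eqI) (auto intro!: lin_op_intros lin_op_dih simp: lin_op_eval)
  from bspec[OF this I_subset[OF assms(1)]] show "ppart (dih 1 1 x) = dih 1 1 x"
    by (simp only: assms(2))
qed

text \<open>Repeated multiplication by \<open>aV 0\<close> separates the eigencomponents. The
  constants -3, -6 and 3 left in front of them are invertible; splitting \<open>proj0 x\<close>
  further would require dividing by 5.\<close>

lemma eigen_in_I:
  assumes x: "x \<in> I"
  shows "proj1 x \<in> I" "proj2 x \<in> I" "proj0 x \<in> I" "x - dih (- 1) 0 x \<in> I"
proof -
  have xC: "x \<in> hatC" using x by simp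
  note eigen = bspec[OF eigen1 xC] bspec[OF eigen2 xC] bspec[OF eigen_half xC] bspec[OF eigen0 xC] bspec[OF eigenz xC]
  define x1 x2 xh x0 xz where "x1 = proj1 x" and "x2 = proj2 x" and "xh = x - dih (- 1) 0 x"
    and "x0 = proj0 x" and "xz = projz x"
  have C: "x1 \<in> hatC" "x2 \<in> hatC" "xh \<in> hatC" "x0 \<in> hatC" "xz \<in> hatC"
    using xC by (simp_all add: x1_def x2_def xh_def x0_def xz_def)
  have ev: "aV 0 \<odot> x1 = x1" "aV 0 \<odot> x2 = sm 2 x2" "aV 0 \<odot> xh = sm hf xh"
    "aV 0 \<odot> x0 = sm (5 * hf) xz" "aV 0 \<odot> xz = sm (5 * hf) xz"
    using eigen by (simp_all only: x1_def x2_def xh_def x0_def xz_def)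
  have dec: "x = x1 + x2 + sm hf xh + x0"
    using bspec[OF decompose xC] by (simp only: x1_def x2_def xh_def x0_def)
  define y1 where "y1 = aV 0 \<odot> x"
  define y2 where "y2 = aV 0 \<odot> y1"
  define y3 where "y3 = aV 0 \<odot> y2"
  define y4 where "y4 = aV 0 \<odot> y3"
  have I: "y1 \<in> I" "y2 \<in> I" "y3 \<in> I" "y4 \<in> I"
    using x by (simp_all add: y1_def y2_def y3_def y4_def I_mult)
  note simps = hmul_simps ev C
  have y1: "y1 = x1 + sm 2 x2 + sm (hf ^ 2) xh + sm (5 * hf) xz"
    unfolding y1_def by (subst dec) (simp add: simps power2_eq_square)
  have y2: "y2 = x1 + sm 4 x2 + sm (hf ^ 3) xh + sm (25 * hf ^ 2) xz"
    unfolding y2_def y1 by (simp add: simps power2_eq_square power3_eq_cube mult_ac)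
  have y3: "y3 = x1 + sm 8 x2 + sm (hf ^ 4) xh + sm (125 * hf ^ 3) xz"
    unfolding y3_def y2 by (simp add: simps power2_eq_square power3_eq_cube power4_eq_xxxx mult_ac)
  have y4: "y4 = x1 + sm 16 x2 + sm (hf ^ 5) xh + sm (625 * hf ^ 4) xz"
    unfolding y4_def y3 by (simp add: simps power2_eq_square power3_eq_cube power4_eq_xxxx numeral_eq_Suc mult_ac)
  \<comment> \<open>The coefficients are those of the polynomials vanishing at all eigenvalues but one.\<close>
  have half: "sm (- 3) xh = sm 8 y4 - sm 44 y3 + sm 76 y2 - sm 40 y1"
    unfolding y1 y2 y3 y4 by (rule vec_scale) (simp add: vec_eq vec_norm numeral_eq_Suc)
  have two: "sm (- 6) x2 = sm 4 y4 - sm 16 y3 + sm 17 y2 - sm 5 y1"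
    unfolding y1 y2 y3 y4 by (rule vec_scale) (simp add: vec_eq vec_norm numeral_eq_Suc)
  have one: "sm 3 x1 = sm 4 y4 - sm 20 y3 + sm 29 y2 - sm 10 y1"
    unfolding y1 y2 y3 y4 by (rule vec_scale) (simp add: vec_eq vec_norm numeral_eq_Suc)
  show xh: "x - dih (- 1) 0 x \<in> I"
    unfolding xh_def[symmetric] by (rule I_cancel[of "- 3"]) (use I in \<open>simp_all add: half I_intros\<close>)
  have "sm (- 6) x2 \<in> I" using I by (simp add: two I_intros)
  moreover have "(- 6::'a) \<noteq> 0"
  proof -
    have "(2::'a) * 3 \<noteq> 0" by (simp only: mult_eq_0_iff nonzero) simp
    then show ?thesis by simp
  qed
  ultimately show x2: "proj2 x \<in> I" unfolding x2_def by (rule I_cancel)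
  show x1: "proj1 x \<in> I"
    unfolding x1_def[symmetric] by (rule I_cancel[of 3]) (use I in \<open>simp_all add: one I_intros\<close>)
  have "x0 = x - x1 - x2 - sm hf xh"
    by (subst dec) simp
  then show "proj0 x \<in> I" using x x1 x2 xh
    unfolding x1_def[symmetric] x2_def[symmetric] xh_def[symmetric] x0_def[symmetric] by (simp add: I_intros)
qed

lemma reflect_in_I: "x \<in> I \<Longrightarrow> dih (- 1) 0 x \<in> I"
  using I_diff[OF _ eigen_in_I(4), of x x] by simp

section \<open>The part of the ideal inside the \<open>P\<close>-span\<close>

definition IP :: "(hidx \<Rightarrow> 'a) set" where
  "IP = {x \<in> I. ppart x = x}"

lemma IP_I: "x \<in> IP \<Longrightarrow> x \<in> I"
  by (simp add: IP_def)

lemma IP_dih: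
  assumes "x \<in> IP"
  shows "dih 1 1 x \<in> IP" "dih 1 2 x \<in> IP"
proof -
  have 1: "dih 1 1 y \<in> IP" if "y \<in> IP" for y
    using that ppart_shift unfolding IP_def by blast
  have "dih 1 1 (dih 1 1 x) = dih 1 2 x"
    using IP_I[OF assms] by (simp add: dih_comp)
  with 1[OF 1[OF assms]] show "dih 1 2 x \<in> IP" by simp
  show "dih 1 1 x \<in> IP" by (rule 1[OF assms])
qed

lemma IP_intros:
  "x \<in> IP \<Longrightarrow> y \<in> IP \<Longrightarrow> x + y \<in> IP"
  "x \<in> IP \<Longrightarrow> y \<in> IP \<Longrightarrow> x - y \<in> IP"
  "x \<in> IP \<Longrightarrow> sm c x \<in> IP"
  by (auto simp: IP_def I_intros ppart_lin)

lemma IP_cancel: "sm c x \<in> IP \<Longrightarrow> c \<noteq> 0 \<Longrightarrow> x \<in> IP"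
  using IP_intros(3)[of "sm c x" "inverse c"] by simp

lemma five_mult: "sm 5 x \<in> IP \<Longrightarrow> sm (5 * c) x \<in> IP"
  using IP_intros(3)[of "sm 5 x" c] by (simp add: mult.commute)

lemma nonzero_more: "(9::'a) \<noteq> 0" "(6::'a) \<noteq> 0" "(24::'a) \<noteq> 0"
proof -
  have "(3::'a) * 3 \<noteq> 0" "(2::'a) * 3 \<noteq> 0" "(8::'a) * 3 \<noteq> 0" by (simp_all only: mult_eq_0_iff nonzero) simp_all
  then show "(9::'a) \<noteq> 0" "(6::'a) \<noteq> 0" "(24::'a) \<noteq> 0" by simp_all
qed

text \<open>\<open>half_D1\<close> and \<open>half_D2\<close> put two elements into
  \<open>IP\<close>, and \<open>half_five\<close> extracts \<open>sm 5 (ppart x)\<close> from them.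
  In characteristic 5 that is the zero vector, but \<open>half_shift\<close> contains
  \<open>ppart x\<close> only with the factors 20 and 10.\<close>

lemma antisym_in_I:
  assumes x: "x \<in> I" and anti: "dih (- 1) 0 x = - x"
  shows "dih 1 1 x \<in> I" "sm 5 (ppart x) \<in> IP" "shadow (dih 1 (- 1) x) - ppart x \<in> IP"
proof -
  define q1 where "q1 = (\<lambda>x::hidx \<Rightarrow> 'a. shadow (dih 1 (- 1) x) - ppart x)"
  have IPq: "q1 x \<in> IP" if x: "x \<in> I" and anti: "dih (- 1) 0 x = - x" for x
  proof -
    have xC: "x \<in> {x \<in> HC. dih (- 1) 0 x = - x}" using x anti by simp
    note D = bspec[OF half_D1 xC]
    have "sm 3 (q1 x) \<in> I"
      unfolding q1_def D[symmetric] using x by (intro I_intros reflect_in_I) simp_all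
    then have "q1 x \<in> I" by (rule I_cancel) simp
    moreover have "ppart (q1 x) = q1 x"
      using x bspec[OF ppart_ppart, of x] bspec[OF ppart_shadow, of "dih 1 (- 1) x"]
      by (simp add: q1_def ppart_lin)
    ultimately show ?thesis by (simp add: IP_def)
  qed
  have xC: "x \<in> {x \<in> HC. dih (- 1) 0 x = - x}" using x anti by simp
  have hC: "x \<in> HC" using x by simp
  define x1 where "x1 = sm 8 (sI 1 \<odot> x) + sm 6 x"
  have x1: "x1 \<in> I" "dih (- 1) 0 x1 = - x1"
    using x bspec[OF half_antisym xC] by (simp_all add: x1_def I_intros)
  define q2 where "q2 = ppart x + shadow (dih 1 (- 2) x)"
  have "sm (- 3) q2 \<in> I"
    unfolding q2_def bspec[OF half_D2 xC, symmetric] using x by (intro I_intros reflect_in_I) simp_all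
  then have "q2 \<in> I" by (rule I_cancel) simp
  moreover have "ppart q2 = q2"
    using x bspec[OF ppart_ppart, of x] bspec[OF ppart_shadow, of "dih 1 (- 2) x"]
    by (simp add: q2_def ppart_lin)
  ultimately have q2: "q2 \<in> IP" by (simp add: IP_def)
  have five: "q1 x1 - sm 3 q2 = sm (- 15) (ppart x)"
    using bspec[OF half_five xC] by (simp only: x1_def q1_def q2_def)
  have "sm (- 3) (sm 5 (ppart x)) = sm (- 15) (ppart x)" by simp
  then have "sm (- 3) (sm 5 (ppart x)) \<in> IP"
    using IP_intros(2)[OF IPq[OF x1] IP_intros(3)[OF q2, of 3]] by (simp only: five)
  then show p5: "sm 5 (ppart x) \<in> IP" by (rule IP_cancel) simp
  show q1: "shadow (dih 1 (- 1) x) - ppart x \<in> IP"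
    using IPq[OF x anti] by (simp add: q1_def)
  define d where "d = aV 0 \<odot> (aV 1 \<odot> x - sm hf x) - sm (3 * hf) (aV 1 \<odot> x - sm hf x)"
  have d: "d \<in> I" unfolding d_def using x by (intro I_intros) simp_all
  have "dih 1 1 (sm 5 (ppart x)) = sm 5 (dih 1 1 (ppart x))" using x by (simp add: dih_lin)
  with IP_dih(1)[OF p5] have p5': "sm 5 (dih 1 1 (ppart x)) \<in> IP" by simp
  have "x1 - sm 8 d - sm 6 (dih 1 1 x) - sm (5 * 4) (ppart x) - sm (5 * 2) (dih 1 1 (ppart x)) = sm 24 (dih 1 1 (q1 x))"
    using bspec[OF half_shift xC] by (simp add: x1_def q1_def d_def)
  then have "sm 6 (dih 1 1 x) = x1 - sm 8 d - sm (5 * 4) (ppart x) - sm (5 * 2) (dih 1 1 (ppart x)) - sm 24 (dih 1 1 (q1 x))"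
    by (simp add: algebra_simps)
  also have "\<dots> \<in> I"
    using x1 d IP_I[OF five_mult[OF p5]] IP_I[OF five_mult[OF p5']] IP_I[OF IP_dih(1)[OF IPq[OF x anti]]]
    by (simp only: I_diff I_sm)
  finally show "dih 1 1 x \<in> I" by (rule I_cancel) (simp add: nonzero_more)
qed

lemma IP_I_ppart: "x \<in> I \<Longrightarrow> ppart x = x \<Longrightarrow> x \<in> IP"
  by (simp add: IP_def)

lemma ppart_shadow_dih: "x \<in> HC \<Longrightarrow> ppart (shadow (dih 1 c x)) = shadow (dih 1 c x)"
  using bspec[OF ppart_shadow, of "dih 1 c x"] by simp

lemma five_ppart_cancel:
  assumes "sm (5 * hf\<^sup>2) (ppart x) \<in> I" "x \<in> HC"
  shows "sm 5 (ppart x) \<in> IP"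
proof (rule IP_I_ppart)
  have "sm 5 (ppart x) = sm 4 (sm (5 * hf\<^sup>2) (ppart x))"
    by (rule vec_scale) (simp add: vec_eq vec_norm)
  then show "sm 5 (ppart x) \<in> I" using assms by (simp only: I_intros)
  show "ppart (sm 5 (ppart x)) = sm 5 (ppart x)"
    using assms bspec[OF ppart_ppart, of x] by (simp add: ppart_lin)
qed

text \<open>The vectors \<open>u, u1, u2\<close> encode the coefficients of \<open>x\<close> and of its translates by 1 and 2. Their
  multiples by 5 lie in the ideal, which is void in characteristic 5; the combination \<open>q\<close> supplies the
  missing relation.\<close>

lemma proj2_shift:
  assumes x: "x \<in> I" and range: "x \<in> proj2 ` HC"
  shows "dih 1 1 x \<in> I"
proof -
  have xC: "x \<in> HC" using x by simp
  define a where "a = aV 1 \<odot> x - sm (3 * hf) x"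
  define e where "e = a - dih (- 1) 0 a"
  define c where "c = sm 6 (a + dih (- 1) 0 a) + (sm 8 (sI 1 \<odot> x) - sm 6 x)"
  define u where "u = sm 2 (shadow x)"
  define u1 where "u1 = sm 2 (shadow (dih 1 1 x))"
  define u2 where "u2 = sm 2 (shadow (dih 1 2 x))"
  have aI: "a \<in> I" using x by (simp add: a_def I_intros)
  have eI: "e \<in> I" using aI by (simp add: e_def I_intros reflect_in_I)
  have cI: "c \<in> I" using aI x by (simp add: c_def I_intros reflect_in_I)
  have uC: "u \<in> HC" "u1 \<in> HC" "u2 \<in> HC" using xC by (simp_all add: u_def u1_def u2_def)
  have pu: "ppart u = u" "ppart u1 = u1" "ppart u2 = u2"
    using xC bspec[OF ppart_shadow xC] by (simp_all add: u_def u1_def u2_def ppart_lin ppart_shadow_dih)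
  have anti: "dih (- 1) 0 e = - e"
    using bspec[OF two_antisym range] by (simp only: e_def a_def)
  note e = antisym_in_I(2,3)[OF eI anti]
  have "sm (5 * hf\<^sup>2) (ppart c) \<in> I"
    using bspec[OF two_eigen_c range] cI by (simp only: c_def[symmetric] a_def[symmetric]) (metis I_diff I_sm I_mult aV_in)
  then have 5: "sm 5 (ppart c) \<in> IP" using cI by (intro five_ppart_cancel) simp_all
  have "sm 9 (sm 5 u1) = dih 1 1 (sm 5 (ppart c)) - dih 1 2 (sm 5 (ppart c))"
  proof -
    have "sm 9 (sm 5 u1) = sm 5 (dih 1 1 (ppart c) - dih 1 2 (ppart c))"
      using bspec[OF two_ppart_c range] by (simp add: c_def[symmetric] a_def[symmetric] u1_def)
    then show ?thesis using cI by (simp add: dih_lin sm_distribs)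
  qed
  then have "sm 9 (sm 5 u1) \<in> IP" using IP_dih[OF 5] by (simp only: IP_intros)
  then have u1: "sm 5 u1 \<in> IP" by (rule IP_cancel) (simp add: nonzero_more)
  have "sm 6 (sm 5 u) = sm 5 (ppart e) + sm (3 * hf) (sm 5 u1)"
  proof -
    have *: "ppart e = sm (- 3 * hf) u1 + sm 6 u"
      using bspec[OF two_ppart_e range] by (simp only: e_def[symmetric] a_def[symmetric] u1_def u_def)
    show ?thesis unfolding * by (rule vec_scale) (simp add: vec_eq vec_norm)
  qed
  then have "sm 6 (sm 5 u) \<in> IP" using e(1) u1 by (simp only: IP_intros)
  then have u: "sm 5 u \<in> IP" by (rule IP_cancel) (simp add: nonzero_more)
  define s where "s = sm (- 18) u + sm (- 18) u2 + sm 27 u1"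
  have "s \<in> I"
    unfolding s_def u_def u1_def u2_def bspec[OF two_c range, symmetric]
      a_def[symmetric] c_def[symmetric] using cI by (intro I_intros reflect_in_I) simp_all
  moreover have "ppart s = s"
    using uC by (simp add: s_def ppart_lin pu)
  ultimately have s: "s \<in> IP" by (simp add: IP_def)
  define k where "k = shadow (dih 1 (- 1) e) - ppart e"
  have k: "k \<in> IP" using e(2) by (simp add: k_def)
  have k4: "sm (- 4) k = sm 21 u - sm 6 u1 + sm 3 u2"
    using bspec[OF two_e range] by (simp only: a_def[symmetric] e_def[symmetric] k_def u_def u1_def u2_def)
  define q where "q = sm 12 u - u1"
  \<comment> \<open>The factor 6 cancels \<open>u2\<close>. The relation that is left has no common
    factor 5 and is therefore informative in characteristic 5 too.\<close>
  have "sm 9 q = sm 6 (sm (- 4) k) + s"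
    unfolding k4 s_def q_def by (rule vec_scale) (simp add: vec_eq vec_norm)
  then have "sm 9 q \<in> IP" using s k by (simp only: IP_intros)
  then have q: "q \<in> IP" by (rule IP_cancel) (simp add: nonzero_more)
  have "sm 24 (dih 1 1 x - x) - c - sm 8 e =
      sm (- 3) (dih 1 1 q - dih 1 2 q) + sm 4 (dih 1 2 q + dih 1 1 q - sm 2 q) - sm 20 (dih 1 2 u + dih 1 1 u - sm 2 u)"
    using bspec[OF two_shift range]
    by (simp only: a_def[symmetric] e_def[symmetric] c_def[symmetric] u_def[symmetric] u1_def[symmetric] q_def[symmetric])
  \<comment> \<open>Apart from \<open>q\<close>, the vector \<open>u\<close> enters only with the
    factor 20, so \<open>sm 5 u\<close> suffices.\<close>
  moreover have "sm 20 (dih 1 2 u + dih 1 1 u - sm 2 u) =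
      sm 4 (dih 1 2 (sm 5 u) + dih 1 1 (sm 5 u) - sm 2 (sm 5 u))"
    using uC by (simp add: dih_lin sm_distribs)
  ultimately have "sm 24 (dih 1 1 x - x) - c - sm 8 e =
      sm (- 3) (dih 1 1 q - dih 1 2 q) + sm 4 (dih 1 2 q + dih 1 1 q - sm 2 q) -
      sm 4 (dih 1 2 (sm 5 u) + dih 1 1 (sm 5 u) - sm 2 (sm 5 u))"
    by (simp only:)
  also have "\<dots> \<in> I" using IP_dih[OF q] IP_dih[OF u] u q
    by (intro IP_I) (simp only: IP_intros)
  finally have "sm 24 (dih 1 1 x - x) - c - sm 8 e + c + sm 8 e \<in> I"
    using cI eI by (simp only: I_add I_sm)
  then have "sm 24 (dih 1 1 x - x) \<in> I" by simp
  then have "dih 1 1 x - x \<in> I" by (rule I_cancel) (simp add: nonzero_more)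
  from I_add[OF this x] show ?thesis by simp
qed

text \<open>The scheme is that of \<open>proj2_shift\<close>, with \<open>v, v1, v2\<close> for the
  shadows and \<open>g\<close> for the independent \<open>P\<close>-part. The elements
  \<open>c\<close> and \<open>e\<close> give the multiples by 5 of \<open>g\<close> and
  \<open>w\<close>; \<open>q\<close> is the relation that remains in characteristic 5.\<close>

lemma proj0_shift:
  assumes x: "x \<in> I" and range: "x \<in> proj0 ` HC"
  shows "dih 1 1 x \<in> I"
proof -
  have xC: "x \<in> HC" using x by simp
  define a where "a = aV 1 \<odot> x - sm (3 * hf) x"
  define e where "e = a - dih (- 1) 0 a"
  define c where "c = sm 2 (a + dih (- 1) 0 a) - (sm 8 (sI 1 \<odot> x) - sm 6 x)"
  define v where "v = sm (- 2) (shadow x)"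
  define v1 where "v1 = sm (- 2) (shadow (dih 1 1 x))"
  define v2 where "v2 = sm (- 2) (shadow (dih 1 2 x))"
  define g where "g = dih 1 2 (ppart x) - dih 1 1 (ppart x)"
  have aI: "a \<in> I" using x by (simp add: a_def I_intros)
  have eI: "e \<in> I" using aI by (simp add: e_def I_intros reflect_in_I)
  have cI: "c \<in> I" using aI x by (simp add: c_def I_intros reflect_in_I)
  have vC: "v \<in> HC" "v1 \<in> HC" "v2 \<in> HC" "g \<in> HC" using xC by (simp_all add: v_def v1_def v2_def g_def)
  have pv: "ppart v = v" "ppart v1 = v1" "ppart v2 = v2" "ppart g = g"
    using xC bspec[OF ppart_shadow xC] bspec[OF ppart_dih xC]
    by (simp_all add: v_def v1_def v2_def g_def ppart_lin ppart_shadow_dih)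
  have anti: "dih (- 1) 0 e = - e"
    using bspec[OF rest_antisym range] by (simp only: e_def a_def)
  note e = antisym_in_I(2,3)[OF eI anti]
  define w where "w = sm 3 v1 + sm 2 v"
  have "sm (5 * hf\<^sup>2) (ppart c) \<in> I"
    using bspec[OF rest_eigen_c range] cI by (simp only: c_def[symmetric] a_def[symmetric]) (metis I_diff I_sm I_mult aV_in)
  then have 5: "sm 5 (ppart c) \<in> IP" using cI by (intro five_ppart_cancel) simp_all
  have *: "sm 5 (sm 2 g - w) = dih 1 1 (sm 5 (ppart c)) - dih 1 2 (sm 5 (ppart c))"
  proof -
    have "sm 2 g - w = dih 1 1 (ppart c) - dih 1 2 (ppart c)"
      using bspec[OF rest_ppart_c range]
      by (simp add: a_def[symmetric] c_def[symmetric] v_def[symmetric] v1_def[symmetric] g_def[symmetric] w_def)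
    then show ?thesis using cI by (simp add: dih_lin sm_distribs)
  qed
  have gw: "sm 5 (sm 2 g - w) \<in> IP" unfolding * using IP_dih[OF 5] by (rule IP_intros)
  have **: "sm 2 (ppart e) = w + sm 2 g"
  proof -
    have e: "ppart e = sm (3 * hf) v1 + v + g"
      using bspec[OF rest_ppart_e range]
      by (simp only: e_def[symmetric] a_def[symmetric] v_def v1_def g_def)
    show ?thesis unfolding e w_def by (rule vec_scale) (simp add: vec_eq vec_norm)
  qed
  have "sm 4 (sm 5 g) = sm 5 (sm 2 g - w) + sm 2 (sm 5 (ppart e))"
  proof -
    have w: "w = sm 2 (ppart e) - sm 2 g" using ** by simp
    show ?thesis unfolding w by (simp add: vec_eq algebra_simps)
  qed
  then have "sm 4 (sm 5 g) \<in> IP" using gw e(1) by (simp only: IP_intros)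
  then have g: "sm 5 g \<in> IP" by (rule IP_cancel) simp
  have "sm 5 w = sm 2 (sm 5 g) - sm 5 (sm 2 g - w)"
    by (simp add: vec_eq algebra_simps)
  then have w: "sm 5 w \<in> IP" using gw g by (simp only: IP_intros)
  define s where "s = sm 15 v1 - sm 4 v - sm 2 g - sm 6 v2"
  have "s \<in> I"
    unfolding s_def v_def v1_def v2_def g_def bspec[OF rest_c range, symmetric]
      a_def[symmetric] c_def[symmetric] using cI by (intro I_intros reflect_in_I) simp_all
  moreover have "ppart s = s"
    using vC by (simp add: s_def ppart_lin pv)
  ultimately have s: "s \<in> IP" by (simp add: IP_def)
  define k where "k = shadow (dih 1 (- 1) e) - ppart e"
  have k: "k \<in> IP" using e(2) by (simp add: k_def)
  have k4: "sm (- 4) k = sm 3 v + sm 4 g + sm 6 v1 + v2"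
    using bspec[OF rest_e range] by (simp only: a_def[symmetric] e_def[symmetric] k_def v_def v1_def v2_def g_def)
  define q where "q = sm 2 w + sm 2 g - sm 20 v"
  \<comment> \<open>The factor 6 cancels \<open>v2\<close>. Subtracting known multiples of
    \<open>sm 5 w\<close> and \<open>sm 5 g\<close> leaves \<open>v\<close> outside \<open>w\<close>
    with the coefficient -20 only.\<close>
  have "q = sm 6 (sm (- 4) k) + s - sm 3 (sm 5 w) - sm 4 (sm 5 g)"
    unfolding k4 s_def q_def w_def by (rule vec_scale) (simp add: vec_eq vec_norm)
  then have q: "q \<in> IP" using s k w g by (simp only: IP_intros)
  \<comment> \<open>In characteristic 5 this vector is zero; otherwise 5 can be cancelled from
    \<open>sm 5 w\<close> and \<open>sm 5 g\<close>.\<close>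
  have v: "sm 20 v \<in> IP"
  proof (cases "(5::'a) = 0")
    case True
    have "(20::'a) = 4 * 5" by simp
    also have "\<dots> = 0" using True by simp
    finally show ?thesis using IP_intros(3)[OF q, of 0] by simp
  next
    case False
    have "sm 20 v = sm 2 w + sm 2 g - q" by (simp add: q_def)
    then show ?thesis using IP_cancel[OF w False] IP_cancel[OF g False] q by (simp only: IP_intros)
  qed
  \<comment> \<open>The right-hand side of \<open>rest_shift\<close>, regrouped into
    \<open>sm 5 w\<close>, \<open>sm 5 g\<close>, \<open>q\<close>, \<open>sm 20 v\<close> and their
    translates, all of which lie in \<open>IP\<close>.\<close>
  define R where "R = sm 5 (dih 1 2 w) - sm 5 w - (sm 5 w - sm 5 (dih 1 1 w)) - sm 10 (dih 1 2 g - g) - sm 20 (g - dih 1 1 g)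
    + (q - dih 1 1 q) + (sm 20 v - dih 1 1 (sm 20 v))"
  have "sm (- 24) (dih 1 1 x - x) - sm 3 c - sm 24 e =
      sm 4 (dih 1 2 (w + sm 2 g) + dih 1 1 (w + sm 2 g) - sm 2 (w + sm 2 g)) -
      (dih 1 1 (w - sm 2 g) - dih 1 2 (w - sm 2 g)) - sm 8 (sm 2 (dih 1 2 g) - g - dih 1 1 g)"
    using bspec[OF rest_shift range]
    by (simp only: a_def[symmetric] e_def[symmetric] c_def[symmetric] v_def[symmetric] v1_def[symmetric]
        g_def[symmetric] w_def[symmetric])
  also have "\<dots> = R"
  proof -
    have wC: "w \<in> HC" using vC by (simp add: w_def)
    show ?thesis unfolding R_def q_def using vC wC
      by (simp add: dih_lin sm_distribs) (simp add: vec_eq algebra_simps)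
  qed
  also have "R \<in> I"
  proof -
    have "sm 5 (dih 1 2 w) = dih 1 2 (sm 5 w)" "sm 5 (dih 1 1 w) = dih 1 1 (sm 5 w)"
      "sm 10 (dih 1 2 g - g) = sm 2 (dih 1 2 (sm 5 g) - sm 5 g)"
      "sm 20 (g - dih 1 1 g) = sm 4 (sm 5 g - dih 1 1 (sm 5 g))"
      using vC by (simp_all add: dih_lin sm_distribs w_def)
    then show ?thesis unfolding R_def
      using IP_dih[OF q] IP_dih[OF w] IP_dih[OF g] IP_dih[OF v] q w g v
      by (intro IP_I) (simp only: IP_intros)
  qed
  finally have "sm (- 24) (dih 1 1 x - x) - sm 3 c - sm 24 e + sm 3 c + sm 24 e \<in> I"
    using cI eI by (simp only: I_add I_sm)
  then have "sm (- 24) (dih 1 1 x - x) \<in> I" by simp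
  then have "dih 1 1 x - x \<in> I" by (rule I_cancel) (simp add: nonzero_more)
  from I_add[OF this x] show ?thesis by simp
qed

lemma proj1_multiple:
  assumes "x \<in> HC"
  shows "\<exists>c. proj1 x = sm c (aV 0)"
  using assms
proof (rule vecs_induct)
  show "\<exists>c. proj1 0 = sm c (aV 0)" by (rule exI[of _ 0]) simp
next
  fix c b and v :: "hidx \<Rightarrow> 'a"
  assume b: "valid_hat b" and v: "v \<in> HC" and "\<exists>d. proj1 v = sm d (aV 0)"
  then obtain d where d: "proj1 v = sm d (aV 0)" by blast
  have "proj1 (uvec b) = aV 0 \<or> proj1 (uvec b) = 0"
    by (cases b) (simp_all add: proj1_def from_basis_def)
  then obtain d' where "proj1 (uvec b) = sm d' (aV 0)"
    by (metis sm_simps(1,3))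
  then have "proj1 (sm c (uvec b) + v) = sm (c * d' + d) (aV 0)"
    using b v d by (simp add: proj_lin sm_distribs)
  then show "\<exists>d. proj1 (sm c (uvec b) + v) = sm d (aV 0)" by blast
qed

text \<open>The vector \<open>b\<close> equals half of \<open>aV 1\<close> plus \<open>sI 1\<close>.
  Its products with \<open>aV 1\<close> and \<open>sI 1\<close>, together with
  \<open>aV 2 \<odot> aV 0\<close>, suffice to eliminate \<open>aV 0\<close>, \<open>aV 2\<close>,
  \<open>sI 1\<close> and \<open>sI 2\<close>.\<close>

lemma aV_0_shift:
  assumes "aV 0 \<in> I"
  shows "aV 1 \<in> I"
proof -
  define b where "b = aV 1 \<odot> aV 0 - sm hf (aV 0)"
  have b: "b \<in> I" using assms by (simp add: b_def I_intros)
  have "sm hf (aV 1) = aV 1 \<odot> b + sm (3 * hf\<^sup>2) b - sI 1 \<odot> b - sm (3 * hf ^ 3) (aV 2 \<odot> aV 0)"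
    unfolding b_def by (simp add: lin_op_eval; rule vec_scale; simp add: vec_eq vec_norm)
  also have "\<dots> \<in> I" using b assms by (intro I_intros) simp_all
  finally show ?thesis by (rule I_cancel) (use hf in auto)
qed

lemma shift_in_I:
  assumes x: "x \<in> I"
  shows "dih 1 1 x \<in> I"
proof -
  have xC: "x \<in> HC" using x by simp
  define xh where "xh = x - dih (- 1) 0 x"
  have "\<forall>y\<in>HC. dih (- 1) 0 (dih (- 1) 0 y) = y"
    by (rule lin_op_eqI; (intro lin_op_intros lin_op_dih; simp; fail)?; simp add: lin_op_eval)
  from bspec[OF this xC] have "dih (- 1) 0 xh = - xh" using xC by (simp add: xh_def dih_lin)
  moreover have "xh \<in> I" using eigen_in_I(4)[OF x] by (simp add: xh_def)
  ultimately have h: "dih 1 1 xh \<in> I" by (intro antisym_in_I)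
  obtain c where c: "proj1 x = sm c (aV 0)" using proj1_multiple[OF xC] by blast
  have 1: "dih 1 1 (proj1 x) \<in> I"
  proof (cases "c = 0")
    case True
    then show ?thesis using c I_sm[OF x, of 0] by simp
  next
    case False
    then have "aV 0 \<in> I" using eigen_in_I(1)[OF x] c by (metis I_cancel)
    then show ?thesis using aV_0_shift by (simp add: c dih_lin I_intros)
  qed
  have 2: "dih 1 1 (proj2 x) \<in> I" using proj2_shift[OF eigen_in_I(2)[OF x]] xC by blast
  have 0: "dih 1 1 (proj0 x) \<in> I" using proj0_shift[OF eigen_in_I(3)[OF x]] xC by blast
  have "dih 1 1 x = dih 1 1 (proj1 x + proj2 x + sm hf xh + proj0 x)"
    using bspec[OF decompose xC] by (simp only: xh_def)
  also have "\<dots> = dih 1 1 (proj1 x) + dih 1 1 (proj2 x) + sm hf (dih 1 1 xh) + dih 1 1 (proj0 x)"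
    using xC by (simp add: dih_lin xh_def)
  also have "\<dots> \<in> I" using 0 1 2 h by (intro I_intros)
  finally show ?thesis .
qed

lemma dih_in_I:
  assumes "e = 1 \<or> e = - 1" and x: "x \<in> I"
  shows "dih e c x \<in> I"
proof -
  have unshift: "dih 1 (- 1) y \<in> I" if y: "y \<in> I" for y
  proof -
    \<comment> \<open>Conjugation by the reflection inverts the translation.\<close>
    have "dih (- 1) 0 (dih 1 1 (dih (- 1) 0 y)) = dih 1 (- 1) y"
      using y by (simp add: dih_comp)
    then show ?thesis using shift_in_I reflect_in_I y by metis
  qed
  have shift: "dih 1 c y \<in> I" if y: "y \<in> I" for c y
  proof (induction c rule: int_induct[where k = 0])
    case base
    have "dih 1 0 y = y" using y by (simp add: dih_id)
    then show ?case using y by simp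
  next
    case (step1 i)
    then show ?case using shift_in_I[of "dih 1 i y"] y by (simp add: dih_comp add.commute)
  next
    case (step2 i)
    then show ?case using unshift[of "dih 1 i y"] y by (simp add: dih_comp add.commute)
  qed
  have "dih (- 1) c x = dih 1 c (dih (- 1) 0 x)" using x by (simp add: dih_comp)
  then show ?thesis using assms shift reflect_in_I by metis
qed

end

section \<open>Quotients\<close>

text \<open>A common form of both algebras, so that quotients are treated once.\<close>

definition vec_alg :: "(hidx \<Rightarrow> bool) \<Rightarrow> (hidx \<Rightarrow> hidx \<Rightarrow> hidx \<Rightarrow> 'a::field) \<Rightarrow> (hidx \<Rightarrow> 'a, 'a) alg" where
  "vec_alg ok B = \<lparr>acar = vecs ok, aadd = (+), asmult = sm, amult = bilin_mult B\<rparr>"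

lemma Hhat_eq: "Hhat = vec_alg valid_hat bprod_hat"
  by (simp add: Hhat_def vec_alg_def vecs_def)

lemma Highwater_eq: "Highwater = vec_alg valid_hw bprod_hw"
  by (simp add: Highwater_def vec_alg_def vecs_def)

lemma vec_alg_sel [simp]:
  "acar (vec_alg ok B) = vecs ok" "aadd (vec_alg ok B) = (+)"
  "asmult (vec_alg ok B) = sm" "amult (vec_alg ok B) = bilin_mult B"
  by (simp_all add: vec_alg_def)

locale vec_quotient =
  fixes ok :: "hidx \<Rightarrow> bool" and B :: "hidx \<Rightarrow> hidx \<Rightarrow> hidx \<Rightarrow> 'a::field" and I
  assumes B_in: "\<And>i j. ok i \<Longrightarrow> ok j \<Longrightarrow> B i j \<in> vecs ok"
    and ideal: "alg_ideal (vec_alg ok B) I"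
begin

lemma I_in: "x \<in> I \<Longrightarrow> x \<in> vecs ok"
  and I_add: "x \<in> I \<Longrightarrow> y \<in> I \<Longrightarrow> x + y \<in> I"
  and I_sm: "x \<in> I \<Longrightarrow> sm c x \<in> I"
  and I_mult: "x \<in> I \<Longrightarrow> y \<in> vecs ok \<Longrightarrow> bilin_mult B x y \<in> I"
  and I_mult': "x \<in> I \<Longrightarrow> y \<in> vecs ok \<Longrightarrow> bilin_mult B y x \<in> I"
  using ideal by (auto simp: alg_ideal_def)

lemma I_zero: "0 \<in> I"
proof -
  obtain x where "x \<in> I" using ideal by (auto simp: alg_ideal_def)
  then show ?thesis using I_sm[of x 0] by simp
qed

lemma I_diff: "x \<in> I \<Longrightarrow> y \<in> I \<Longrightarrow> x - y \<in> I"
  using I_add[of x "sm (- 1) y"] I_sm[of y "- 1"] by (simp add: sm_minus_one)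

lemma mult_in: "x \<in> vecs ok \<Longrightarrow> y \<in> vecs ok \<Longrightarrow> bilin_mult B x y \<in> vecs ok"
  using B_in by (rule bilin_mult_in_vecs)

abbreviation cst :: "(hidx \<Rightarrow> 'a) \<Rightarrow> (hidx \<Rightarrow> 'a) set" where
  "cst \<equiv> coset (vec_alg ok B) I"

lemma mem_cst: "y \<in> cst x \<longleftrightarrow> y - x \<in> I"
proof
  assume "y - x \<in> I"
  then have "y = x + (y - x) \<and> y - x \<in> I" by simp
  then show "y \<in> cst x" unfolding coset_def vec_alg_sel by blast
qed (auto simp: coset_def)

lemma cst_add: "aadd (quot_alg (vec_alg ok B) I) (cst x) (cst y) = cst (x + y)"
proof -
  have "z \<in> {x' + y' |x' y'. x' \<in> cst x \<and> y' \<in> cst y} \<longleftrightarrow> z \<in> cst (x + y)" for z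
  proof
    assume "z \<in> {x' + y' |x' y'. x' \<in> cst x \<and> y' \<in> cst y}"
    then obtain x' y' where z: "z = x' + y'" "x' - x \<in> I" "y' - y \<in> I" by (auto simp: mem_cst)
    have "z - (x + y) = (x' - x) + (y' - y)" by (simp add: z)
    then show "z \<in> cst (x + y)" using z I_add by (simp only: mem_cst)
  next
    assume "z \<in> cst (x + y)"
    then have "z = (z - y) + y" "z - y \<in> cst x" "y \<in> cst y"
      using I_zero by (simp_all add: mem_cst algebra_simps)
    then show "z \<in> {x' + y' |x' y'. x' \<in> cst x \<and> y' \<in> cst y}" by blast
  qed
  then show ?thesis by (auto simp: quot_alg_def)
qed

lemma cst_sm: "asmult (quot_alg (vec_alg ok B) I) c (cst x) = cst (sm c x)"
proof -
  have "z \<in> {sm c x' + w |x' w. x' \<in> cst x \<and> w \<in> I} \<longleftrightarrow> z \<in> cst (sm c x)" for z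
  proof
    assume "z \<in> {sm c x' + w |x' w. x' \<in> cst x \<and> w \<in> I}"
    then obtain x' w where z: "z = sm c x' + w" "x' - x \<in> I" "w \<in> I" by (auto simp: mem_cst)
    have "z - sm c x = sm c (x' - x) + w" by (simp add: z sm_distribs)
    then show "z \<in> cst (sm c x)" using z I_add I_sm by (simp only: mem_cst)
  next
    assume "z \<in> cst (sm c x)"
    then have "z = sm c x + (z - sm c x)" "x \<in> cst x" "z - sm c x \<in> I"
      using I_zero by (simp_all add: mem_cst)
    then show "z \<in> {sm c x' + w |x' w. x' \<in> cst x \<and> w \<in> I}" by blast
  qed
  then show ?thesis by (auto simp: quot_alg_def)
qed

lemma cst_mult:
  assumes "x \<in> vecs ok" "y \<in> vecs ok"
  shows "amult (quot_alg (vec_alg ok B) I) (cst x) (cst y) = cst (bilin_mult B x y)"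
proof -
  have "z \<in> {bilin_mult B x' y' + w |x' y' w. x' \<in> cst x \<and> y' \<in> cst y \<and> w \<in> I}
      \<longleftrightarrow> z \<in> cst (bilin_mult B x y)" for z
  proof
    assume "z \<in> {bilin_mult B x' y' + w |x' y' w. x' \<in> cst x \<and> y' \<in> cst y \<and> w \<in> I}"
    then obtain x' y' w where z: "z = bilin_mult B x' y' + w" "x' - x \<in> I" "y' - y \<in> I" "w \<in> I"
      by (auto simp: mem_cst)
    define u v where "u = x' - x" and "v = y' - y"
    have uv: "u \<in> I" "v \<in> I" "u \<in> vecs ok" "v \<in> vecs ok" using z I_in by (auto simp: u_def v_def)
    have xy: "x' = x + u" "y' = y + v" by (simp_all add: u_def v_def)
    have "z - bilin_mult B x y = bilin_mult B u y + (bilin_mult B x v + bilin_mult B u v) + w"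
      using assms uv by (simp add: z xy bilin_mult_simps[where ok = ok])
    also have "\<dots> \<in> I" using assms uv z(4) by (intro I_add I_mult I_mult'[of v x])
    finally show "z \<in> cst (bilin_mult B x y)" by (simp only: mem_cst)
  next
    assume "z \<in> cst (bilin_mult B x y)"
    then have "z = bilin_mult B x y + (z - bilin_mult B x y)" "x \<in> cst x" "y \<in> cst y" "z - bilin_mult B x y \<in> I"
      using I_zero by (simp_all add: mem_cst)
    then show "z \<in> {bilin_mult B x' y' + w |x' y' w. x' \<in> cst x \<and> y' \<in> cst y \<and> w \<in> I}" by blast
  qed
  then show ?thesis by (auto simp: quot_alg_def)
qed

lemma acar_quot: "acar (quot_alg (vec_alg ok B) I) = cst ` vecs ok"
  by (simp add: quot_alg_def)

lemma quotient_symmetric: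
  assumes ab: "a \<in> vecs ok" "b \<in> vecs ok"
    and gen: "\<And>X. alg_closed (vec_alg ok B) X \<Longrightarrow> a \<in> X \<Longrightarrow> b \<in> X \<Longrightarrow> X = vecs ok"
    and f: "lin_on ok f" "\<And>x. x \<in> vecs ok \<Longrightarrow> f x \<in> vecs ok" "\<And>x. x \<in> vecs ok \<Longrightarrow> f (f x) = x"
      "\<And>x y. x \<in> vecs ok \<Longrightarrow> y \<in> vecs ok \<Longrightarrow> f (bilin_mult B x y) = bilin_mult B (f x) (f y)"
      "\<And>x. x \<in> I \<Longrightarrow> f x \<in> I" "f a = b" "f b = a"
  shows "alg_symmetric (quot_alg (vec_alg ok B) I) (cst a) (cst b)"
proof -
  let ?Q = "quot_alg (vec_alg ok B) I"
  have "alg_generated_by ?Q {cst a, cst b}"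
    unfolding alg_generated_by_def
  proof (intro conjI allI impI)
    show "{cst a, cst b} \<subseteq> acar ?Q" using ab by (auto simp: acar_quot)
    fix Y assume Y: "alg_closed ?Q Y \<and> {cst a, cst b} \<subseteq> Y"
    \<comment> \<open>The preimage of a subalgebra of the quotient is a subalgebra, and it contains
      \<open>a\<close> and \<open>b\<close>.\<close>
    let ?X = "{x \<in> vecs ok. cst x \<in> Y}"
    have "cst (x + y) \<in> Y" "cst (bilin_mult B x y) \<in> Y" "cst (sm c x) \<in> Y" if "x \<in> ?X" "y \<in> ?X" for x y c
      using Y that cst_add[of x y] cst_mult[of x y] cst_sm[of c x] unfolding alg_closed_def
      by (metis (no_types, lifting) mem_Collect_eq)+
    then have "alg_closed (vec_alg ok B) ?X"
      by (auto simp: alg_closed_def mult_in)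
    then have "?X = vecs ok" using Y ab by (intro gen) auto
    then have "acar ?Q \<subseteq> Y" by (auto simp: acar_quot)
    then show "Y = acar ?Q" using Y by (auto simp: alg_closed_def)
  qed
  \<comment> \<open>Because \<open>f\<close> preserves \<open>I\<close> and is its own inverse, it
    maps cosets onto cosets; taking images of sets is then the induced automorphism.\<close>
  moreover have img: "f ` cst x = cst (f x)" if x: "x \<in> vecs ok" for x
  proof -
    have *: "f y \<in> cst (f x)" if "y \<in> cst x" "x \<in> vecs ok" for x y
    proof -
      have "y - x \<in> I" using that by (simp add: mem_cst)
      moreover have "y = x + (y - x)" by simp
      ultimately have "f y = f x + f (y - x)" using lin_onD(1)[OF f(1) that(2)] I_in by metis
      then show ?thesis using f(5)[OF \<open>y - x \<in> I\<close>] by (simp add: mem_cst)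
    qed
    show ?thesis
    proof
      show "f ` cst x \<subseteq> cst (f x)" using * x by blast
      show "cst (f x) \<subseteq> f ` cst x"
      proof
        fix y assume y: "y \<in> cst (f x)"
        then have "f y \<in> cst x" using *[OF y f(2)[OF x]] f(3)[OF x] by simp
        moreover have "y \<in> vecs ok"
        proof -
          have "y - f x \<in> vecs ok" using y I_in by (simp add: mem_cst)
          then have "f x + (y - f x) \<in> vecs ok" using f(2)[OF x] by (intro vecs_add)
          then show ?thesis by simp
        qed
        ultimately show "y \<in> f ` cst x" using f(3) by (metis imageI)
      qed
    qed
  qed
  moreover have "alg_aut ?Q (\<lambda>X. f ` X)"
  proof -
    have "bij_betw (\<lambda>X. f ` X) (cst ` vecs ok) (cst ` vecs ok)"
      by (rule bij_betw_byWitness[where f' = "\<lambda>X. f ` X"]) (auto simp: img f(2,3))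
    moreover have "x + y \<in> vecs ok" if "x \<in> vecs ok" "y \<in> vecs ok" for x y :: "hidx \<Rightarrow> 'a" using that by simp
    ultimately show ?thesis
      unfolding alg_aut_def acar_quot
      by (auto simp: cst_add cst_sm cst_mult img f(2,4) mult_in lin_onD[OF f(1)])
  qed
  ultimately show ?thesis
    unfolding alg_symmetric_def
    using ab f(2,3,6,7) by (intro conjI exI[of _ "\<lambda>X. f ` X"]) (auto simp: img acar_quot)
qed

end

section \<open>Generation by \<open>aV 0\<close> and \<open>aV 1\<close>\<close>

context char_not_2_3
begin

text \<open>The difference is \<open>2 pI r k\<close> minus the other two residues, which together
  equal \<open>- pI r k\<close>.\<close>

lemma pI_from_zI: "sm 3 (pI r k) = zI (r + 2) k - (zI (r + 1) k :: hidx \<Rightarrow> 'a)"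
proof -
  have "pI (r + 3) k = (pI r k :: hidx \<Rightarrow> 'a)" by (rule pI_cong) simp
  moreover have "r + 2 + 1 = r + 3" "r + 2 - 1 = r + 1" "r + 1 + 1 = r + 2" "r + 1 - 1 = r" by simp_all
  ultimately show ?thesis
    unfolding zI_def by (simp only: pI_third) (simp add: vec_eq)
qed

lemma hat_generated:
  assumes X: "alg_closed Hhat X" and a: "aV 0 \<in> X" "aV 1 \<in> X"
  shows "X = HC"
proof -
  have X_in: "x \<in> HC" if "x \<in> X" for x using X that by (auto simp: alg_closed_def)
  have add: "x + y \<in> X" and mult: "x \<odot> y \<in> X" if "x \<in> X" "y \<in> X" for x y
    using X that by (auto simp: alg_closed_def)
  have smult: "sm c x \<in> X" if "x \<in> X" for x c
    using X that by (auto simp: alg_closed_def)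
  have diff: "x - y \<in> X" if "x \<in> X" "y \<in> X" for x y
    using add[OF that(1) smult[OF that(2), of "- 1"]] by (simp add: sm_minus_one)
  have cancel: "x \<in> X" if "sm c x \<in> X" "c \<noteq> 0" for c x
    using smult[OF that(1), of "inverse c"] that(2) by simp
  have s1: "sI 1 \<in> X"
  proof -
    have "sI 1 = aV 0 \<odot> aV 1 - sm hf (aV 0 + aV 1)"
      by (simp add: lin_op_eval)
    then show ?thesis using a by (simp add: add mult smult diff)
  qed
  \<comment> \<open>Multiplication by \<open>sI 1\<close> isolates the sum of the two neighbours of
    \<open>aV i\<close>, so two consecutive vectors generate all others in both directions.\<close>
  have step: "aV (i - 1) + aV (i + 1) \<in> X" if "aV i \<in> X" for i
  proof (rule cancel[of "3 * hf ^ 3"])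
    have "sm (3 * hf ^ 3) (aV (i - 1) + aV (i + 1))
        = sI 1 \<odot> aV i - (sm (- 3 * hf\<^sup>2) (aV i) + sm (3 * hf) (sI 1))"
      by (simp add: s1_mult)
    also have "\<dots> \<in> X" using that s1 by (blast intro: add mult smult diff)
    finally show "sm (3 * hf ^ 3) (aV (i - 1) + aV (i + 1)) \<in> X" .
  qed (use hf in auto)
  have "aV i \<in> X \<and> aV (i + 1) \<in> X" for i
  proof (induction i rule: int_induct[where k = 0])
    case (step1 i)
    then have "aV i + aV (i + 1 + 1) - aV i \<in> X" using step[of "i + 1"] by (intro diff) simp_all
    then show ?case using step1 by simp
  next
    case (step2 i)
    then have "aV (i - 1) + aV (i + 1) - aV (i + 1) \<in> X" using step[of i] by (intro diff) simp_all
    then show ?case using step2 by simp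
  qed (use a in simp)
  then have aX: "aV i \<in> X" for i by blast
  have sz: "sI j + zI i j \<in> X" for i j
  proof -
    have "sI j + zI i j = aV i \<odot> aV (i + j) - sm hf (aV i + aV (i + j))"
      by (simp add: aV_mult_aV')
    then show ?thesis using aX by (simp add: add mult smult diff)
  qed
  have sX: "sI j \<in> X" for j
  proof (rule cancel[of 3])
    \<comment> \<open>The three \<open>z\<close>-terms add up to zero, so summing over all residues
      isolates \<open>sI j\<close>.\<close>
    have "sm 3 (sI j) = (sI j + zI 0 j) + (sI j + zI 1 j) + (sI j + zI 2 j :: hidx \<Rightarrow> 'a)"
      by (simp add: zI_def pI_reduce) (simp add: vec_eq algebra_simps)
    then show "sm 3 (sI j) \<in> X" using sz by (simp only: add)
  qed simp
  have zX: "zI i j \<in> X" for i j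
    using diff[OF sz[of j i] sX[of j]] by simp
  have pX: "pI r k \<in> X" for r k
    by (rule cancel[of 3]) (use zX in \<open>simp_all add: pI_from_zI diff\<close>)
  have "x \<in> X" if "x \<in> HC" for x
    using that
  proof (rule vecs_induct)
    show "0 \<in> X" using smult[OF a(1), of 0] by simp
    fix c b and v :: "hidx \<Rightarrow> 'a"
    assume b: "valid_hat b" and v: "v \<in> X"
    have "uvec b \<in> X"
    proof (cases b)
      case (A i)
      then show ?thesis using aX[of i] by (simp add: aV_def)
    next
      case (S j)
      then show ?thesis using sX[of "int j"] b by (simp add: sI_def sV_def)
    next
      case (P r k)
      then show ?thesis using pX[of r "int k"] b by (auto simp: pI_def pV_def)
    qed
    then show "sm c (uvec b) + v \<in> X" using v by (simp add: add smult)
  qed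
  then show ?thesis using X_in by blast
qed

section \<open>The Highwater algebra as a quotient\<close>

text \<open>The quotient map that kills the \<open>P\<close>-span, realised as a projection onto the
  vectors supported on \<open>valid_hw\<close>.\<close>

definition hw_part :: "(hidx \<Rightarrow> 'a) \<Rightarrow> hidx \<Rightarrow> 'a" where
  "hw_part = from_basis aV sI (\<lambda>_ _. 0)"

lemma lin_op_hw_part: "lin_op hw_part"
  unfolding hw_part_def by (rule lin_op_from_basis) simp_all

lemma hw_subset: "x \<in> vecs valid_hw \<Longrightarrow> x \<in> HC"
proof -
  have "valid_hw b \<Longrightarrow> valid_hat b" for b by (cases b) auto
  then show "x \<in> vecs valid_hw \<Longrightarrow> x \<in> HC" by (auto simp: vecs_def)
qed

lemma aV_sI_in_hw [simp]: "aV i \<in> vecs valid_hw" "sI j \<in> vecs valid_hw" "sV k \<in> vecs valid_hw"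
proof -
  show "sV k \<in> vecs valid_hw" for k by (simp add: sV_def)
  then show "sI j \<in> vecs valid_hw" by (simp add: sI_def)
qed (simp add: aV_def)

lemma hw_part_in: "x \<in> HC \<Longrightarrow> hw_part x \<in> vecs valid_hw"
  unfolding hw_part_def from_basis_def
  by (rule ext_in_vecs[where ok = valid_hat]) (auto split: hidx.split)

lemma lin_on_hw_part: "lin_on ok hw_part"
  by (simp add: hw_part_def from_basis_def)

lemma hw_part_id: "x \<in> vecs valid_hw \<Longrightarrow> hw_part x = x"
proof (rule lin_on_eqI[OF lin_on_hw_part lin_on_intros(1)])
  fix b assume "valid_hw b"
  then show "hw_part (uvec b) = uvec b"
    by (cases b) (auto simp: hw_part_def from_basis_def aV_def sI_def sV_def)
qed

lemma hw_part_aV: "hw_part (aV i) = aV i"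
  by (simp add: hw_part_id)

lemma hw_part_sV: "hw_part (sV i) = sV i"
  by (simp add: hw_part_id)

lemma hw_part_zero: "hw_part 0 = 0"
  by (simp add: hw_part_id)

lemma hw_part_pV: "hw_part (pV r k) = 0"
proof (cases "k > 0 \<and> 3 dvd k")
  case True
  have "hw_part (uvec (P u k)) = 0" for u
    by (simp add: hw_part_def from_basis_def)
  then show ?thesis using True by (intro pI_lin_zero[where F = hw_part, OF lin_on_hw_part]) auto
next
  case False
  then have "pV r k = (0 :: hidx \<Rightarrow> 'a)" by (auto simp: pV_not_dvd)
  then show ?thesis by (simp add: hw_part_zero)
qed

lemma bprod_hw_in: "valid_hw i \<Longrightarrow> valid_hw j \<Longrightarrow> bprod_hw i j \<in> vecs valid_hw"
  by (cases "(i, j)" rule: bprod_hw.cases) (auto simp: prodSS_def)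

lemmas hw_part_lin = lin_onD[OF lin_on_hw_part] lin_on_more(1,2)[OF lin_on_hw_part]

lemma hw_part_zV: "hw_part (zV r k) = 0"
proof -
  have "hw_part (zV r k) = hw_part (pV (r + 1) k) - hw_part (pV (r - 1) k)"
    unfolding zV_def by (rule hw_part_lin(4)) (rule pV_in)+
  then show ?thesis by (simp add: hw_part_pV)
qed

text \<open>Deleting the \<open>P\<close>-terms from the formulas for \<open>bprod_hat\<close> gives
  those for \<open>bprod_hw\<close>, and every product with a \<open>P\<close>-vector stays in the
  \<open>P\<close>-span.\<close>

lemma hw_part_hmul:
  assumes "x \<in> HC" "y \<in> HC"
  shows "hw_part (x \<odot> y) = bilin_mult bprod_hw (hw_part x) (hw_part y)"
  unfolding hw_part_def from_basis_def
proof (rule bilin_mult_hom[OF assms bprod_hat_in, where ok' = valid_hw], goal_cases)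
  case (1 b)
  then show ?case by (cases b) simp_all
next
  case (2 i j)
  have zero: "bilin_mult bprod_hw 0 v = 0" "bilin_mult bprod_hw v 0 = 0" for v :: "hidx \<Rightarrow> 'a"
    by (simp_all add: bilin_mult_def fun_eq_iff zero_fun_apply supp_def)
  note part = hw_part_lin[of _ valid_hat] hw_part_aV hw_part_sV hw_part_pV hw_part_zV
  have "hw_part (bprod_hat i j) = bilin_mult bprod_hw
      (case i of A i \<Rightarrow> aV i | S j \<Rightarrow> sI (int j) | P r k \<Rightarrow> 0) (case j of A i \<Rightarrow> aV i | S j \<Rightarrow> sI (int j) | P r k \<Rightarrow> 0)"
    using 2
    by (cases "(i, j)" rule: bprod_hat.cases)
      (simp_all add: zero prodAA_def prodAS_def prodAP_def prodSS_def prodSP_def prodPP_def part,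
        auto simp: aV_def sI_def sV_def prodSS_def)
  then show ?case by (simp only: hw_part_def from_basis_def)
qed

lemma hw_part_dih: "x \<in> HC \<Longrightarrow> hw_part (dih e c x) = dih e c (hw_part x)" if "e = 1 \<or> e = - 1"
proof -
  have op: "lin_op (\<lambda>x. hw_part (F x))" if "lin_op F" for F :: "(hidx \<Rightarrow> 'a) \<Rightarrow> hidx \<Rightarrow> 'a"
    using that lin_op_hw_part by (auto simp: lin_op_def intro: lin_on_comp)
  have hs: "hw_part (sI j) = sI j" for j by (simp add: hw_part_id)
  have hp: "hw_part (pI r k) = 0" for r k by (simp add: pI_def hw_part_pV)
  have "\<forall>x\<in>HC. hw_part (dih e c x) = dih e c (hw_part x)"
    using that by (intro lin_op_eqI op lin_op_dih lin_op_intros(1)) (simp_all add: hw_part_aV hs hp hw_part_lin[of _ valid_hat])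
  then show "x \<in> HC \<Longrightarrow> hw_part (dih e c x) = dih e c (hw_part x)" by blast
qed

lemma dih_hw_in: "x \<in> vecs valid_hw \<Longrightarrow> dih e c x \<in> vecs valid_hw"
  unfolding dih_def
  by (rule ext_in_vecs[where ok = valid_hw]) (auto simp: dih_basis_def split: hidx.split)

end

section \<open>Idempotents and automorphisms\<close>

text \<open>For comparing leading coefficients: \<open>T\<close> lists the few pairs of basis
  vectors that can contribute to the coefficient at \<open>x\<close>.\<close>

lemma bilin_mult_apply_finite:
  assumes "finite (supp v)" "finite (supp w)" "finite T"
    and zero: "\<And>i j. i \<in> supp v \<Longrightarrow> j \<in> supp w \<Longrightarrow> (i, j) \<notin> T \<Longrightarrow> B i j x = 0"
  shows "bilin_mult B v w x = (\<Sum>(i, j)\<in>T. v i * w j * B i j x)"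
proof -
  have "bilin_mult B v w x = (\<Sum>(i, j)\<in>supp v \<times> supp w. v i * w j * B i j x)"
    unfolding bilin_mult_def by (rule sum.cartesian_product)
  also have "\<dots> = (\<Sum>(i, j)\<in>supp v \<times> supp w \<inter> T. v i * w j * B i j x)"
  proof (rule sum.mono_neutral_right)
    show "\<forall>z\<in>supp v \<times> supp w - supp v \<times> supp w \<inter> T. (case z of (i, j) \<Rightarrow> v i * w j * B i j x) = 0"
      by (clarify, subst zero) auto
  qed (use assms(1,2) in auto)
  also have "\<dots> = (\<Sum>(i, j)\<in>T. v i * w j * B i j x)"
    by (rule sum.mono_neutral_left) (use assms in \<open>auto simp: supp_def\<close>)
  finally show ?thesis .
qed

lemma basis_apply:
  "aV i (A n) = (if n = i then 1 else 0)" "aV i (S m) = 0" "aV i (P r k) = 0"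
  "sV j (A n) = 0" "sV j (S m) = (if j \<noteq> 0 \<and> m = j then 1 else 0)" "sV j (P r k) = 0"
  "pV r j (A n) = 0" "pV r j (S m) = 0" "zV r j (A n) = 0" "zV r j (S m) = 0"
  "m \<noteq> j \<Longrightarrow> pV r j (P q m) = 0" "m \<noteq> j \<Longrightarrow> zV r j (P q m) = 0"
  by (auto simp: aV_def sV_def pV_def zV_def uvec_def vec_eq)

lemma zV_apply_diag:
  assumes "k > 0" "3 dvd k"
  shows "zV (- 2) k (P 1 k) = 1" "zV (- 2) k (P 2 k) = 2" "zV (- 3) k (P 1 k) = 1" "zV (- 3) k (P 2 k) = - 1"
    "zV (- 4) k (P 1 k) = - 2" "zV (- 4) k (P 2 k) = - 1"
  using assms by (simp_all add: zV_def pV_def uvec_def vec_eq)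

lemma finite_vimage_constr:
  assumes "finite X"
  shows "finite {i. A i \<in> X}" "finite {j. S j \<in> X}" "finite {k. \<exists>r. P r k \<in> X}"
proof -
  show "finite {i. A i \<in> X}" "finite {j. S j \<in> X}"
    using finite_vimageI[OF assms, of A] finite_vimageI[OF assms, of S] by (auto simp: vimage_def inj_def)
  have "{k. \<exists>r. P r k \<in> X} \<subseteq> (\<lambda>b. case b of A i \<Rightarrow> 0 | S j \<Rightarrow> 0 | P r k \<Rightarrow> k) ` X"
    by force
  then show "finite {k. \<exists>r. P r k \<in> X}" using assms by (meson finite_imageI finite_subset)
qed

context char_not_2_3
begin

text \<open>For the largest indices \<open>m\<close> and \<open>d\<close>, only \<open>A m\<close>
  and \<open>S d\<close>, in both orders, contribute to the square at \<open>A (m + int d)\<close>.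
  The coefficient is nonzero there, but \<open>m + int d\<close> exceeds \<open>m\<close>.\<close>

lemma idempotent_A_or_S:
  fixes e :: "hidx \<Rightarrow> 'a"
  assumes e: "e \<in> HC" and idem: "e \<odot> e = e" and "A i \<in> supp e" "S j \<in> supp e"
  shows False
proof -
  have fin: "finite (supp e)" and val: "\<And>b. b \<in> supp e \<Longrightarrow> valid_hat b" using e by (auto simp: vecs_def)
  define m where "m = Max {i. A i \<in> supp e}"
  define d where "d = Max {j. S j \<in> supp e}"
  have m: "A m \<in> supp e" and m_max: "\<And>i. A i \<in> supp e \<Longrightarrow> i \<le> m"
    using Max_in[OF finite_vimage_constr(1)[OF fin]] Max_ge[OF finite_vimage_constr(1)[OF fin]] assms(3)
    unfolding m_def by auto
  have d: "S d \<in> supp e" and d_max: "\<And>j. S j \<in> supp e \<Longrightarrow> j \<le> d"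
    using Max_in[OF finite_vimage_constr(2)[OF fin]] Max_ge[OF finite_vimage_constr(2)[OF fin]] assms(4)
    unfolding d_def by auto
  have d1: "d \<ge> 1" using val[OF d] by simp
  let ?x = "A (m + int d)"
  have AS: "prodAS i j ?x = (if i = m \<and> j = d then 3/8 else (0::'a))"
    if "A i \<in> supp e" "S j \<in> supp e" for i j
    using m_max[OF that(1)] d_max[OF that(2)] val[OF that(2)] d1
    by (auto simp: prodAS_def basis_apply vec_eq)
  have AA: "prodAA i i' ?x = (0::'a)" if "A i \<in> supp e" "A i' \<in> supp e" for i i'
    using m_max[OF that(1)] m_max[OF that(2)] d1 by (auto simp: prodAA_def basis_apply vec_eq)
  have "(e \<odot> e) ?x = (\<Sum>(i, j)\<in>{(A m, S d), (S d, A m)}. e i * e j * bprod_hat i j ?x)"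
  proof (rule bilin_mult_apply_finite)
    fix i j assume "i \<in> supp e" "j \<in> supp e" "(i, j) \<notin> {(A m, S d), (S d, A m)}"
    then show "bprod_hat i j ?x = (0::'a)"
      by (cases "(i, j)" rule: bprod_hat.cases)
        (auto simp: AS AA prodAP_def prodSS_def prodSP_def prodPP_def basis_apply vec_eq)
  qed (use fin in auto)
  also have "\<dots> = e (A m) * e (S d) * (3/4)"
    using AS[OF m d] by (simp add: field_simps)
  finally have "e ?x = e (A m) * e (S d) * (3/4)" by (simp only: idem)
  moreover have "e (A m) * e (S d) * (3/4) \<noteq> 0" using m d by (simp add: supp_def)
  moreover have "e ?x = 0" using m_max[of "m + int d"] d1 by (auto simp: supp_def)
  ultimately show False by simp
qed

text \<open>Without \<open>A\<close>-terms, only the square of the leading \<open>S d\<close>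
  reaches \<open>S (2 * d)\<close>, with the coefficient -3/8.\<close>

lemma idempotent_no_S:
  fixes e :: "hidx \<Rightarrow> 'a"
  assumes e: "e \<in> HC" and idem: "e \<odot> e = e"
  shows "S j \<notin> supp e"
proof
  assume S: "S j \<in> supp e"
  then have noA: "A i \<notin> supp e" for i using idempotent_A_or_S[OF e idem] by blast
  have fin: "finite (supp e)" and val: "\<And>b. b \<in> supp e \<Longrightarrow> valid_hat b" using e by (auto simp: vecs_def)
  define d where "d = Max {j. S j \<in> supp e}"
  have d: "S d \<in> supp e" and d_max: "\<And>j. S j \<in> supp e \<Longrightarrow> j \<le> d"
    using Max_in[OF finite_vimage_constr(2)[OF fin]] Max_ge[OF finite_vimage_constr(2)[OF fin]] S
    unfolding d_def by auto
  have d1: "d \<ge> 1" using val[OF d] by simp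
  let ?x = "S (2 * d)"
  have SS: "prodSS i j ?x = (if i = d \<and> j = d then - 3/8 else (0::'a))"
    if "S i \<in> supp e" "S j \<in> supp e" for i j
    using d_max[OF that(1)] d_max[OF that(2)] val[OF that(1)] val[OF that(2)] d1
    by (auto simp: prodSS_def basis_apply vec_eq)
  have "(e \<odot> e) ?x = (\<Sum>(i, j)\<in>{(S d, S d)}. e i * e j * bprod_hat i j ?x)"
  proof (rule bilin_mult_apply_finite)
    fix i j assume "i \<in> supp e" "j \<in> supp e" "(i, j) \<notin> {(S d, S d)}"
    then show "bprod_hat i j ?x = (0::'a)"
      using noA
      by (cases "(i, j)" rule: bprod_hat.cases)
        (auto simp: SS prodSP_def prodPP_def basis_apply vec_eq)
  qed (use fin in auto)
  also have "\<dots> = e (S d) * e (S d) * (- 3/8)"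
    using SS[OF d d] by simp
  finally have "(e \<odot> e) ?x \<noteq> 0" using d by (simp add: supp_def)
  moreover have "e ?x = 0" using d_max[of "2 * d"] d1 by (auto simp: supp_def)
  ultimately show False by (simp add: idem)
qed

text \<open>Without \<open>S\<close>-terms in \<open>e\<close>, two extreme indices
  \<open>n < m\<close> would create a nonzero coefficient at \<open>S (nat (m - n))\<close>. The
  coefficient of the one remaining \<open>A\<close>-vector equals its own square.\<close>

lemma idempotent_single_A:
  fixes e :: "hidx \<Rightarrow> 'a"
  assumes e: "e \<in> HC" and idem: "e \<odot> e = e" and A: "A i \<in> supp e" "A i' \<in> supp e"
  shows "i = i'" "e (A i) = 1"
proof -
  note noS = idempotent_no_S[OF e idem]
  have fin: "finite (supp e)" and val: "\<And>b. b \<in> supp e \<Longrightarrow> valid_hat b" using e by (auto simp: vecs_def)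
  define m where "m = Max {i. A i \<in> supp e}"
  define n where "n = Min {i. A i \<in> supp e}"
  have m: "A m \<in> supp e" and m_max: "\<And>i. A i \<in> supp e \<Longrightarrow> i \<le> m"
    using Max_in[OF finite_vimage_constr(1)[OF fin]] Max_ge[OF finite_vimage_constr(1)[OF fin]] A
    unfolding m_def by auto
  have n: "A n \<in> supp e" and n_min: "\<And>i. A i \<in> supp e \<Longrightarrow> n \<le> i"
    using Min_in[OF finite_vimage_constr(1)[OF fin]] Min_le[OF finite_vimage_constr(1)[OF fin]] A
    unfolding n_def by auto
  have "m = n"
  proof (rule ccontr)
    assume "m \<noteq> n"
    then have mn: "n < m" using m_max[OF n] by simp
    let ?x = "S (nat (m - n))"
    have AA: "prodAA i j ?x = (if (i = m \<and> j = n) \<or> (i = n \<and> j = m) then 1 else (0::'a))"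
      if "A i \<in> supp e" "A j \<in> supp e" for i j
      using m_max[OF that(1)] n_min[OF that(1)] m_max[OF that(2)] n_min[OF that(2)] mn
      by (auto simp: prodAA_def basis_apply vec_eq)
    have "(e \<odot> e) ?x = (\<Sum>(i, j)\<in>{(A m, A n), (A n, A m)}. e i * e j * bprod_hat i j ?x)"
    proof (rule bilin_mult_apply_finite)
      fix i j assume "i \<in> supp e" "j \<in> supp e" "(i, j) \<notin> {(A m, A n), (A n, A m)}"
      then show "bprod_hat i j ?x = (0::'a)"
        using noS
        by (cases "(i, j)" rule: bprod_hat.cases)
          (auto simp: AA prodAP_def prodPP_def basis_apply vec_eq)
    qed (use fin in auto)
    also have "\<dots> = 2 * (e (A m) * e (A n))"
      using AA[OF m n] AA[OF n m] mn by simp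
    finally have "(e \<odot> e) ?x \<noteq> 0" using m n by (simp add: supp_def)
    moreover have "e ?x = 0" using noS by (auto simp: supp_def)
    ultimately show False by (simp add: idem)
  qed
  then have uniq: "k = m" if "A k \<in> supp e" for k using m_max[OF that] n_min[OF that] by simp
  then show "i = i'" using A by metis
  have "(e \<odot> e) (A m) = (\<Sum>(i, j)\<in>{(A m, A m)}. e i * e j * bprod_hat i j (A m))"
  proof (rule bilin_mult_apply_finite)
    fix i j assume "i \<in> supp e" "j \<in> supp e" "(i, j) \<notin> {(A m, A m)}"
    then show "bprod_hat i j (A m) = (0::'a)"
      using noS uniq
      by (cases "(i, j)" rule: bprod_hat.cases) (auto simp: prodAP_def prodPP_def basis_apply vec_eq)
  qed (use fin in auto)
  also have "\<dots> = e (A m) * e (A m)"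
    by (simp add: prodAA_def basis_apply vec_eq)
  finally have "e (A m) = 1" using m by (simp add: idem supp_def)
  then show "e (A i) = 1" using uniq[OF A(1)] by simp
qed

text \<open>With at most one \<open>A\<close>-vector present, \<open>P q (2 * d)\<close> arises only
  from products of \<open>P\<close>-vectors of maximal index \<open>d\<close>. Its coefficients for
  \<open>q = 1\<close> and \<open>q = 2\<close> are quadratic forms in \<open>a\<close> and
  \<open>b\<close> whose only common zero is \<open>a = b = 0\<close>.\<close>

lemma idempotent_no_P:
  fixes e :: "hidx \<Rightarrow> 'a"
  assumes e: "e \<in> HC" and idem: "e \<odot> e = e"
  shows "P r k \<notin> supp e"
proof
  assume P: "P r k \<in> supp e"
  note noS = idempotent_no_S[OF e idem] and uniq = idempotent_single_A(1)[OF e idem]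
  have fin: "finite (supp e)" and val: "\<And>b. b \<in> supp e \<Longrightarrow> valid_hat b" using e by (auto simp: vecs_def)
  define d where "d = Max {k. \<exists>r. P r k \<in> supp e}"
  have dex: "\<exists>r. P r d \<in> supp e" and d_max: "\<And>r k. P r k \<in> supp e \<Longrightarrow> k \<le> d"
    using Max_in[OF finite_vimage_constr(3)[OF fin]] Max_ge[OF finite_vimage_constr(3)[OF fin]] P
    unfolding d_def by blast+
  obtain r0 where r0: "P r0 d \<in> supp e" using dex by blast
  have d1: "d > 0" "3 dvd d" "r0 = 1 \<or> r0 = 2" using val[OF r0] by auto
  define a b where "a = e (P 1 d)" and "b = e (P 2 d)"
  have PPd: "prodPP r d t d (P q (2 * d)) = - (1/8) * (zV (- (r + t)) (2 * d) (P q (2 * d)) :: 'a)" for r t q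
  proof -
    have "zV u d (P q (2 * d)) = (0::'a)" "zV u 0 (P q (2 * d)) = (0::'a)" for u
      using d1(1) by (simp_all add: basis_apply)
    then show ?thesis
      unfolding prodPP_def sm_apply plus_fun_apply minus_apply by (simp flip: mult_2)
  qed
  have PP: "prodPP r h t k (P q (2 * d)) = (0::'a)"
    if "P r h \<in> supp e" "P t k \<in> supp e" "\<not> (h = d \<and> k = d)" for r h t k q
  proof -
    have "2 * d \<noteq> h" "2 * d \<noteq> k" "2 * d \<noteq> nat \<bar>int h - int k\<bar>" "2 * d \<noteq> h + k"
      using d_max[OF that(1)] d_max[OF that(2)] that(3) d1(1) by linarith+
    then show ?thesis
      unfolding prodPP_def sm_apply plus_fun_apply minus_apply by (simp add: basis_apply(12))
  qed
  have coeff: "(e \<odot> e) (P q (2 * d)) = - (1/8) * (a * a * zV (- 2) (2 * d) (P q (2 * d))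
      + 2 * (a * b * zV (- 3) (2 * d) (P q (2 * d))) + b * b * zV (- 4) (2 * d) (P q (2 * d)))" for q
  proof -
    let ?x = "P q (2 * d)"
    let ?T = "{(P 1 d, P 1 d), (P 1 d, P 2 d), (P 2 d, P 1 d), (P 2 d, P 2 d)}"
    have "(e \<odot> e) ?x = (\<Sum>(i, j)\<in>?T. e i * e j * bprod_hat i j ?x)"
    proof (rule bilin_mult_apply_finite)
      fix i j assume ij: "i \<in> supp e" "j \<in> supp e" "(i, j) \<notin> ?T"
      have AP: "prodAP i r k ?x = (0::'a)" if "P r k \<in> supp e" for i r k
        using d_max[OF that] d1 by (auto simp: prodAP_def basis_apply vec_eq)
      show "bprod_hat i j ?x = (0::'a)"
        using ij noS val[OF ij(1)] val[OF ij(2)]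
        by (cases "(i, j)" rule: bprod_hat.cases)
          (auto simp: AP PP prodAA_def basis_apply vec_eq zV_def dest: uniq)
    qed (use fin in auto)
    also have "\<dots> = - (1/8) * (a * a * zV (- 2) (2 * d) ?x
      + 2 * (a * b * zV (- 3) (2 * d) ?x) + b * b * zV (- 4) (2 * d) ?x)"
      by (simp add: a_def b_def PPd) (simp add: algebra_simps)
    finally show ?thesis .
  qed
  have zero: "e (P q (2 * d)) = 0" for q
    using d_max[of q "2 * d"] d1 by (auto simp: supp_def)
  have d2: "2 * d > 0" "3 dvd 2 * d" using d1 by auto
  have eighth: "x = 0" if "0 = - (1/8) * x" for x :: 'a
    using that by simp
  have "a * a * 1 + 2 * (a * b * 1) + b * b * (- 2) = 0"
    by (rule eighth) (use coeff[of 1] in \<open>simp only: idem zero zV_apply_diag[OF d2]\<close>)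
  then have 1: "a * a + 2 * (a * b) - 2 * (b * b) = 0" by (simp add: algebra_simps)
  have "a * a * 2 + 2 * (a * b * (- 1)) + b * b * (- 1) = 0"
    by (rule eighth) (use coeff[of 2] in \<open>simp only: idem zero zV_apply_diag[OF d2]\<close>)
  then have 2: "2 * (a * a) - 2 * (a * b) - b * b = 0" by (simp add: algebra_simps)
  \<comment> \<open>This is the sum of both forms. Either factor being zero turns the first form
    into a nonzero multiple of \<open>b * b\<close>.\<close>
  have "3 * ((a - b) * (a + b)) = 0" using 1 2 by algebra
  then have "a = b \<or> a = - b" by (simp add: eq_neg_iff_add_eq_0)
  then have "a = 0 \<and> b = 0"
  proof
    assume "a = b" then have "b * b = 0" using 1 by simp
    then show ?thesis using \<open>a = b\<close> by simp
  next
    assume "a = - b" then have "3 * (b * b) = 0" using 1 by simp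
    then show ?thesis using \<open>a = - b\<close> by simp
  qed
  then show False using r0 d1 by (auto simp: a_def b_def supp_def)
qed

lemma idempotent_cases:
  fixes e :: "hidx \<Rightarrow> 'a"
  assumes e: "e \<in> HC" and idem: "e \<odot> e = e" and "e \<noteq> 0"
  shows "\<exists>i. e = aV i"
proof -
  obtain b where b: "b \<in> supp e" using \<open>e \<noteq> 0\<close> by (auto simp: supp_def vec_eq)
  then obtain i where i: "A i \<in> supp e"
    using idempotent_no_S[OF e idem] idempotent_no_P[OF e idem] by (cases b) auto
  have "e c = aV i c" for c
  proof (cases c)
    case (A n)
    show ?thesis
    proof (cases "n = i")
      case True
      then show ?thesis using A idempotent_single_A(2)[OF e idem i i] by (simp add: basis_apply)
    next
      case False
      then have "A n \<notin> supp e" using idempotent_single_A(1)[OF e idem i, of n] by blast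
      then show ?thesis using A False by (simp add: basis_apply supp_def)
    qed
  next
    case (S j)
    then show ?thesis using idempotent_no_S[OF e idem, of j] by (simp add: basis_apply supp_def)
  next
    case (P r k)
    then show ?thesis using idempotent_no_P[OF e idem, of r k] by (simp add: basis_apply supp_def)
  qed
  then show ?thesis by blast
qed

section \<open>Automorphisms are dihedral\<close>

lemma alg_aut_aV_translation:
  assumes aut: "alg_aut Hhat \<phi>"
  shows "\<exists>e c. (e = 1 \<or> e = - 1) \<and> \<phi> (aV 0 :: hidx \<Rightarrow> 'a) = aV c \<and> \<phi> (aV 1) = aV (e + c)"
proof -
  have inj: "inj_on \<phi> HC" and surj: "\<phi> ` HC = HC"
    using aut by (auto simp: alg_aut_def bij_betw_def)
  have add: "\<phi> (x + y) = \<phi> x + \<phi> y" and mult: "\<phi> (x \<odot> y) = \<phi> x \<odot> \<phi> y" if "x \<in> HC" "y \<in> HC" for x y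
    using aut that by (auto simp: alg_aut_def)
  have smult: "\<phi> (sm c x) = sm c (\<phi> x)" if "x \<in> HC" for x c
    using aut that by (auto simp: alg_aut_def)
  have in_C: "\<phi> x \<in> HC" if "x \<in> HC" for x using surj that by blast
  have zero: "\<phi> 0 = 0" using smult[of 0 0] by simp
  have aV_neq: "aV i \<noteq> (0 :: hidx \<Rightarrow> 'a)" for i
  proof
    assume "aV i = (0 :: hidx \<Rightarrow> 'a)"
    from fun_cong[OF this, of "A i"] show False by (simp add: basis_apply zero_fun_apply)
  qed
  have aV_inj: "aV i = (aV j :: hidx \<Rightarrow> 'a) \<Longrightarrow> i = j" for i j
    by (drule fun_cong[of _ _ "A i"]) (simp add: basis_apply split: if_splits)
  have aV_idem: "aV i \<odot> aV i = (aV i :: hidx \<Rightarrow> 'a)" for i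
    unfolding aV_mult_aV by (rule vec_scale) (simp add: zI_def vec_eq vec_norm)
  have "\<exists>j. \<phi> (aV i) = aV j" for i
  proof (rule idempotent_cases)
    show "\<phi> (aV i) \<odot> \<phi> (aV i) = \<phi> (aV i)" by (simp add: aV_idem flip: mult)
    show "\<phi> (aV i) \<noteq> 0" using inj_onD[OF inj, of "aV i" 0] aV_neq[of i] zero by auto
  qed (simp add: in_C)
  then obtain \<pi> where \<pi>: "\<And>i. \<phi> (aV i) = aV (\<pi> i)" by metis
  have \<pi>_inj: "\<pi> i = \<pi> j \<Longrightarrow> i = j" for i j
    using inj_onD[OF inj, of "aV i" "aV j"] aV_inj[of i j] by (simp add: \<pi>)
  have \<pi>_surj: "\<exists>i. \<pi> i = j" for j
  proof -
    obtain y where y: "y \<in> HC" "\<phi> y = aV j" using surj aV_in[of j] by (metis imageE)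
    have "\<phi> (y \<odot> y) = \<phi> y" using y by (simp add: mult aV_idem)
    then have "y \<odot> y = y" using inj_onD[OF inj] y by (metis hmul_in)
    moreover have "y \<noteq> 0" using y zero aV_neq by metis
    ultimately obtain i where "y = aV i" using idempotent_cases y by blast
    then show ?thesis using y \<pi> aV_inj by metis
  qed
  define D where "D = \<bar>\<pi> 1 - \<pi> 0\<bar>"
  have step: "\<bar>\<pi> (i + 1) - \<pi> i\<bar> = D" for i
  proof -
    \<comment> \<open>Every consecutive pair \<open>aV i\<close>, \<open>aV (i + 1)\<close> yields
      the same \<open>sI 1\<close>, so the position of the single \<open>S\<close>-coefficient of
      its image is the distance of \<open>\<pi> i\<close> and \<open>\<pi> (i + 1)\<close> for all
      \<open>i\<close> at once.\<close>
    have s1: "\<phi> (sI 1) (S (nat n)) = (if n = \<bar>\<pi> (i + 1) - \<pi> i\<bar> then 1 else 0)" if "n > 0" for i n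
    proof -
      have "sI 1 = aV i \<odot> aV (i + 1) - (sm hf (aV i) + sm hf (aV (i + 1)))"
        by (simp add: aV_mult_aV' zI_def pI_small sm_distribs)
      then have "sI 1 + (sm hf (aV i) + sm hf (aV (i + 1))) = aV i \<odot> aV (i + 1)" by simp
      then have "\<phi> (sI 1 + (sm hf (aV i) + sm hf (aV (i + 1)))) = aV (\<pi> i) \<odot> aV (\<pi> (i + 1))"
        by (simp add: mult \<pi>)
      then have "\<phi> (sI 1) + (sm hf (aV (\<pi> i)) + sm hf (aV (\<pi> (i + 1)))) = aV (\<pi> i) \<odot> aV (\<pi> (i + 1))"
        by (simp add: add smult \<pi>)
      from fun_cong[OF this, of "S (nat n)"] show ?thesis
        using that by (auto simp: aV_mult_aV' basis_apply vec_eq sI_def zI_conv)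
    qed
    have "D > 0" using \<pi>_inj[of 1 0] by (auto simp: D_def)
    then show ?thesis using s1[of D 0] s1[of D i] by (auto simp: D_def split: if_splits)
  qed
  \<comment> \<open>All values of \<open>\<pi>\<close> are congruent modulo \<open>D\<close>, so
    surjectivity forces \<open>D = 1\<close>.\<close>
  have "D dvd \<pi> i - \<pi> 0" for i
  proof (induction i rule: int_induct[where k = 0])
    case (step1 i)
    have "D dvd \<pi> (i + 1) - \<pi> i" using step[of i] by (metis dvd_abs_iff dvd_refl)
    then have "D dvd (\<pi> (i + 1) - \<pi> i) + (\<pi> i - \<pi> 0)" using step1 by (intro dvd_add)
    then show ?case by simp
  next
    case (step2 i)
    have *: "D dvd \<pi> i - \<pi> (i - 1)" using step[of "i - 1"] by (metis diff_add_cancel dvd_abs_iff dvd_refl)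
    have "D dvd (\<pi> i - \<pi> 0) - (\<pi> i - \<pi> (i - 1))" by (rule dvd_diff[OF step2.IH *])
    then show ?case by simp
  qed simp
  moreover obtain i where "\<pi> i = \<pi> 0 + 1" using \<pi>_surj by blast
  ultimately have "D dvd 1" by (metis add_diff_cancel_left')
  then have "\<pi> 1 - \<pi> 0 = 1 \<or> \<pi> 1 - \<pi> 0 = - 1" by (auto simp: D_def)
  then show ?thesis using \<pi> by (intro exI[of _ "\<pi> 1 - \<pi> 0"] exI[of _ "\<pi> 0"]) auto
qed

text \<open>The set on which two homomorphisms agree is a subalgebra; here it contains the
  generators \<open>aV 0\<close> and \<open>aV 1\<close>.\<close>

lemma alg_aut_eq_dih:
  assumes aut: "alg_aut Hhat \<phi>"
  shows "\<exists>e c. (e = 1 \<or> e = - 1) \<and> (\<forall>x\<in>HC. \<phi> x = dih e c x)"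
proof -
  obtain e c where ec: "e = 1 \<or> e = - 1" "\<phi> (aV 0 :: hidx \<Rightarrow> 'a) = aV c" "\<phi> (aV 1 :: hidx \<Rightarrow> 'a) = aV (e + c)"
    using alg_aut_aV_translation[OF aut] by blast
  have hom: "\<phi> (x + y) = \<phi> x + \<phi> y" "\<phi> (x \<odot> y) = \<phi> x \<odot> \<phi> y" "\<phi> (sm k x) = sm k (\<phi> x)"
    if "x \<in> HC" "y \<in> HC" for x y k
    using aut that by (auto simp: alg_aut_def)
  have "{x \<in> HC. \<phi> x = dih e c x} = HC"
    by (rule hat_generated) (use ec in \<open>auto simp: alg_closed_def hom dih_lin dih_hmul\<close>)
  then show ?thesis using ec(1) by blast
qed

end

theorem theorem1p4:
  assumes char2: "(2::'a::field) \<noteq> 0" and char3: "(3::'a) \<noteq> 0"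
  shows "(\<forall>I \<phi>. alg_ideal (Hhat :: (hidx \<Rightarrow> 'a, 'a) alg) I \<and> alg_aut Hhat \<phi> \<longrightarrow> \<phi> ` I \<subseteq> I)
       \<and> (\<forall>I. alg_ideal (Hhat :: (hidx \<Rightarrow> 'a, 'a) alg) I \<and> I \<noteq> acar Hhat \<longrightarrow>
            alg_symmetric (quot_alg Hhat I) (coset Hhat I (aV 0)) (coset Hhat I (aV 1)))
       \<and> (\<forall>I. alg_ideal (Highwater :: (hidx \<Rightarrow> 'a, 'a) alg) I \<and> I \<noteq> acar Highwater \<longrightarrow>
            alg_symmetric (quot_alg Highwater I) (coset Highwater I (aV 0)) (coset Highwater I (aV 1)))"
proof -
  interpret char_not_2_3 "1 / 2 :: 'a"
    by standard (use char2 char3 in simp_all)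
  have inv: "dih e c x \<in> I" if "alg_ideal Hhat I" "e = 1 \<or> e = - 1" "x \<in> I" for I e c and x :: "hidx \<Rightarrow> 'a"
  proof -
    interpret hat_ideal "1 / 2 :: 'a" I by standard (fact that(1))
    show ?thesis using that by (intro dih_in_I)
  qed
  have flip: "dih (- 1) 1 (dih (- 1) 1 x) = x" if "x \<in> HC" for x
    using that by (simp add: dih_comp dih_id)
  have "\<phi> ` I \<subseteq> I" if I: "alg_ideal (Hhat :: (hidx \<Rightarrow> 'a, 'a) alg) I" and "alg_aut Hhat \<phi>" for I \<phi>
  proof -
    obtain e c where ec: "e = 1 \<or> e = - 1" "\<forall>x\<in>HC. \<phi> x = dih e c x"
      using alg_aut_eq_dih[OF \<open>alg_aut Hhat \<phi>\<close>] by blast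
    have "I \<subseteq> HC" using I by (auto simp: alg_ideal_def)
    then show ?thesis using ec inv[OF I ec(1)] by auto
  qed
  moreover have "alg_symmetric (quot_alg Hhat I) (coset Hhat I (aV 0)) (coset Hhat I (aV 1))"
    if I: "alg_ideal (Hhat :: (hidx \<Rightarrow> 'a, 'a) alg) I" for I
  proof -
    interpret vec_quotient valid_hat bprod_hat I
      by standard (use I in \<open>simp_all add: bprod_hat_in Hhat_eq\<close>)
    have gen: "X = HC" if "alg_closed (vec_alg valid_hat bprod_hat) X" "aV 0 \<in> X" "aV 1 \<in> X" for X :: "(hidx \<Rightarrow> 'a) set"
      using that by (intro hat_generated) (simp_all add: Hhat_eq)
    show ?thesis
      unfolding Hhat_eq
      by (rule quotient_symmetric[where f = "dih (- 1) 1"])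
        (auto simp: gen flip dih_hmul inv[OF I])
  qed
  moreover have "alg_symmetric (quot_alg Highwater I) (coset Highwater I (aV 0)) (coset Highwater I (aV 1))"
    if I: "alg_ideal (Highwater :: (hidx \<Rightarrow> 'a, 'a) alg) I" for I
  proof -
    interpret vec_quotient valid_hw bprod_hw I
      by standard (use I in \<open>simp_all add: bprod_hw_in Highwater_eq\<close>)
    \<comment> \<open>The preimage of \<open>I\<close> under \<open>hw_part\<close> is an ideal to
      which the dihedral invariance applies; \<open>hw_part\<close> commutes with the flip and
      carries the invariance back to \<open>I\<close>.\<close>
    define J where "J = {x \<in> HC. hw_part x \<in> I}"
    have J: "alg_ideal Hhat J"
      unfolding alg_ideal_def J_def
      by (auto simp: hw_part_lin[of _ valid_hat] hw_part_zero hw_part_hmul hw_part_in I_add I_sm I_zero I_mult I_mult'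
          intro!: exI[of _ 0])
    have gen: "X = vecs valid_hw" if X: "alg_closed (vec_alg valid_hw bprod_hw) X" "aV 0 \<in> X" "aV 1 \<in> X" for X :: "(hidx \<Rightarrow> 'a) set"
    proof -
      \<comment> \<open>Generation is transferred through preimages in the same way.\<close>
      have "{x \<in> HC. hw_part x \<in> X} = HC"
        by (rule hat_generated)
          (use X in \<open>auto simp: alg_closed_def hw_part_lin[of _ valid_hat] hw_part_hmul hw_part_aV\<close>)
      then have "x \<in> X" if "x \<in> vecs valid_hw" for x
        using hw_part_id[OF that] hw_subset[OF that] by (metis (mono_tags, lifting) mem_Collect_eq)
      then show ?thesis using X(1) by (auto simp: alg_closed_def)
    qed
    have hw_mult: "bilin_mult bprod_hw x y = hw_part (x \<odot> y)" if "x \<in> vecs valid_hw" "y \<in> vecs valid_hw" for x y :: "hidx \<Rightarrow> 'a"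
      using that by (simp add: hw_part_hmul hw_subset hw_part_id)
    have hom: "dih (- 1) 1 (bilin_mult bprod_hw x y) = bilin_mult bprod_hw (dih (- 1) 1 x) (dih (- 1) 1 y)"
      if "x \<in> vecs valid_hw" "y \<in> vecs valid_hw" for x y :: "hidx \<Rightarrow> 'a"
      using that by (simp add: hw_mult dih_hw_in hw_subset dih_hmul flip: hw_part_dih)
    have "dih (- 1) 1 x \<in> I" if "x \<in> I" for x
    proof -
      have hw: "x \<in> vecs valid_hw" using that by (rule I_in)
      then have "x \<in> J" using that by (simp add: J_def hw_part_id hw_subset)
      then have "hw_part (dih (- 1) 1 x) \<in> I" using inv[OF J, of "- 1" x 1] by (simp add: J_def)
      then show ?thesis using hw by (simp add: hw_part_id dih_hw_in)
    qed
    then show ?thesis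
      unfolding Highwater_eq
      by (intro quotient_symmetric[where f = "dih (- 1) 1"])
        (simp_all add: gen flip hom dih_hw_in hw_subset, simp add: dih_def)
  qed
  ultimately show ?thesis by blast
qed

end
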